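(* Let $\Bbbk$ be a field. (1) $\operatorname{der}(\mathcal{A}ss)\cong \Bbbk$ and $H^1(\mathcal{A}ss)=0$. (2) $\operatorname{der}(\mathcal{C}om)\cong \Bbbk$ and $H^1(\mathcal{C}om)=0$. (3) $\operatorname{der}(\mathcal{L}ie)\cong \Bbbk$ and $H^1(\mathcal{L}ie)=0$. (4) $\operatorname{der}(\mathcal{P}ois)\cong \Bbbk\oplus \Bbbk$, the 2-dimensional abelian Lie algebra, and $H^1(\mathcal{P}ois)\cong \Bbbk$.
   Context: $\Bbbk$ is a field. An operad is a symmetric $\Bbbk$-linear operad $\mathcal{P}=(\mathcal{P}(n))_{n\ge 0}$: right $\Bbbk\mathbb{S}_n$-modules $\mathcal{P}(n)$ (action written $\ast$), an identity $\mathbf{1}\in\mathcal{P}(1)$, and partial compositions $-\circ_i-:\mathcal{P}(m)\otimes\mathcal{P}(n)\to\mathcal{P}(m+n-1)$ ($m\ge1$, $n\ge0$, $1\le i\le m$) satisfying the usual identity, associativity and equivariance axioms. A derivation of $\mathcal{P}$ is an arity-preserving $\Bbbk$-linear map $\partial:\mathcal{P}\to\mathcal{P}$, commuting with the $\mathbb{S}_n$-actions, with $\partial(\mu\circ_i\nu)=\partial(\mu)\circ_i\nu+\mu\circ_i\partial(\nu)$ for all $\mu\in\mathcal{P}(m)$, $\nu\in\mathcal{P}(n)$, $1\le i\le m$. $\operatorname{der}(\mathcal{P})$ is the Lie algebra (under the commutator) of derivations. For $\lambda\in\mathcal{P}(1)$ the inner derivation $\operatorname{ad}_\lambda$ is $\operatorname{ad}_\lambda(\theta)=\lambda\circ_1\theta-\sum_{i=1}^n\theta\circ_i\lambda$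 for $\theta\in\mathcal{P}(n)$; $\operatorname{ider}(\mathcal{P})$ is the set of inner derivations, a Lie ideal, and $H^1(\mathcal{P}):=\operatorname{der}(\mathcal{P})/\operatorname{ider}(\mathcal{P})$. The operads: $\mathcal{A}ss$ encodes unital associative algebras ($\mathcal{A}ss(n)=\Bbbk\mathbb{S}_n$ for all $n\ge0$). $\mathcal{C}om$ encodes unital commutative associative algebras ($\mathcal{C}om(n)=\Bbbk$ with trivial action for all $n\ge0$). $\mathcal{L}ie$ encodes Lie algebras: $\mathcal{L}ie(0)=0$ and it is generated by $\mathfrak{b}\in\mathcal{L}ie(2)$ with relations $\mathfrak{b}\ast(12)=-\mathfrak{b}$ and $\mathfrak{b}\circ_2\mathfrak{b}=\mathfrak{b}\circ_1\mathfrak{b}+(\mathfrak{b}\circ_2\mathfrak{b})\ast(12)$. $\mathcal{P}ois$ encodes unital commutative Poisson algebras: it is generated by $\mathbf{1}_0\in\mathcal{P}ois(0)$ and $\mathbf{1}_2,\mathfrak{b}\in\mathcal{P}ois(2)$ with relations $\mathbf{1}_2\circ_1\mathbf{1}_0=\mathbf{1}_2\circ_2\mathbf{1}_0=\mathbf{1}$; $\mathfrak{b}\circ_1\mathbf{1}_0=\mathfrak{b}\circ_2\mathbf{1}_0=0$; $\mathbf{1}_2\ast(12)=\mathbf{1}_2$; $\mathfrak{b}\ast(12)=-\mathfrak{b}$; $\mathbf{1}_2\circ_1\mathbf{1}_2=\mathbf{1}_2\circ_2\mathbf{1}_2$; $\mathfrak{b}\circ_1\mathbf{1}_2=\mathbf{1}_2\circ_2\mathfrak{b}+(\mathbf{1}_2\circ_2\mathfrak{b})\ast(12)$;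 $\mathfrak{b}\circ_2\mathfrak{b}=\mathfrak{b}\circ_1\mathfrak{b}+(\mathfrak{b}\circ_2\mathfrak{b})\ast(12)$.
   Formalization: Part (4) is proved only for fields of characteristic other than 2; in characteristic 2 it is false, since 1_0 ↦ 0, 1_2 ↦ b, b ↦ 0 defines a further non-inner derivation of Pois. Parts (1)–(3) hold over every field. *)

theory Defs
  imports "HOL-Algebra.AbelCoset" "HOL-Algebra.Module" "HOL-Combinatorics.Permutations"
begin

section \<open>Symmetric operads\<close>

text \<open>
  The symmetric group on n letters is \<open>{\<sigma>. \<sigma> permutes {1..n}}\<close> with composition of functions
  as product. As always in HOL-Algebra, a module record inherits the fields \<open>mult\<close> and \<open>one\<close>
  from the ring record; they carry no meaning for a module and are left undefined below.
\<close>

record ('k, 'a) operad =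
  comps :: "nat \<Rightarrow> ('k, 'a) module"
  act   :: "nat \<Rightarrow> 'a \<Rightarrow> (nat \<Rightarrow> nat) \<Rightarrow> 'a"  \<comment> \<open>\<open>act P n x \<sigma>\<close> is \<open>x \<^emph> \<sigma>\<close> in arity n\<close>
  ident :: 'a
  pcomp :: "nat \<Rightarrow> nat \<Rightarrow> nat \<Rightarrow> 'a \<Rightarrow> 'a \<Rightarrow> 'a"
    \<comment> \<open>\<open>pcomp P m n i \<mu> \<nu>\<close> is the i-th partial composition of \<open>\<mu>\<close> in arity m with \<open>\<nu>\<close> in arity n\<close>

text \<open>
  \<open>perm_ins m n i \<sigma> \<tau>\<close> is the permutation of \<open>{1..m + n - 1}\<close> obtained from \<open>\<sigma>\<close> by replacing
  the letter i with a block of n letters permuted by \<open>\<tau>\<close>; for n = 0 the letter i is deleted.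
  In terms of words: if a permutation is read as the word \<open>inv \<sigma> 1, ..., inv \<sigma> m\<close>, the letter i is
  replaced by the word of \<open>\<tau>\<close> shifted by i - 1, and every letter above i is shifted by n - 1.
\<close>

definition perm_ins :: "nat \<Rightarrow> nat \<Rightarrow> nat \<Rightarrow> (nat \<Rightarrow> nat) \<Rightarrow> (nat \<Rightarrow> nat) \<Rightarrow> nat \<Rightarrow> nat" where
  "perm_ins m n i \<sigma> \<tau> l =
    (if l \<notin> {1..m + n - 1} then l
     else if i \<le> l \<and> l < i + n then \<sigma> i - 1 + \<tau> (l + 1 - i)
     else let j = (if l < i then l else l + 1 - n)
          in if \<sigma> j < \<sigma> i then \<sigma> j else \<sigma> j + n - 1)"

lemma perm_ins_permutes:
  assumes s: "\<sigma> permutes {1..m}" and t: "\<tau> permutes {1..n}" and i: "1 \<le> i" "i \<le> m"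
  shows "perm_ins m n i \<sigma> \<tau> permutes {1..m + n - 1}"
proof -
  let ?f = "perm_ins m n i \<sigma> \<tau>"
  have s1: "1 \<le> \<sigma> j \<and> \<sigma> j \<le> m" if "1 \<le> j" "j \<le> m" for j
    using permutes_in_image[OF s, of j] that by auto
  have t1: "1 \<le> \<tau> j \<and> \<tau> j \<le> n" if "1 \<le> j" "j \<le> n" for j
    using permutes_in_image[OF t, of j] that by auto
  have si: "\<sigma> x = \<sigma> y \<longleftrightarrow> x = y" for x y using permutes_inj[OF s] by (auto simp: inj_def)
  have ti: "\<tau> x = \<tau> y \<longleftrightarrow> x = y" for x y using permutes_inj[OF t] by (auto simp: inj_def)
  have A: "?f l = \<sigma> i - 1 + \<tau> (l + 1 - i)" if "i \<le> l" "l < i + n" for l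
    using that i by (auto simp: perm_ins_def)
  have B: "?f l = (if \<sigma> l < \<sigma> i then \<sigma> l else \<sigma> l + n - 1)" if "1 \<le> l" "l < i" for l
    using that i by (auto simp: perm_ins_def)
  have C: "?f l = (if \<sigma> (l + 1 - n) < \<sigma> i then \<sigma> (l + 1 - n) else \<sigma> (l + 1 - n) + n - 1)"
    if "i + n \<le> l" "l \<le> m + n - 1" for l
    using that i by (auto simp: perm_ins_def Let_def)
  have "?f ` {1..m + n - 1} \<subseteq> {1..m + n - 1}"
  proof clarsimp
    fix l assume l: "Suc 0 \<le> l" "l \<le> m + n - Suc 0"
    consider "i \<le> l" "l < i + n" | "1 \<le> l" "l < i" | "i + n \<le> l" "l \<le> m + n - 1"
      using l by force
    then show "Suc 0 \<le> ?f l \<and> ?f l \<le> m + n - Suc 0"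
    proof cases
      case 1 have "1 \<le> l + 1 - i \<and> l + 1 - i \<le> n" using 1 by auto
      then show ?thesis using A[OF 1] s1[of i] t1[of "l + 1 - i"] i by auto
    next
      case 2 then show ?thesis using B[OF 2] s1[of i] s1[of l] si[of l i] i by auto
    next
      case 3 have "1 \<le> l + 1 - n \<and> l + 1 - n \<le> m" using 3 i by auto
      then have "1 \<le> \<sigma> (l + 1 - n)" "\<sigma> (l + 1 - n) \<le> m" "\<sigma> (l + 1 - n) \<noteq> \<sigma> i" "1 \<le> \<sigma> i"  "\<sigma> i \<le> m"
        using s1[of i] s1[of "l + 1 - n"] si[of "l+1-n" i] i 3 by auto
      then show ?thesis using C[OF 3] by (cases "\<sigma> (l + 1 - n) < \<sigma> i"; simp; arith?)
    qed
  qed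
  moreover have "inj_on ?f {1..m + n - 1}"
  proof (rule linorder_inj_onI)
    fix x y assume xy: "x < y" "x \<in> {1..m + n - 1}" "y \<in> {1..m + n - 1}"
    consider "i \<le> x" "x < i + n" | "1 \<le> x" "x < i" | "i + n \<le> x" "x \<le> m + n - 1"
      using xy by force
    note cx = this
    consider "i \<le> y" "y < i + n" | "1 \<le> y" "y < i" | "i + n \<le> y" "y \<le> m + n - 1"
      using xy by force
    note cy = this
    have I: "1 \<le> \<sigma> i" "\<sigma> i \<le> m" using s1 i by auto
    have A': "1 \<le> \<tau> (l + 1 - i) \<and> \<tau> (l + 1 - i) \<le> n" if "i \<le> l" "l < i + n" for l
      using that by (intro t1) auto
    have B': "1 \<le> \<sigma> l \<and> \<sigma> l \<le> m \<and> \<sigma> l \<noteq> \<sigma> i" if "1 \<le> l" "l < i" for l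
      using that s1[of l] si i by auto
    have C': "1 \<le> \<sigma> (l+1-n) \<and> \<sigma> (l+1-n) \<le> m \<and> \<sigma> (l+1-n) \<noteq> \<sigma> i \<and> l+1-n > i" if "i + n \<le> l" "l \<le> m + n - 1" for l
    proof -
      have "1 \<le> l+1-n" "l+1-n \<le> m" "l+1-n > i" using that i by auto
      then show ?thesis using s1[of "l+1-n"] si by auto
    qed
    show "?f x \<noteq> ?f y"
    proof (rule cx; rule cy)
      assume "i \<le> x" "x < i + n" and "i \<le> y" "y < i + n"
      then show ?thesis using A A' I ti[of "x+1-i" "y+1-i"] xy by auto
    next
      assume a: "i \<le> x" "x < i + n" and b: "i + n \<le> y" "y \<le> m + n - 1"
      show ?thesis unfolding A[OF a] C[OF b] using A'[OF a] C'[OF b] I by (auto simp del: One_nat_def)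
    next
      assume b: "1 \<le> x" "x < i" and a: "i \<le> y" "y < i + n"
      show ?thesis unfolding A[OF a] B[OF b] using A'[OF a] B'[OF b] I by (auto simp del: One_nat_def)
    next
      assume a: "1 \<le> x" "x < i" and b: "1 \<le> y" "y < i"
      show ?thesis unfolding B[OF a] B[OF b] using B'[OF a] B'[OF b] I si[of x y] xy by (auto simp del: One_nat_def)
    next
      assume a: "1 \<le> x" "x < i" and b: "i + n \<le> y" "y \<le> m + n - 1"
      have "\<sigma> x \<noteq> \<sigma> (y+1-n)" using si a C'[OF b] by auto
      then show ?thesis unfolding B[OF a] C[OF b] using B'[OF a] C'[OF b] I by (auto simp del: One_nat_def)
    next
      assume a: "i + n \<le> x" "x \<le> m + n - 1" and b: "i + n \<le> y" "y \<le> m + n - 1"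
      have "\<sigma> (x+1-n) \<noteq> \<sigma> (y+1-n)" using si a b xy by auto
      moreover have "u \<noteq> v \<Longrightarrow> u \<noteq> w \<Longrightarrow> v \<noteq> w \<Longrightarrow> 1 \<le> w \<Longrightarrow> (if u < w then u else u + n - 1) \<noteq> (if v < w then v else v + n - 1)" for u v w :: nat
        by (auto split: if_splits)
      ultimately show ?thesis unfolding C[OF a] C[OF b] using C'[OF a] C'[OF b] I by metis
    qed (use xy in auto)
  qed auto
  ultimately have "bij_betw ?f {1..m + n - 1} {1..m + n - 1}"
    by (metis bij_betw_def endo_inj_surj finite_atLeastAtMost)
  then show ?thesis by (rule bij_imp_permutes) (auto simp: perm_ins_def)
qed

locale operad =
  fixes K (structure) and P :: "(_, _) operad"
  assumes field: "field K"
    and comps_module: "module K (comps P n)"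
    and act_closed: "\<lbrakk>x \<in> carrier (comps P n); \<sigma> permutes {1..n}\<rbrakk> \<Longrightarrow> act P n x \<sigma> \<in> carrier (comps P n)"
    and act_add: "\<lbrakk>x \<in> carrier (comps P n); y \<in> carrier (comps P n); \<sigma> permutes {1..n}\<rbrakk>
      \<Longrightarrow> act P n (x \<oplus>\<^bsub>comps P n\<^esub> y) \<sigma> = act P n x \<sigma> \<oplus>\<^bsub>comps P n\<^esub> act P n y \<sigma>"
    and act_smult: "\<lbrakk>c \<in> carrier K; x \<in> carrier (comps P n); \<sigma> permutes {1..n}\<rbrakk>
      \<Longrightarrow> act P n (c \<odot>\<^bsub>comps P n\<^esub> x) \<sigma> = c \<odot>\<^bsub>comps P n\<^esub> act P n x \<sigma>"
    and act_id: "x \<in> carrier (comps P n) \<Longrightarrow> act P n x id = x"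
    and act_comp: "\<lbrakk>x \<in> carrier (comps P n); \<sigma> permutes {1..n}; \<tau> permutes {1..n}\<rbrakk>
      \<Longrightarrow> act P n (act P n x \<sigma>) \<tau> = act P n x (\<sigma> \<circ> \<tau>)"
    and ident_closed: "ident P \<in> carrier (comps P 1)"
    and pcomp_closed: "\<lbrakk>x \<in> carrier (comps P m); y \<in> carrier (comps P n); 1 \<le> i; i \<le> m\<rbrakk>
      \<Longrightarrow> pcomp P m n i x y \<in> carrier (comps P (m + n - 1))"
    and pcomp_add_left: "\<lbrakk>x \<in> carrier (comps P m); x' \<in> carrier (comps P m);
        y \<in> carrier (comps P n); 1 \<le> i; i \<le> m\<rbrakk>
      \<Longrightarrow> pcomp P m n i (x \<oplus>\<^bsub>comps P m\<^esub> x') y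
          = pcomp P m n i x y \<oplus>\<^bsub>comps P (m + n - 1)\<^esub> pcomp P m n i x' y"
    and pcomp_add_right: "\<lbrakk>x \<in> carrier (comps P m); y \<in> carrier (comps P n);
        y' \<in> carrier (comps P n); 1 \<le> i; i \<le> m\<rbrakk>
      \<Longrightarrow> pcomp P m n i x (y \<oplus>\<^bsub>comps P n\<^esub> y')
          = pcomp P m n i x y \<oplus>\<^bsub>comps P (m + n - 1)\<^esub> pcomp P m n i x y'"
    and pcomp_smult_left: "\<lbrakk>c \<in> carrier K; x \<in> carrier (comps P m);
        y \<in> carrier (comps P n); 1 \<le> i; i \<le> m\<rbrakk>
      \<Longrightarrow> pcomp P m n i (c \<odot>\<^bsub>comps P m\<^esub> x) y = c \<odot>\<^bsub>comps P (m + n - 1)\<^esub> pcomp P m n i x y"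
    and pcomp_smult_right: "\<lbrakk>c \<in> carrier K; x \<in> carrier (comps P m);
        y \<in> carrier (comps P n); 1 \<le> i; i \<le> m\<rbrakk>
      \<Longrightarrow> pcomp P m n i x (c \<odot>\<^bsub>comps P n\<^esub> y) = c \<odot>\<^bsub>comps P (m + n - 1)\<^esub> pcomp P m n i x y"
    and ident_left: "y \<in> carrier (comps P n) \<Longrightarrow> pcomp P 1 n 1 (ident P) y = y"
    and ident_right: "\<lbrakk>x \<in> carrier (comps P m); 1 \<le> i; i \<le> m\<rbrakk> \<Longrightarrow> pcomp P m 1 i x (ident P) = x"
    and assoc_sequential: "\<lbrakk>x \<in> carrier (comps P l); y \<in> carrier (comps P m);
        z \<in> carrier (comps P n); 1 \<le> i; i \<le> l; 1 \<le> j; j \<le> m\<rbrakk>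
      \<Longrightarrow> pcomp P (l + m - 1) n (i + j - 1) (pcomp P l m i x y) z
          = pcomp P l (m + n - 1) i x (pcomp P m n j y z)"
    and assoc_parallel: "\<lbrakk>x \<in> carrier (comps P l); y \<in> carrier (comps P m);
        z \<in> carrier (comps P n); 1 \<le> i; i < k; k \<le> l\<rbrakk>
      \<Longrightarrow> pcomp P (l + m - 1) n (k + m - 1) (pcomp P l m i x y) z
          = pcomp P (l + n - 1) m i (pcomp P l n k x z) y"
    and equivariant: "\<lbrakk>x \<in> carrier (comps P m); y \<in> carrier (comps P n);
        \<sigma> permutes {1..m}; \<tau> permutes {1..n}; 1 \<le> i; i \<le> m\<rbrakk>
      \<Longrightarrow> pcomp P m n i (act P m x \<sigma>) (act P n y \<tau>)
          = act P (m + n - 1) (pcomp P m n (\<sigma> i) x y) (perm_ins m n i \<sigma> \<tau>)"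


section \<open>Lie algebras\<close>

record ('k, 'a) lie_algebra = "('k, 'a) module" +
  bracket :: "'a \<Rightarrow> 'a \<Rightarrow> 'a"

definition lie_iso ::
  "('k, 'r) ring_scheme \<Rightarrow> ('k, 'a) lie_algebra \<Rightarrow> ('k, 'b) lie_algebra \<Rightarrow> bool" where
  "lie_iso K L M \<longleftrightarrow> (\<exists>f. bij_betw f (carrier L) (carrier M) \<and>
    (\<forall>x\<in>carrier L. \<forall>y\<in>carrier L. f (x \<oplus>\<^bsub>L\<^esub> y) = f x \<oplus>\<^bsub>M\<^esub> f y) \<and>
    (\<forall>c\<in>carrier K. \<forall>x\<in>carrier L. f (c \<odot>\<^bsub>L\<^esub> x) = c \<odot>\<^bsub>M\<^esub> f x) \<and>
    (\<forall>x\<in>carrier L. \<forall>y\<in>carrier L. f (bracket L x y) = bracket M (f x) (f y)))"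

definition lie_trivial :: "('k, 'a) lie_algebra \<Rightarrow> bool" where
  "lie_trivial L \<longleftrightarrow> carrier L = {\<zero>\<^bsub>L\<^esub>}"

text \<open>The ground field as the one-dimensional abelian Lie algebra, and direct sums.\<close>

definition lie_base :: "('k, 'r) ring_scheme \<Rightarrow> ('k, 'k) lie_algebra" where
  "lie_base K = \<lparr>carrier = carrier K, monoid.mult = undefined, monoid.one = undefined,
     ring.zero = \<zero>\<^bsub>K\<^esub>, add = (\<oplus>\<^bsub>K\<^esub>), smult = (\<otimes>\<^bsub>K\<^esub>), bracket = (\<lambda>x y. \<zero>\<^bsub>K\<^esub>)\<rparr>"

definition lie_dsum ::
  "('k, 'a) lie_algebra \<Rightarrow> ('k, 'b) lie_algebra \<Rightarrow> ('k, 'a \<times> 'b) lie_algebra" where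
  "lie_dsum L M = \<lparr>carrier = carrier L \<times> carrier M, monoid.mult = undefined, monoid.one = undefined,
     ring.zero = (\<zero>\<^bsub>L\<^esub>, \<zero>\<^bsub>M\<^esub>),
     add = (\<lambda>x y. (fst x \<oplus>\<^bsub>L\<^esub> fst y, snd x \<oplus>\<^bsub>M\<^esub> snd y)),
     smult = (\<lambda>c x. (c \<odot>\<^bsub>L\<^esub> fst x, c \<odot>\<^bsub>M\<^esub> snd x)),
     bracket = (\<lambda>x y. (bracket L (fst x) (fst y), bracket M (snd x) (snd y)))\<rparr>"

text \<open>The quotient by a Lie ideal I; its elements are the cosets \<open>I +> x\<close>.\<close>

definition lie_quotient :: "('k, 'a) lie_algebra \<Rightarrow> 'a set \<Rightarrow> ('k, 'a set) lie_algebra" where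
  "lie_quotient L I = \<lparr>carrier = a_rcosets\<^bsub>L\<^esub> I, monoid.mult = undefined, monoid.one = undefined,
     ring.zero = I,
     add = (\<lambda>X Y. X <+>\<^bsub>L\<^esub> Y),
     smult = (\<lambda>c X. \<Union>x\<in>X. I +>\<^bsub>L\<^esub> c \<odot>\<^bsub>L\<^esub> x),
     bracket = (\<lambda>X Y. \<Union>x\<in>X. \<Union>y\<in>Y. I +>\<^bsub>L\<^esub> bracket L x y)\<rparr>"


section \<open>Derivations\<close>

text \<open>
  An arity-preserving map is a family indexed by the arity. The members of the family are
  extensional (undefined outside the carrier), so that equality of families is equality of maps.
\<close>

definition derivation ::
  "('k, 'r) ring_scheme \<Rightarrow> ('k, 'a) operad \<Rightarrow> (nat \<Rightarrow> 'a \<Rightarrow> 'a) \<Rightarrow> bool" where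
  "derivation K P d \<longleftrightarrow>
    (\<forall>n. d n \<in> carrier (comps P n) \<rightarrow>\<^sub>E carrier (comps P n)) \<and>
    (\<forall>n. \<forall>x\<in>carrier (comps P n). \<forall>y\<in>carrier (comps P n).
       d n (x \<oplus>\<^bsub>comps P n\<^esub> y) = d n x \<oplus>\<^bsub>comps P n\<^esub> d n y) \<and>
    (\<forall>n. \<forall>c\<in>carrier K. \<forall>x\<in>carrier (comps P n).
       d n (c \<odot>\<^bsub>comps P n\<^esub> x) = c \<odot>\<^bsub>comps P n\<^esub> d n x) \<and>
    (\<forall>n. \<forall>x\<in>carrier (comps P n). \<forall>\<sigma>. \<sigma> permutes {1..n} \<longrightarrow>
       d n (act P n x \<sigma>) = act P n (d n x) \<sigma>) \<and>
    (\<forall>m n i. \<forall>x\<in>carrier (comps P m). \<forall>y\<in>carrier (comps P n). 1 \<le> i \<and> i \<le> m \<longrightarrow>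
       d (m + n - 1) (pcomp P m n i x y)
         = pcomp P m n i (d m x) y \<oplus>\<^bsub>comps P (m + n - 1)\<^esub> pcomp P m n i x (d n y))"

definition der ::
  "('k, 'r) ring_scheme \<Rightarrow> ('k, 'a) operad \<Rightarrow> ('k, nat \<Rightarrow> 'a \<Rightarrow> 'a) lie_algebra" where
  "der K P = \<lparr>carrier = {d. derivation K P d}, monoid.mult = undefined, monoid.one = undefined,
     ring.zero = (\<lambda>n. \<lambda>x\<in>carrier (comps P n). \<zero>\<^bsub>comps P n\<^esub>),
     add = (\<lambda>d e n. \<lambda>x\<in>carrier (comps P n). d n x \<oplus>\<^bsub>comps P n\<^esub> e n x),
     smult = (\<lambda>c d n. \<lambda>x\<in>carrier (comps P n). c \<odot>\<^bsub>comps P n\<^esub> d n x),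
     bracket = (\<lambda>d e n. \<lambda>x\<in>carrier (comps P n). d n (e n x) \<ominus>\<^bsub>comps P n\<^esub> e n (d n x))\<rparr>"

definition inner_der :: "('k, 'a) operad \<Rightarrow> 'a \<Rightarrow> nat \<Rightarrow> 'a \<Rightarrow> 'a" where
  "inner_der P u = (\<lambda>n. \<lambda>x\<in>carrier (comps P n).
     pcomp P 1 n 1 u x \<ominus>\<^bsub>comps P n\<^esub> (\<Oplus>\<^bsub>comps P n\<^esub>i\<in>{1..n}. pcomp P n 1 i x u))"

definition ider :: "('k, 'a) operad \<Rightarrow> (nat \<Rightarrow> 'a \<Rightarrow> 'a) set" where
  "ider P = inner_der P ` carrier (comps P 1)"

definition H1 ::
  "('k, 'r) ring_scheme \<Rightarrow> ('k, 'a) operad \<Rightarrow> ('k, (nat \<Rightarrow> 'a \<Rightarrow> 'a) set) lie_algebra" where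
  "H1 K P = lie_quotient (der K P) (ider P)"


section \<open>The associative and the commutative operad\<close>

text \<open>
  An element of the group algebra is its coefficient function on permutations. In \<open>Ass\<close> the group
  element \<open>\<sigma>\<close> is the operation taking \<open>x\<^sub>1, ..., x\<^sub>n\<close> to the product of the \<open>x\<close> with indices
  \<open>inv \<sigma> 1, ..., inv \<sigma> n\<close> in this order; on group elements the partial compositions
  are therefore \<open>perm_ins\<close>, and the right action is right multiplication.
\<close>

definition Ass :: "('k, 'r) ring_scheme \<Rightarrow> ('k, (nat \<Rightarrow> nat) \<Rightarrow> 'k) operad" where
  "Ass K = \<lparr>
     comps = (\<lambda>n. let S = {\<sigma>. \<sigma> permutes {1..n}} in
       \<lparr>carrier = S \<rightarrow>\<^sub>E carrier K, monoid.mult = undefined, monoid.one = undefined,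
        ring.zero = (\<lambda>\<pi>\<in>S. \<zero>\<^bsub>K\<^esub>),
        add = (\<lambda>f g. \<lambda>\<pi>\<in>S. f \<pi> \<oplus>\<^bsub>K\<^esub> g \<pi>),
        smult = (\<lambda>c f. \<lambda>\<pi>\<in>S. c \<otimes>\<^bsub>K\<^esub> f \<pi>)\<rparr>),
     act = (\<lambda>n f \<sigma>. \<lambda>\<pi>\<in>{\<pi>. \<pi> permutes {1..n}}. f (\<pi> \<circ> inv_into UNIV \<sigma>)),
     ident = (\<lambda>\<pi>\<in>{\<pi>. \<pi> permutes {1..1}}. \<one>\<^bsub>K\<^esub>),
     pcomp = (\<lambda>m n i f g. \<lambda>\<pi>\<in>{\<pi>. \<pi> permutes {1..m + n - 1}}.
       (\<Oplus>\<^bsub>K\<^esub>p\<in>{(\<sigma>, \<tau>). \<sigma> permutes {1..m} \<and> \<tau> permutes {1..n} \<and> perm_ins m n i \<sigma> \<tau> = \<pi>}.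
          f (fst p) \<otimes>\<^bsub>K\<^esub> g (snd p)))\<rparr>"

definition Com :: "('k, 'r) ring_scheme \<Rightarrow> ('k, 'k) operad" where
  "Com K = \<lparr>
     comps = (\<lambda>n. \<lparr>carrier = carrier K, monoid.mult = undefined, monoid.one = undefined,
        ring.zero = \<zero>\<^bsub>K\<^esub>, add = (\<oplus>\<^bsub>K\<^esub>), smult = (\<otimes>\<^bsub>K\<^esub>)\<rparr>),
     act = (\<lambda>n x \<sigma>. x),
     ident = \<one>\<^bsub>K\<^esub>,
     pcomp = (\<lambda>m n i x y. x \<otimes>\<^bsub>K\<^esub> y)\<rparr>"


lemma Com_operad:
  assumes "field K" shows "operad K (Com K)"
proof -
  interpret field K by fact
  have ex: "\<exists>y\<in>carrier K. y \<oplus>\<^bsub>K\<^esub> x = \<zero>\<^bsub>K\<^esub>" if "x \<in> carrier K" for x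
    using that by (metis l_neg a_inv_closed)
  have m: "module K (comps (Com K) n)" for n
    unfolding Com_def
    by (intro moduleI abelian_groupI) (auto simp: is_cring a_assoc m_assoc l_distr r_distr intro: ex a_comm)
  show ?thesis
    apply (rule operad.intro)
    apply (rule assms)
    apply (rule m)
    apply (simp_all add: Com_def l_distr r_distr m_assoc)
    apply (metis m_lcomm)
    apply (metis m_comm)
    done
qed


section \<open>Operads given by generators and relations\<close>

text \<open>
  The operad presented by generators of prescribed arities and relations is the algebra of all
  well-formed expressions in the generators and the operations of an operad, modulo the
  smallest congruence that contains the operad axioms and the given relations (the initial
  model of the theory). \<open>Zero n\<close> is the zero vector of arity n.
\<close>

datatype ('k, 'g) expr =
    Gen 'g
  | Ident
  | Zero nat
  | Plus "('k, 'g) expr" "('k, 'g) expr"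
  | Smult 'k "('k, 'g) expr"
  | Act "('k, 'g) expr" "nat \<Rightarrow> nat"
  | Comp nat "('k, 'g) expr" "('k, 'g) expr"

inductive has_arity :: "('k, 'r) ring_scheme \<Rightarrow> ('g \<Rightarrow> nat) \<Rightarrow> ('k, 'g) expr \<Rightarrow> nat \<Rightarrow> bool"
  for K ar where
  "has_arity K ar (Gen g) (ar g)"
| "has_arity K ar Ident 1"
| "has_arity K ar (Zero n) n"
| "\<lbrakk>has_arity K ar s n; has_arity K ar t n\<rbrakk> \<Longrightarrow> has_arity K ar (Plus s t) n"
| "\<lbrakk>c \<in> carrier K; has_arity K ar t n\<rbrakk> \<Longrightarrow> has_arity K ar (Smult c t) n"
| "\<lbrakk>has_arity K ar t n; \<sigma> permutes {1..n}\<rbrakk> \<Longrightarrow> has_arity K ar (Act t \<sigma>) n"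
| "\<lbrakk>has_arity K ar s m; has_arity K ar t n; 1 \<le> i; i \<le> m\<rbrakk>
    \<Longrightarrow> has_arity K ar (Comp i s t) (m + n - 1)"

text \<open>\<open>op_eq K ar R n s t\<close>: the expressions s and t of arity n are identified.\<close>

inductive op_eq :: "('k, 'r) ring_scheme \<Rightarrow> ('g \<Rightarrow> nat) \<Rightarrow>
    (('k, 'g) expr \<times> ('k, 'g) expr) set \<Rightarrow> nat \<Rightarrow> ('k, 'g) expr \<Rightarrow> ('k, 'g) expr \<Rightarrow> bool"
  for K ar R where
  rel: "\<lbrakk>(s, t) \<in> R; has_arity K ar s n; has_arity K ar t n\<rbrakk> \<Longrightarrow> op_eq K ar R n s t"
| refl: "has_arity K ar t n \<Longrightarrow> op_eq K ar R n t t"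
| sym: "op_eq K ar R n s t \<Longrightarrow> op_eq K ar R n t s"
| trans: "\<lbrakk>op_eq K ar R n s t; op_eq K ar R n t u\<rbrakk> \<Longrightarrow> op_eq K ar R n s u"
| cong_plus: "\<lbrakk>op_eq K ar R n s s'; op_eq K ar R n t t'\<rbrakk>
    \<Longrightarrow> op_eq K ar R n (Plus s t) (Plus s' t')"
| cong_smult: "\<lbrakk>c \<in> carrier K; op_eq K ar R n t t'\<rbrakk> \<Longrightarrow> op_eq K ar R n (Smult c t) (Smult c t')"
| cong_act: "\<lbrakk>op_eq K ar R n t t'; \<sigma> permutes {1..n}\<rbrakk> \<Longrightarrow> op_eq K ar R n (Act t \<sigma>) (Act t' \<sigma>)"
| cong_comp: "\<lbrakk>op_eq K ar R m s s'; op_eq K ar R n t t'; 1 \<le> i; i \<le> m\<rbrakk>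
    \<Longrightarrow> op_eq K ar R (m + n - 1) (Comp i s t) (Comp i s' t')"
| plus_assoc: "\<lbrakk>has_arity K ar s n; has_arity K ar t n; has_arity K ar u n\<rbrakk>
    \<Longrightarrow> op_eq K ar R n (Plus (Plus s t) u) (Plus s (Plus t u))"
| plus_comm: "\<lbrakk>has_arity K ar s n; has_arity K ar t n\<rbrakk> \<Longrightarrow> op_eq K ar R n (Plus s t) (Plus t s)"
| plus_zero: "has_arity K ar t n \<Longrightarrow> op_eq K ar R n (Plus (Zero n) t) t"
| plus_neg: "has_arity K ar t n \<Longrightarrow> op_eq K ar R n (Plus (Smult (\<ominus>\<^bsub>K\<^esub> \<one>\<^bsub>K\<^esub>) t) t) (Zero n)"
| smult_add: "\<lbrakk>b \<in> carrier K; c \<in> carrier K; has_arity K ar t n\<rbrakk>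
    \<Longrightarrow> op_eq K ar R n (Smult (b \<oplus>\<^bsub>K\<^esub> c) t) (Plus (Smult b t) (Smult c t))"
| smult_plus: "\<lbrakk>c \<in> carrier K; has_arity K ar s n; has_arity K ar t n\<rbrakk>
    \<Longrightarrow> op_eq K ar R n (Smult c (Plus s t)) (Plus (Smult c s) (Smult c t))"
| smult_mult: "\<lbrakk>b \<in> carrier K; c \<in> carrier K; has_arity K ar t n\<rbrakk>
    \<Longrightarrow> op_eq K ar R n (Smult (b \<otimes>\<^bsub>K\<^esub> c) t) (Smult b (Smult c t))"
| smult_one: "has_arity K ar t n \<Longrightarrow> op_eq K ar R n (Smult \<one>\<^bsub>K\<^esub> t) t"
| act_plus: "\<lbrakk>has_arity K ar s n; has_arity K ar t n; \<sigma> permutes {1..n}\<rbrakk>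
    \<Longrightarrow> op_eq K ar R n (Act (Plus s t) \<sigma>) (Plus (Act s \<sigma>) (Act t \<sigma>))"
| act_smult: "\<lbrakk>c \<in> carrier K; has_arity K ar t n; \<sigma> permutes {1..n}\<rbrakk>
    \<Longrightarrow> op_eq K ar R n (Act (Smult c t) \<sigma>) (Smult c (Act t \<sigma>))"
| act_id: "has_arity K ar t n \<Longrightarrow> op_eq K ar R n (Act t id) t"
| act_comp: "\<lbrakk>has_arity K ar t n; \<sigma> permutes {1..n}; \<tau> permutes {1..n}\<rbrakk>
    \<Longrightarrow> op_eq K ar R n (Act (Act t \<sigma>) \<tau>) (Act t (\<sigma> \<circ> \<tau>))"
| comp_plus_left: "\<lbrakk>has_arity K ar s m; has_arity K ar s' m; has_arity K ar t n; 1 \<le> i; i \<le> m\<rbrakk>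
    \<Longrightarrow> op_eq K ar R (m + n - 1) (Comp i (Plus s s') t) (Plus (Comp i s t) (Comp i s' t))"
| comp_plus_right: "\<lbrakk>has_arity K ar s m; has_arity K ar t n; has_arity K ar t' n; 1 \<le> i; i \<le> m\<rbrakk>
    \<Longrightarrow> op_eq K ar R (m + n - 1) (Comp i s (Plus t t')) (Plus (Comp i s t) (Comp i s t'))"
| comp_smult_left: "\<lbrakk>c \<in> carrier K; has_arity K ar s m; has_arity K ar t n; 1 \<le> i; i \<le> m\<rbrakk>
    \<Longrightarrow> op_eq K ar R (m + n - 1) (Comp i (Smult c s) t) (Smult c (Comp i s t))"
| comp_smult_right: "\<lbrakk>c \<in> carrier K; has_arity K ar s m; has_arity K ar t n; 1 \<le> i; i \<le> m\<rbrakk>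
    \<Longrightarrow> op_eq K ar R (m + n - 1) (Comp i s (Smult c t)) (Smult c (Comp i s t))"
| ident_left: "has_arity K ar t n \<Longrightarrow> op_eq K ar R n (Comp 1 Ident t) t"
| ident_right: "\<lbrakk>has_arity K ar s m; 1 \<le> i; i \<le> m\<rbrakk> \<Longrightarrow> op_eq K ar R m (Comp i s Ident) s"
| assoc_sequential: "\<lbrakk>has_arity K ar s l; has_arity K ar t m; has_arity K ar u n;
      1 \<le> i; i \<le> l; 1 \<le> j; j \<le> m\<rbrakk>
    \<Longrightarrow> op_eq K ar R (l + (m + n - 1) - 1)
          (Comp (i + j - 1) (Comp i s t) u) (Comp i s (Comp j t u))"
| assoc_parallel: "\<lbrakk>has_arity K ar s l; has_arity K ar t m; has_arity K ar u n;
      1 \<le> i; i < k; k \<le> l\<rbrakk>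
    \<Longrightarrow> op_eq K ar R (l + m - 1 + n - 1)
          (Comp (k + m - 1) (Comp i s t) u) (Comp i (Comp k s u) t)"
| equivariant: "\<lbrakk>has_arity K ar s m; has_arity K ar t n; \<sigma> permutes {1..m}; \<tau> permutes {1..n};
      1 \<le> i; i \<le> m\<rbrakk>
    \<Longrightarrow> op_eq K ar R (m + n - 1)
          (Comp i (Act s \<sigma>) (Act t \<tau>)) (Act (Comp (\<sigma> i) s t) (perm_ins m n i \<sigma> \<tau>))"

definition expr_rel :: "('k, 'r) ring_scheme \<Rightarrow> ('g \<Rightarrow> nat) \<Rightarrow>
    (('k, 'g) expr \<times> ('k, 'g) expr) set \<Rightarrow> nat \<Rightarrow> (('k, 'g) expr \<times> ('k, 'g) expr) set" where
  "expr_rel K ar R n = {(s, t). op_eq K ar R n s t}"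

definition presented :: "('k, 'r) ring_scheme \<Rightarrow> ('g \<Rightarrow> nat) \<Rightarrow>
    (('k, 'g) expr \<times> ('k, 'g) expr) set \<Rightarrow> ('k, ('k, 'g) expr set) operad" where
  "presented K ar R = (let E = expr_rel K ar R in \<lparr>
     comps = (\<lambda>n. \<lparr>carrier = {t. has_arity K ar t n} // E n, monoid.mult = undefined, monoid.one = undefined,
        ring.zero = E n `` {Zero n},
        add = (\<lambda>X Y. \<Union>s\<in>X. \<Union>t\<in>Y. E n `` {Plus s t}),
        smult = (\<lambda>c X. \<Union>t\<in>X. E n `` {Smult c t})\<rparr>),
     act = (\<lambda>n X \<sigma>. \<Union>t\<in>X. E n `` {Act t \<sigma>}),
     ident = E 1 `` {Ident},
     pcomp = (\<lambda>m n i X Y. \<Union>s\<in>X. \<Union>t\<in>Y. E (m + n - 1) `` {Comp i s t})\<rparr>)"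

lemma permutes_id1: "id permutes A" by (rule permutes_id)

lemma op_eq_arity:
  assumes "op_eq K ar R n s t" "field K"
  shows "has_arity K ar s n \<and> has_arity K ar t n"
proof -
  interpret field K by fact
  show ?thesis using assms(1)
  proof (induction rule: op_eq.induct)
    case (assoc_sequential s l t m u n i j)
    have "has_arity K ar (Comp (i + j - 1) (Comp i s t) u) (l + m - 1 + n - 1)"
      by (intro has_arity.intros) (use assoc_sequential in auto)
    moreover have "has_arity K ar (Comp i s (Comp j t u)) (l + (m + n - 1) - 1)"
      by (intro has_arity.intros) (use assoc_sequential in auto)
    moreover have "l + m - 1 + n - 1 = l + (m + n - 1) - 1" using assoc_sequential by auto
    ultimately show ?case by metis
  next
    case (assoc_parallel s l t m u n i k)
    have "has_arity K ar (Comp (k + m - 1) (Comp i s t) u) (l + m - 1 + n - 1)"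
      by (intro has_arity.intros) (use assoc_parallel in auto)
    moreover have "has_arity K ar (Comp i (Comp k s u) t) (l + n - 1 + m - 1)"
      by (intro has_arity.intros) (use assoc_parallel in auto)
    moreover have "l + m - 1 + n - 1 = l + n - 1 + m - 1" using assoc_parallel by auto
    ultimately show ?case by metis
  next
    case (equivariant s m t n \<sigma> \<tau> i)
    have "\<sigma> i \<in> {1..m}" using permutes_in_image[OF equivariant(3), of i] equivariant by auto
    then show ?case using equivariant perm_ins_permutes[OF equivariant(3,4), of i]
      by (intro conjI has_arity.intros) auto
  next
    case (ident_left t n) then show ?case
      using has_arity.intros(7)[OF has_arity.intros(2) ident_left, of 1] by auto
  next
    case (ident_right t n i) then show ?case
      using has_arity.intros(7)[OF _ has_arity.intros(2), of K ar t n  i] by auto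
  next
    case rel then show ?case by blast
  next
    case refl then show ?case by blast
  next
    case sym then show ?case by blast
  next
    case trans then show ?case by blast
  next
    case cong_plus show ?case
      by (intro conjI has_arity.intros permutes_compose permutes_id1) (use cong_plus in \<open>(simp; fail)\<close>)+
  next
    case cong_smult show ?case
      by (intro conjI has_arity.intros permutes_compose permutes_id1) (use cong_smult in \<open>(simp; fail)\<close>)+
  next
    case cong_act show ?case
      by (intro conjI has_arity.intros permutes_compose permutes_id1) (use cong_act in \<open>(simp; fail)\<close>)+
  next
    case cong_comp show ?case
      by (intro conjI has_arity.intros permutes_compose permutes_id1) (use cong_comp in \<open>(simp; fail)\<close>)+
  next
    case plus_assoc show ?case
      by (intro conjI has_arity.intros permutes_compose permutes_id1) (use plus_assoc in \<open>(simp; fail)\<close>)+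
  next
    case plus_comm show ?case
      by (intro conjI has_arity.intros permutes_compose permutes_id1) (use plus_comm in \<open>(simp; fail)\<close>)+
  next
    case plus_zero show ?case
      by (intro conjI has_arity.intros permutes_compose permutes_id1) (use plus_zero in \<open>(simp; fail)\<close>)+
  next
    case plus_neg show ?case
      by (intro conjI has_arity.intros permutes_compose permutes_id1) (use plus_neg in \<open>(simp; fail)\<close>)+
  next
    case smult_add show ?case
      by (intro conjI has_arity.intros permutes_compose permutes_id1) (use smult_add in \<open>(simp; fail)\<close>)+
  next
    case smult_plus show ?case
      by (intro conjI has_arity.intros permutes_compose permutes_id1) (use smult_plus in \<open>(simp; fail)\<close>)+
  next
    case smult_mult show ?case
      by (intro conjI has_arity.intros permutes_compose permutes_id1) (use smult_mult in \<open>(simp; fail)\<close>)+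
  next
    case smult_one show ?case
      by (intro conjI has_arity.intros permutes_compose permutes_id1) (use smult_one in \<open>(simp; fail)\<close>)+
  next
    case act_plus show ?case
      by (intro conjI has_arity.intros permutes_compose permutes_id1) (use act_plus in \<open>(simp; fail)\<close>)+
  next
    case act_smult show ?case
      by (intro conjI has_arity.intros permutes_compose permutes_id1) (use act_smult in \<open>(simp; fail)\<close>)+
  next
    case act_id show ?case
      by (intro conjI has_arity.intros permutes_compose permutes_id1) (use act_id in \<open>(simp; fail)\<close>)+
  next
    case act_comp show ?case
      by (intro conjI has_arity.intros permutes_compose permutes_id1) (use act_comp in \<open>(simp; fail)\<close>)+
  next
    case comp_plus_left show ?case
      by (intro conjI has_arity.intros permutes_compose permutes_id1) (use comp_plus_left in \<open>(simp; fail)\<close>)+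
  next
    case comp_plus_right show ?case
      by (intro conjI has_arity.intros permutes_compose permutes_id1) (use comp_plus_right in \<open>(simp; fail)\<close>)+
  next
    case comp_smult_left show ?case
      by (intro conjI has_arity.intros permutes_compose permutes_id1) (use comp_smult_left in \<open>(simp; fail)\<close>)+
  next
    case comp_smult_right show ?case
      by (intro conjI has_arity.intros permutes_compose permutes_id1) (use comp_smult_right in \<open>(simp; fail)\<close>)+
  qed
qed

text \<open>Presented operads satisfy the operad axioms; \<open>cl n t\<close> is the class of the expression t of arity n.\<close>

locale presentation = field K for K :: "('k, 'r) ring_scheme" (structure) + fixes ar :: "'g \<Rightarrow> nat" and R :: "(('k, 'g) expr \<times> ('k, 'g) expr) set"
begin
abbreviation (input) "P \<equiv> presented K ar R"
definition "cl n t = expr_rel K ar R n `` {t}"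
abbreviation (input) "h \<equiv> has_arity K ar"
abbreviation (input) "oe \<equiv> op_eq K ar R"

lemma arity: "oe n s t \<Longrightarrow> h s n \<and> h t n"
  using op_eq_arity field_axioms by blast

lemma equiv: "equiv {t. h t n} (expr_rel K ar R n)"
proof (rule equivI)
  show "expr_rel K ar R n \<subseteq> {t. h t n} \<times> {t. h t n}" using arity by (auto simp: expr_rel_def)
  show "refl_on {t. h t n} (expr_rel K ar R n)" using arity by (auto simp: refl_on_def expr_rel_def op_eq.refl)
  show "sym (expr_rel K ar R n)" unfolding sym_def expr_rel_def using op_eq.sym[of K ar R n] by blast
  show "trans (expr_rel K ar R n)" unfolding trans_def expr_rel_def using op_eq.trans[of K ar R n] by blast
qed

lemma cl_eq: "oe n s t \<Longrightarrow> cl n s = cl n t"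
  unfolding cl_def by (rule equiv_class_eq[OF equiv]) (simp add: expr_rel_def)

lemma cl_eq_iff: "h s n \<Longrightarrow> h t n \<Longrightarrow> cl n s = cl n t \<longleftrightarrow> oe n s t"
  unfolding cl_def using eq_equiv_class_iff[OF equiv, of s n t] by (auto simp: expr_rel_def)

lemma in_cl: "t' \<in> cl n t \<longleftrightarrow> oe n t t'" by (auto simp: cl_def expr_rel_def)

lemma car: "carrier (comps P n) = cl n ` {t. h t n}"
  by (auto simp: presented_def Let_def quotient_def cl_def)

lemma cl_car: "h t n \<Longrightarrow> cl n t \<in> carrier (comps P n)" by (auto simp: car)

lemma zero_P: "\<zero>\<^bsub>comps P n\<^esub> = cl n (Zero n)"
  by (simp add: presented_def Let_def cl_def)

lemma UNc: "a \<in> A \<Longrightarrow> (\<And>y. y \<in> A \<Longrightarrow> f y = c) \<Longrightarrow> (\<Union>x\<in>A. f x) = c" by auto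

lemma self: "h t n \<Longrightarrow> t \<in> cl n t" by (simp add: in_cl op_eq.refl)

lemma lift1:
  assumes "h t n" "\<And>x. oe n t x \<Longrightarrow> oe k (f t) (f x)"
  shows "(\<Union>x\<in>cl n t. cl k (f x)) = cl k (f t)"
proof (rule UNc)
  show "t \<in> cl n t" using assms(1) by (rule self)
  fix x assume "x \<in> cl n t"
  then have "oe k (f t) (f x)" unfolding in_cl by (rule assms(2))
  then show "cl k (f x) = cl k (f t)" by (rule cl_eq[symmetric])
qed

lemma lift2:
  assumes "h s m" "h t n" "\<And>x y. oe m s x \<Longrightarrow> oe n t y \<Longrightarrow> oe k (f s t) (f x y)"
  shows "(\<Union>x\<in>cl m s. \<Union>y\<in>cl n t. cl k (f x y)) = cl k (f s t)"
proof (rule UNc)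
  show "s \<in> cl m s" using assms(1) by (rule self)
  fix x assume x: "x \<in> cl m s"
  show "(\<Union>y\<in>cl n t. cl k (f x y)) = cl k (f s t)"
  proof (rule UNc)
    show "t \<in> cl n t" using assms(2) by (rule self)
    fix y assume "y \<in> cl n t"
    with x have "oe k (f s t) (f x y)" unfolding in_cl by (rule assms(3))
    then show "cl k (f x y) = cl k (f s t)" by (rule cl_eq[symmetric])
  qed
qed

lemma add_P: "h s n \<Longrightarrow> h t n \<Longrightarrow> cl n s \<oplus>\<^bsub>comps P n\<^esub> cl n t = cl n (Plus s t)"
  unfolding presented_def Let_def by (simp flip: cl_def) (rule lift2; simp add: op_eq.cong_plus)

lemma smult_P: "c \<in> carrier K \<Longrightarrow> h t n \<Longrightarrow> c \<odot>\<^bsub>comps P n\<^esub> cl n t = cl n (Smult c t)"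
  unfolding presented_def Let_def by (simp flip: cl_def) (rule lift1; simp add: op_eq.cong_smult)

lemma act_P: "\<sigma> permutes {1..n} \<Longrightarrow> h t n \<Longrightarrow> act P n (cl n t) \<sigma> = cl n (Act t \<sigma>)"
  unfolding presented_def Let_def by (simp flip: cl_def) (rule lift1; simp add: op_eq.cong_act)

lemma ident_P: "ident P = cl 1 Ident"
  by (simp add: presented_def Let_def cl_def)

lemma comp_P: "h s m \<Longrightarrow> h t n \<Longrightarrow> 1 \<le> i \<Longrightarrow> i \<le> m \<Longrightarrow> pcomp P m n i (cl m s) (cl n t) = cl (m + n - 1) (Comp i s t)"
  unfolding presented_def Let_def by (simp flip: cl_def del: One_nat_def) (rule lift2; simp add: op_eq.cong_comp del: One_nat_def)

lemmas hi = has_arity.intros permutes_id1 permutes_compose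
lemmas ce = cl_eq[OF op_eq.plus_assoc] cl_eq[OF op_eq.plus_zero] cl_eq[OF op_eq.smult_add]
  cl_eq[OF op_eq.smult_plus] cl_eq[OF op_eq.smult_mult] cl_eq[OF op_eq.smult_one]
  cl_eq[OF op_eq.act_plus] cl_eq[OF op_eq.act_smult] cl_eq[OF op_eq.act_id] cl_eq[OF op_eq.act_comp]
  cl_eq[OF op_eq.comp_plus_left] cl_eq[OF op_eq.comp_plus_right] cl_eq[OF op_eq.comp_smult_left] cl_eq[OF op_eq.comp_smult_right]
lemmas P_simps = zero_P add_P smult_P act_P ident_P comp_P

lemma module_P: "module K (comps P n)"
proof (intro moduleI abelian_groupI)
  fix x assume "x \<in> carrier (comps P n)"
  then obtain t where t: "h t n" "x = cl n t" by (auto simp: car)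
  then have "cl n (Smult (\<ominus> \<one>) t) \<oplus>\<^bsub>comps P n\<^esub> x = \<zero>\<^bsub>comps P n\<^esub>"
    by (simp add: P_simps has_arity.intros cl_eq[OF op_eq.plus_neg])
  then show "\<exists>y\<in>carrier (comps P n). y \<oplus>\<^bsub>comps P n\<^esub> x = \<zero>\<^bsub>comps P n\<^esub>"
    using t by (intro bexI) (auto intro!: cl_car has_arity.intros)
next
  fix x y assume "x \<in> carrier (comps P n)" "y \<in> carrier (comps P n)"
  then show "x \<oplus>\<^bsub>comps P n\<^esub> y = y \<oplus>\<^bsub>comps P n\<^esub> x"
    unfolding car using cl_eq[OF op_eq.plus_comm] by (auto simp only: add_P)
qed (auto simp: car P_simps hi is_cring ce intro!: imageI hi simp del: One_nat_def)

lemma cl_cong: "n = n' \<Longrightarrow> cl n' s = cl n' t \<Longrightarrow> cl n s = cl n' t" by simp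

lemma operad_P: "operad K P"
proof (rule operad.intro)
  show "field K" by (rule field_axioms)
  show "module K (comps P n)" for n by (rule module_P)
  show "pcomp P (l + m - 1) n (i + j - 1) (pcomp P l m i x y) z = pcomp P l (m + n - 1) i x (pcomp P m n j y z)"
    if "x \<in> carrier (comps P l)" "y \<in> carrier (comps P m)" "z \<in> carrier (comps P n)"
     and ij: "1 \<le> i" "i \<le> l" "1 \<le> j" "j \<le> m" for l m n i j x y z
  proof -
    obtain s t u where *: "h s l" "h t m" "h u n" "x = cl l s" "y = cl m t" "z = cl n u"
      using \<open>x \<in> _\<close> \<open>y \<in> _\<close> \<open>z \<in> _\<close> by (auto simp: car)
    have "pcomp P (l + m - 1) n (i + j - 1) (pcomp P l m i x y) z = cl (l + m - 1 + n - 1) (Comp (i + j - 1) (Comp i s t) u)"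
      using * ij by (simp only: comp_P) (intro comp_P, auto intro!: has_arity.intros simp del: One_nat_def)
    moreover have "pcomp P l (m + n - 1) i x (pcomp P m n j y z) = cl (l + (m + n - 1) - 1) (Comp i s (Comp j t u))"
      using * ij by (simp only: comp_P) (intro comp_P, auto intro!: has_arity.intros simp del: One_nat_def)
    moreover have "l + m - 1 + n - 1 = l + (m + n - 1) - 1" using ij by auto
    ultimately show ?thesis using * ij cl_eq[OF op_eq.assoc_sequential[OF *(1-3) ij]] by simp
  qed
  show "pcomp P (l + m - 1) n (k + m - 1) (pcomp P l m i x y) z = pcomp P (l + n - 1) m i (pcomp P l n k x z) y"
    if "x \<in> carrier (comps P l)" "y \<in> carrier (comps P m)" "z \<in> carrier (comps P n)"
     and ij: "1 \<le> i" "i < k" "k \<le> l" for l m n i k x y z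
  proof -
    obtain s t u where *: "h s l" "h t m" "h u n" "x = cl l s" "y = cl m t" "z = cl n u"
      using \<open>x \<in> _\<close> \<open>y \<in> _\<close> \<open>z \<in> _\<close> by (auto simp: car)
    have ik: "i \<le> l" "1 \<le> k" "k \<le> l" "1 \<le> i" using ij by auto
    have "pcomp P (l + m - 1) n (k + m - 1) (pcomp P l m i x y) z = cl (l + m - 1 + n - 1) (Comp (k + m - 1) (Comp i s t) u)"
      using * ij unfolding *(4-6) comp_P[OF *(1,2) ik(4,1)] comp_P[OF *(1,3) ik(2,3)]
      by - (intro comp_P, auto intro!: has_arity.intros simp del: One_nat_def)
    moreover have "pcomp P (l + n - 1) m i (pcomp P l n k x z) y = cl (l + n - 1 + m - 1) (Comp i (Comp k s u) t)"
      using * ij unfolding *(4-6) comp_P[OF *(1,2) ik(4,1)] comp_P[OF *(1,3) ik(2,3)]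
      by - (intro comp_P, auto intro!: has_arity.intros simp del: One_nat_def)
    moreover have "l + m - 1 + n - 1 = l + n - 1 + m - 1" using ij by auto
    ultimately show ?thesis using * ij cl_eq[OF op_eq.assoc_parallel[OF *(1-3) ij]] by simp
  qed
  show "pcomp P m n i (act P m x \<sigma>) (act P n y \<tau>) = act P (m + n - 1) (pcomp P m n (\<sigma> i) x y) (perm_ins m n i \<sigma> \<tau>)"
    if "x \<in> carrier (comps P m)" "y \<in> carrier (comps P n)"
     and p: "\<sigma> permutes {1..m}" "\<tau> permutes {1..n}" and i: "1 \<le> i" "i \<le> m" for m n i x y \<sigma> \<tau>
  proof -
    obtain s t where *: "h s m" "h t n" "x = cl m s" "y = cl n t" 
      using \<open>x \<in> _\<close> \<open>y \<in> _\<close> by (auto simp: car)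
    have "\<sigma> i \<in> {1..m}" using permutes_in_image[OF p(1), of i] i by auto
    then have "act P (m + n - 1) (pcomp P m n (\<sigma> i) x y) (perm_ins m n i \<sigma> \<tau>) = cl (m + n - 1) (Act (Comp (\<sigma> i) s t) (perm_ins m n i \<sigma> \<tau>))"
      using * i p by (simp add: comp_P del: One_nat_def) (intro act_P perm_ins_permutes has_arity.intros, auto)
    moreover have "pcomp P m n i (act P m x \<sigma>) (act P n y \<tau>) = cl (m + n - 1) (Comp i (Act s \<sigma>) (Act t \<tau>))"
      using * i p by (simp add: act_P del: One_nat_def) (intro comp_P has_arity.intros, auto)
    ultimately show ?thesis using cl_eq[OF op_eq.equivariant[OF *(1,2) p i]] by simp
  qed
  fix x n assume "x \<in> carrier (comps P n)"
  then obtain t where t: "h t n" "x = cl n t" by (auto simp: car)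
  show "pcomp P 1 n 1 (ident P) x = x" using t comp_P[OF has_arity.intros(2) t(1), of 1] cl_eq[OF op_eq.ident_left[OF t(1)]]
    by (simp add: ident_P)
  show "pcomp P n 1 i x (ident P) = x" if "1 \<le> i" "i \<le> n" for i
    using t comp_P[OF t(1) has_arity.intros(2) that] cl_eq[OF op_eq.ident_right[OF t(1) that]]
    by (simp add: ident_P)
qed (auto simp: car P_simps hi ce intro!: imageI hi simp del: One_nat_def)
end

abbreviation swap12 :: "nat \<Rightarrow> nat" where
  "swap12 \<equiv> Transposition.transpose 1 2"


section \<open>The Lie and the Poisson operad\<close>

datatype lie_gen = LieBracket

definition Lie_rels ::
  "('k, 'r) ring_scheme \<Rightarrow> (('k, lie_gen) expr \<times> ('k, lie_gen) expr) set" where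
  "Lie_rels K = (let b = Gen LieBracket in
    {(Act b swap12, Smult (\<ominus>\<^bsub>K\<^esub> \<one>\<^bsub>K\<^esub>) b),
     (Comp 2 b b, Plus (Comp 1 b b) (Act (Comp 2 b b) swap12))})"

definition Lie :: "('k, 'r) ring_scheme \<Rightarrow> ('k, ('k, lie_gen) expr set) operad" where
  "Lie K = presented K (\<lambda>_. 2) (Lie_rels K)"

datatype pois_gen = PoisUnit | PoisMult | PoisBracket

fun pois_arity :: "pois_gen \<Rightarrow> nat" where
  "pois_arity PoisUnit = 0"
| "pois_arity PoisMult = 2"
| "pois_arity PoisBracket = 2"

definition Pois_rels ::
  "('k, 'r) ring_scheme \<Rightarrow> (('k, pois_gen) expr \<times> ('k, pois_gen) expr) set" where
  "Pois_rels K = (let e = Gen PoisUnit; p = Gen PoisMult; b = Gen PoisBracket in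
    {(Comp 1 p e, Ident), (Comp 2 p e, Ident),
     (Comp 1 b e, Zero 1), (Comp 2 b e, Zero 1),
     (Act p swap12, p),
     (Act b swap12, Smult (\<ominus>\<^bsub>K\<^esub> \<one>\<^bsub>K\<^esub>) b),
     (Comp 1 p p, Comp 2 p p),
     (Comp 1 b p, Plus (Comp 2 p b) (Act (Comp 2 p b) swap12)),
     (Comp 2 b b, Plus (Comp 1 b b) (Act (Comp 2 b b) swap12))})"

text \<open>
  Characteristic 2 is exceptional for \<open>Pois\<close>: there \<open>e \<mapsto> 0\<close>, \<open>p \<mapsto> b\<close>, \<open>b \<mapsto> 0\<close> respects all
  the relations above (b is then symmetric, the associator of p is sent to an identity that follows
  from the Leibniz rule, and the Leibniz rule is sent to the Jacobi identity up to signs), so it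
  extends to a derivation that is not a combination of the two gradings by the number of p minus
  the number of e, and by the number of b; \<open>der\<close> then has dimension 3 and is not abelian.
\<close>

definition Pois :: "('k, 'r) ring_scheme \<Rightarrow> ('k, ('k, pois_gen) expr set) operad" where
  "Pois K = presented K pois_arity (Pois_rels K)"

lemma operad_Lie: "field K \<Longrightarrow> operad K (Lie K)"
  unfolding Lie_def by (simp add: presentation.intro presentation.operad_P)

lemma operad_Pois: "field K \<Longrightarrow> operad K (Pois K)"
  unfolding Pois_def by (simp add: presentation.intro presentation.operad_P)

end

theory Submission
  imports Defs
begin

text \<open>
  In each of the four operads the unary operations are the multiples of the identity, and all
  operations arise from binary ones, together with a unit except for \<open>Lie\<close>. A derivation kills the
  identity, is determined by its values on generators, and on the unit its value is forced by the unit
  law. So everything happens in arity two.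

  The inner derivation of \<open>-c 1\<close> multiplies the operations of arity n by \<open>c (n - 1)\<close>
  (\<open>arity_der_inner\<close>). On binary operations this is multiplication by c, so the inner derivations are a
  line, and they account for every derivation that rescales a single binary generator
  (\<open>derivations_one_dimensional\<close>). For \<open>Com\<close> and \<open>Lie\<close> the generator spans arity two. For \<open>Ass\<close> a
  derivation could add to the product a multiple of the opposite product, but associativity
  excludes this. For \<open>Pois\<close> the product is symmetric and the bracket is antisymmetric; if 2 is
  invertible, a derivation cannot mix them and is given by two scalars. Both scalars occur, because the
  relations are homogeneous in the number of brackets and counting brackets is a derivation
  (\<open>euler_der_derivation\<close>); it is the outer one (\<open>derivations_two_dimensional\<close>).

  For the two presented operads this requires control of the low arities from both sides. Upper bounds
  come from an induction over expressions that is possible once no nullary operation lowers the arity;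
  to get there for \<open>Pois\<close>, the unit is pushed through compositions until it is absorbed by a generator
  (\<open>generated_unital\<close>). Lower bounds, namely that the identity, the product and the bracket do not
  collapse, come from a model that records an operation up to first order in the bracket
  (\<open>same_value_sound\<close>).
\<close>

section \<open>Quotients of abelian Lie algebras given in coordinates\<close>

lemma lie_trivial_quotient_self:
  fixes L :: "('k, 'a) lie_algebra" and \<phi> :: "'b \<Rightarrow> 'a"
  assumes K: "abelian_group K" and car: "carrier L = \<phi> ` carrier K"
    and add: "\<And>a b. a \<in> carrier K \<Longrightarrow> b \<in> carrier K \<Longrightarrow> \<phi> a \<oplus>\<^bsub>L\<^esub> \<phi> b = \<phi> (a \<oplus>\<^bsub>K\<^esub> b)"
  shows "lie_trivial (lie_quotient L (carrier L))"
proof -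
  interpret K: abelian_group K by fact
  have coset: "carrier L +>\<^bsub>L\<^esub> \<phi> a = carrier L" if a: "a \<in> carrier K" for a
  proof -
    have "carrier L +>\<^bsub>L\<^esub> \<phi> a = (\<lambda>b. \<phi> (b \<oplus>\<^bsub>K\<^esub> a)) ` carrier K"
      using a by (force simp: a_r_coset_def r_coset_def car add)
    also have "\<dots> = \<phi> ` carrier K"
    proof (intro equalityI subsetI)
      fix x assume "x \<in> \<phi> ` carrier K"
      then obtain b where "b \<in> carrier K" "x = \<phi> b" by blast
      with a show "x \<in> (\<lambda>b. \<phi> (b \<oplus>\<^bsub>K\<^esub> a)) ` carrier K"
        by (intro image_eqI[of _ _ "b \<ominus>\<^bsub>K\<^esub> a"]) (auto simp: K.minus_eq K.a_assoc K.l_neg)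
    qed (use a in auto)
    finally show ?thesis by (simp add: car)
  qed
  have "a_rcosets\<^bsub>L\<^esub> (carrier L) = (\<lambda>x. carrier L +>\<^bsub>L\<^esub> x) ` carrier L"
    by (auto simp: A_RCOSETS_def RCOSETS_def a_r_coset_def)
  also have "\<dots> = {carrier L}"
    using coset by (auto simp: car intro!: image_eqI[where x = "\<phi> \<zero>\<^bsub>K\<^esub>"])
  finally show ?thesis by (simp add: lie_trivial_def lie_quotient_def)
qed

text \<open>
  In the coordinates \<open>\<phi> a b\<close> the ideal is the axis \<open>b = 0\<close>. Its cosets are the parallel lines, and the
  second coordinate is constant on each of them; it is the isomorphism of the quotient with the field.
\<close>

lemma lie_iso_quotient_coordinate:
  fixes L :: "('k, 'a) lie_algebra" and K :: "('k, 'r) ring_scheme" and \<phi> :: "'k \<Rightarrow> 'k \<Rightarrow> 'a"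
  assumes K: "field K"
    and car: "carrier L = {\<phi> a b | a b. a \<in> carrier K \<and> b \<in> carrier K}"
    and inj: "\<And>a b a' b'. \<lbrakk>a \<in> carrier K; b \<in> carrier K; a' \<in> carrier K; b' \<in> carrier K;
                \<phi> a b = \<phi> a' b'\<rbrakk> \<Longrightarrow> a = a' \<and> b = b'"
    and add: "\<And>a b a' b'. \<lbrakk>a \<in> carrier K; b \<in> carrier K; a' \<in> carrier K; b' \<in> carrier K\<rbrakk>
                \<Longrightarrow> \<phi> a b \<oplus>\<^bsub>L\<^esub> \<phi> a' b' = \<phi> (a \<oplus>\<^bsub>K\<^esub> a') (b \<oplus>\<^bsub>K\<^esub> b')"
    and smult: "\<And>c a b. \<lbrakk>c \<in> carrier K; a \<in> carrier K; b \<in> carrier K\<rbrakk>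
                \<Longrightarrow> c \<odot>\<^bsub>L\<^esub> \<phi> a b = \<phi> (c \<otimes>\<^bsub>K\<^esub> a) (c \<otimes>\<^bsub>K\<^esub> b)"
    and bracket: "\<And>a b a' b'. \<lbrakk>a \<in> carrier K; b \<in> carrier K; a' \<in> carrier K; b' \<in> carrier K\<rbrakk>
                \<Longrightarrow> bracket L (\<phi> a b) (\<phi> a' b') = \<phi> \<zero>\<^bsub>K\<^esub> \<zero>\<^bsub>K\<^esub>"
  shows "lie_iso K L (lie_dsum (lie_base K) (lie_base K))"
    and "lie_iso K (lie_quotient L {\<phi> a \<zero>\<^bsub>K\<^esub> | a. a \<in> carrier K}) (lie_base K)"
proof -
  interpret K: field K by fact
  define f where "f x = (THE p. p \<in> carrier K \<times> carrier K \<and> x = \<phi> (fst p) (snd p))" for x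
  have f: "f (\<phi> a b) = (a, b)" if "a \<in> carrier K" "b \<in> carrier K" for a b
    unfolding f_def
  proof (rule the_equality)
    fix p assume "p \<in> carrier K \<times> carrier K \<and> \<phi> a b = \<phi> (fst p) (snd p)"
    then show "p = (a, b)" using that inj[of a b "fst p" "snd p"] by (auto simp: prod_eq_iff)
  qed (use that in simp)
  have fL: "bij_betw f (carrier L) (carrier K \<times> carrier K)"
    by (rule bij_betw_byWitness[where f' = "\<lambda>(a, b). \<phi> a b"]) (auto simp: car f)
  then show "lie_iso K L (lie_dsum (lie_base K) (lie_base K))"
    unfolding lie_iso_def lie_dsum_def lie_base_def
    by (intro exI[of _ f]) (auto simp: car f add smult bracket)
  define C where "C b = {\<phi> a b | a. a \<in> carrier K}" for b
  have C0: "{\<phi> a \<zero>\<^bsub>K\<^esub> | a. a \<in> carrier K} = C \<zero>\<^bsub>K\<^esub>" by (simp add: C_def)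
  have Cadd: "C b <+>\<^bsub>L\<^esub> C b' = C (b \<oplus>\<^bsub>K\<^esub> b')" if b: "b \<in> carrier K" "b' \<in> carrier K" for b b'
  proof (intro equalityI subsetI)
    fix x assume "x \<in> C b <+>\<^bsub>L\<^esub> C b'"
    then show "x \<in> C (b \<oplus>\<^bsub>K\<^esub> b')"
      using b by (auto simp: set_add_def set_mult_def C_def add)
  next
    fix x assume "x \<in> C (b \<oplus>\<^bsub>K\<^esub> b')"
    then obtain a where "a \<in> carrier K" "x = \<phi> (a \<oplus>\<^bsub>K\<^esub> \<zero>\<^bsub>K\<^esub>) (b \<oplus>\<^bsub>K\<^esub> b')"
      by (auto simp: C_def)
    then have "x = \<phi> a b \<oplus>\<^bsub>L\<^esub> \<phi> \<zero>\<^bsub>K\<^esub> b'" using b by (simp add: add)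
    then show "x \<in> C b <+>\<^bsub>L\<^esub> C b'"
      using b \<open>a \<in> _\<close> by (auto simp: set_add_def set_mult_def C_def)
  qed
  have coset: "C \<zero>\<^bsub>K\<^esub> +>\<^bsub>L\<^esub> \<phi> a b = C b" if a: "a \<in> carrier K" and b: "b \<in> carrier K" for a b
  proof (intro equalityI subsetI)
    fix x assume "x \<in> C \<zero>\<^bsub>K\<^esub> +>\<^bsub>L\<^esub> \<phi> a b"
    then show "x \<in> C b" using a b by (auto simp: a_r_coset_def r_coset_def C_def add)
  next
    fix x assume "x \<in> C b"
    then obtain a' where a': "a' \<in> carrier K" "x = \<phi> a' b" by (auto simp: C_def)
    then have "x = \<phi> (a' \<ominus>\<^bsub>K\<^esub> a) \<zero>\<^bsub>K\<^esub> \<oplus>\<^bsub>L\<^esub> \<phi> a b"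
      using a b by (simp add: add K.minus_eq K.a_assoc K.l_neg)
    then show "x \<in> C \<zero>\<^bsub>K\<^esub> +>\<^bsub>L\<^esub> \<phi> a b"
      using a a' by (auto simp: a_r_coset_def r_coset_def C_def)
  qed
  have Cne: "C b \<noteq> {}" for b by (auto simp: C_def intro: K.zero_closed)
  have rcosets: "a_rcosets\<^bsub>L\<^esub> (C \<zero>\<^bsub>K\<^esub>) = C ` carrier K"
  proof -
    have "a_rcosets\<^bsub>L\<^esub> (C \<zero>\<^bsub>K\<^esub>) = (\<lambda>x. C \<zero>\<^bsub>K\<^esub> +>\<^bsub>L\<^esub> x) ` carrier L"
      by (auto simp: A_RCOSETS_def RCOSETS_def a_r_coset_def)
    also have "\<dots> = C ` carrier K"
      unfolding car by (auto simp: coset image_iff) (metis K.zero_closed coset)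
    finally show ?thesis .
  qed
  define g where "g X = (THE b. b \<in> carrier K \<and> X = C b)" for X
  have Cinj: "b = b'" if "b \<in> carrier K" "b' \<in> carrier K" "C b = C b'" for b b'
  proof -
    have "\<phi> \<zero>\<^bsub>K\<^esub> b \<in> C b" by (auto simp: C_def)
    then have "\<phi> \<zero>\<^bsub>K\<^esub> b \<in> C b'" using that by simp
    then obtain a where "a \<in> carrier K" "\<phi> \<zero>\<^bsub>K\<^esub> b = \<phi> a b'" by (auto simp: C_def)
    then show ?thesis using that inj[of "\<zero>\<^bsub>K\<^esub>" b a b'] by simp
  qed
  have g: "g (C b) = b" if "b \<in> carrier K" for b
    unfolding g_def using that Cinj by (intro the_equality) blast+
  have gL: "bij_betw g (C ` carrier K) (carrier K)"
    by (rule bij_betw_byWitness[where f' = C]) (auto simp: g)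
  have Csmult: "(\<Union>x\<in>C b. C \<zero>\<^bsub>K\<^esub> +>\<^bsub>L\<^esub> c \<odot>\<^bsub>L\<^esub> x) = C (c \<otimes>\<^bsub>K\<^esub> b)"
    if "c \<in> carrier K" "b \<in> carrier K" for b c
  proof -
    have "C \<zero>\<^bsub>K\<^esub> +>\<^bsub>L\<^esub> c \<odot>\<^bsub>L\<^esub> x = C (c \<otimes>\<^bsub>K\<^esub> b)" if "x \<in> C b" for x
      using that \<open>c \<in> _\<close> \<open>b \<in> _\<close> by (auto simp: smult coset C_def[of b])
    then show ?thesis using Cne[of b] by auto
  qed
  have Cbracket: "(\<Union>x\<in>C b. \<Union>y\<in>C b'. C \<zero>\<^bsub>K\<^esub> +>\<^bsub>L\<^esub> bracket L x y) = C \<zero>\<^bsub>K\<^esub>"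
    if "b \<in> carrier K" "b' \<in> carrier K" for b b'
  proof -
    have "C \<zero>\<^bsub>K\<^esub> +>\<^bsub>L\<^esub> bracket L x y = C \<zero>\<^bsub>K\<^esub>" if "x \<in> C b" "y \<in> C b'" for x y
      using that \<open>b \<in> _\<close> \<open>b' \<in> _\<close> by (auto simp: bracket coset C_def[of b] C_def[of b'])
    then show ?thesis using Cne[of b] Cne[of b'] by auto
  qed
  show "lie_iso K (lie_quotient L {\<phi> a \<zero>\<^bsub>K\<^esub> | a. a \<in> carrier K}) (lie_base K)"
    unfolding lie_iso_def lie_quotient_def lie_base_def C0
    using gL by (intro exI[of _ g]) (auto simp: rcosets g Cadd Csmult Cbracket)
qed


section \<open>The arity derivation\<close>

text \<open>
  The part of the operad axioms that governs multiples of the identity operation: linearity over the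
  field and the two identity laws. Everything about the arity derivation follows from it. In the
  associative operad, where the compositions are given by inserting permutations into each other, it
  amounts to the bilinearity of the convolution and to inserting the permutation of one letter.
\<close>

locale pre_operad =
  fixes K :: "('k, 'r) ring_scheme" (structure) and P :: "('k, 'a) operad"
  assumes field: "field K"
    and comps_module: "module K (comps P n)"
    and act_closed: "\<lbrakk>x \<in> carrier (comps P n); \<sigma> permutes {1..n}\<rbrakk> \<Longrightarrow> act P n x \<sigma> \<in> carrier (comps P n)"
    and act_smult: "\<lbrakk>c \<in> carrier K; x \<in> carrier (comps P n); \<sigma> permutes {1..n}\<rbrakk>
      \<Longrightarrow> act P n (c \<odot>\<^bsub>comps P n\<^esub> x) \<sigma> = c \<odot>\<^bsub>comps P n\<^esub> act P n x \<sigma>"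
    and ident_closed: "ident P \<in> carrier (comps P 1)"
    and pcomp_closed: "\<lbrakk>x \<in> carrier (comps P m); y \<in> carrier (comps P n); 1 \<le> i; i \<le> m\<rbrakk>
      \<Longrightarrow> pcomp P m n i x y \<in> carrier (comps P (m + n - 1))"
    and pcomp_smult_left: "\<lbrakk>c \<in> carrier K; x \<in> carrier (comps P m);
        y \<in> carrier (comps P n); 1 \<le> i; i \<le> m\<rbrakk>
      \<Longrightarrow> pcomp P m n i (c \<odot>\<^bsub>comps P m\<^esub> x) y = c \<odot>\<^bsub>comps P (m + n - 1)\<^esub> pcomp P m n i x y"
    and pcomp_smult_right: "\<lbrakk>c \<in> carrier K; x \<in> carrier (comps P m);
        y \<in> carrier (comps P n); 1 \<le> i; i \<le> m\<rbrakk>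
      \<Longrightarrow> pcomp P m n i x (c \<odot>\<^bsub>comps P n\<^esub> y) = c \<odot>\<^bsub>comps P (m + n - 1)\<^esub> pcomp P m n i x y"
    and ident_left: "y \<in> carrier (comps P n) \<Longrightarrow> pcomp P 1 n 1 (ident P) y = y"
    and ident_right: "\<lbrakk>x \<in> carrier (comps P m); 1 \<le> i; i \<le> m\<rbrakk> \<Longrightarrow> pcomp P m 1 i x (ident P) = x"

sublocale operad \<subseteq> pre_operad
  by (rule pre_operad.intro) (rule field comps_module act_closed act_smult ident_closed pcomp_closed
      pcomp_smult_left pcomp_smult_right ident_left ident_right; assumption)+

lemma derivationD:
  assumes "derivation K P d"
  shows derivation_closed: "x \<in> carrier (comps P n) \<Longrightarrow> d n x \<in> carrier (comps P n)"
    and derivation_extensional: "x \<notin> carrier (comps P n) \<Longrightarrow> d n x = undefined"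
    and derivation_add: "\<lbrakk>x \<in> carrier (comps P n); y \<in> carrier (comps P n)\<rbrakk>
      \<Longrightarrow> d n (x \<oplus>\<^bsub>comps P n\<^esub> y) = d n x \<oplus>\<^bsub>comps P n\<^esub> d n y"
    and derivation_smult: "\<lbrakk>c \<in> carrier K; x \<in> carrier (comps P n)\<rbrakk>
      \<Longrightarrow> d n (c \<odot>\<^bsub>comps P n\<^esub> x) = c \<odot>\<^bsub>comps P n\<^esub> d n x"
    and derivation_act: "\<lbrakk>x \<in> carrier (comps P n); \<sigma> permutes {1..n}\<rbrakk>
      \<Longrightarrow> d n (act P n x \<sigma>) = act P n (d n x) \<sigma>"
    and derivation_pcomp: "\<lbrakk>x \<in> carrier (comps P m); y \<in> carrier (comps P n); 1 \<le> i; i \<le> m\<rbrakk>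
      \<Longrightarrow> d (m + n - 1) (pcomp P m n i x y)
        = pcomp P m n i (d m x) y \<oplus>\<^bsub>comps P (m + n - 1)\<^esub> pcomp P m n i x (d n y)"
  using assms unfolding derivation_def by (blast | auto simp: PiE_def extensional_def)+

lemma derivation_eqI:
  assumes "derivation K P d" "derivation K P d'"
    and "\<And>n x. x \<in> carrier (comps P n) \<Longrightarrow> d n x = d' n x"
  shows "d = d'"
proof (intro ext)
  fix n x
  show "d n x = d' n x"
    by (cases "x \<in> carrier (comps P n)")
      (simp_all add: assms(3) derivation_extensional[OF assms(1)] derivation_extensional[OF assms(2)])
qed

context pre_operad
begin

sublocale K: field K by (rule field)

sublocale M: module K "comps P n" for n by (rule comps_module)

lemma smult_cancel:
  assumes x: "x \<in> carrier (comps P n)" "x \<noteq> \<zero>\<^bsub>comps P n\<^esub>"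
    and c: "c \<in> carrier K" "c' \<in> carrier K" and eq: "c \<odot>\<^bsub>comps P n\<^esub> x = c' \<odot>\<^bsub>comps P n\<^esub> x"
  shows "c = c'"
proof (rule ccontr)
  assume "c \<noteq> c'"
  define e where "e = c \<ominus> c'"
  have e: "e \<in> carrier K" "e \<noteq> \<zero>"
    using c \<open>c \<noteq> c'\<close> K.add.inv_solve_right'[of \<zero> c c'] by (auto simp: e_def K.minus_eq)
  have "c = c' \<oplus> e" using c by (simp add: e_def K.minus_eq K.a_lcomm K.r_neg)
  then have "c' \<odot>\<^bsub>comps P n\<^esub> x \<oplus>\<^bsub>comps P n\<^esub> e \<odot>\<^bsub>comps P n\<^esub> x = c' \<odot>\<^bsub>comps P n\<^esub> x"
    using eq c e x by (simp add: M.smult_l_distr)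
  then have "e \<odot>\<^bsub>comps P n\<^esub> x = \<zero>\<^bsub>comps P n\<^esub>"
    using c e x by simp
  then have "inv e \<odot>\<^bsub>comps P n\<^esub> (e \<odot>\<^bsub>comps P n\<^esub> x) = \<zero>\<^bsub>comps P n\<^esub>"
    using e by (simp add: M.smult_r_null K.field_Units)
  then show False
    using e x by (simp add: M.smult_assoc1[symmetric] K.field_Units K.Units_l_inv M.smult_one)
qed

text \<open>
  Differentiating \<open>1 \<circ> 1 = 1\<close> gives \<open>d 1 = d 1 + d 1\<close>.
\<close>

lemma derivation_ident:
  assumes "derivation K P d"
  shows "d 1 (ident P) = \<zero>\<^bsub>comps P 1\<^esub>"
proof -
  have d: "d 1 (ident P) \<in> carrier (comps P 1)"
    by (rule derivation_closed[OF assms ident_closed])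
  have "d 1 (ident P) = d 1 (ident P) \<oplus>\<^bsub>comps P 1\<^esub> d 1 (ident P)"
    using derivation_pcomp[OF assms ident_closed ident_closed, of 1] d ident_closed
    by (simp add: ident_left[OF ident_closed, simplified] ident_left[OF d, simplified]
        ident_right[OF d, of 1, simplified])
  then show ?thesis
    using d M.add.l_cancel_one'[of "d 1 (ident P)" 1 "d 1 (ident P)"] by simp
qed

definition arity_weight :: "nat \<Rightarrow> 'k" where
  "arity_weight n = [n] \<cdot> \<one> \<ominus> \<one>"

definition arity_der :: "'k \<Rightarrow> nat \<Rightarrow> 'a \<Rightarrow> 'a" where
  "arity_der c n = (\<lambda>x\<in>carrier (comps P n). (c \<otimes> arity_weight n) \<odot>\<^bsub>comps P n\<^esub> x)"

lemma arity_weight_closed [simp]: "arity_weight n \<in> carrier K"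
  by (simp add: arity_weight_def)

lemma arity_weight_2: "arity_weight 2 = \<one>"
  by (simp add: arity_weight_def numeral_2_eq_2 K.minus_eq K.a_assoc K.r_neg)

text \<open>
  Plugging one operation into another uses up one input, so that the arity minus one is additive under
  partial composition. For this reason \<open>arity_der\<close> satisfies the Leibniz rule.
\<close>

lemma arity_weight_comp:
  assumes "1 \<le> m" shows "arity_weight (m + n - 1) = arity_weight m \<oplus> arity_weight n"
proof -
  obtain k where m: "m = Suc k" using assms by (cases m) auto
  have "[(k + n)] \<cdot> \<one> = [k] \<cdot> \<one> \<oplus> [n] \<cdot> \<one>" by (simp add: K.add.nat_pow_mult)
  then show ?thesis
    by (simp add: m arity_weight_def K.minus_eq K.a_assoc K.r_neg)
qed

lemma arity_der_derivation:
  assumes c: "c \<in> carrier K" shows "derivation K P (arity_der c)"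
  unfolding derivation_def
proof (intro conjI allI ballI impI)
  fix m n i x y
  assume x: "x \<in> carrier (comps P m)" and y: "y \<in> carrier (comps P n)" and i: "1 \<le> i \<and> i \<le> m"
  then have "pcomp P m n i x y \<in> carrier (comps P (m + n - 1))" by (intro pcomp_closed) auto
  moreover have "arity_weight (m + n - 1) = arity_weight m \<oplus> arity_weight n"
    by (rule arity_weight_comp) (use i in auto)
  ultimately show "arity_der c (m + n - 1) (pcomp P m n i x y)
      = pcomp P m n i (arity_der c m x) y \<oplus>\<^bsub>comps P (m + n - 1)\<^esub> pcomp P m n i x (arity_der c n y)"
    using x y i c
    by (simp add: arity_der_def pcomp_smult_left pcomp_smult_right K.r_distr M.smult_l_distr)
next
  fix n x \<sigma> assume "x \<in> carrier (comps P n)" "\<sigma> permutes {1..n}"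
  then show "arity_der c n (act P n x \<sigma>) = act P n (arity_der c n x) \<sigma>"
    using c by (simp add: arity_der_def act_closed act_smult)
next
  fix n a x assume "a \<in> carrier K" "x \<in> carrier (comps P n)"
  then show "arity_der c n (a \<odot>\<^bsub>comps P n\<^esub> x) = a \<odot>\<^bsub>comps P n\<^esub> arity_der c n x"
    using c by (simp add: arity_der_def M.smult_closed M.smult_assoc1[symmetric] K.m_comm)
next
  fix n x y assume "x \<in> carrier (comps P n)" "y \<in> carrier (comps P n)"
  then show "arity_der c n (x \<oplus>\<^bsub>comps P n\<^esub> y) = arity_der c n x \<oplus>\<^bsub>comps P n\<^esub> arity_der c n y"
    using c by (simp add: arity_der_def M.a_closed M.smult_r_distr)
qed (use c in \<open>auto simp: arity_der_def M.smult_closed\<close>)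

text \<open>
  A multiple of the identity can be composed once at the root and once at each of the n inputs, with
  opposite signs: together this multiplies by \<open>1 - n\<close>. The minus sign in front of c turns this into
  the weight \<open>n - 1\<close>, which is 1 on binary operations in every characteristic.
\<close>

lemma arity_der_inner:
  assumes c: "c \<in> carrier K"
  shows "inner_der P (\<ominus> c \<odot>\<^bsub>comps P 1\<^esub> ident P) = arity_der c"
proof (intro ext)
  fix n x
  show "inner_der P (\<ominus> c \<odot>\<^bsub>comps P 1\<^esub> ident P) n x = arity_der c n x"
  proof (cases "x \<in> carrier (comps P n)")
    case x: True
    let ?u = "\<ominus> c \<odot>\<^bsub>comps P 1\<^esub> ident P"
    have "pcomp P 1 n 1 ?u x = \<ominus> c \<odot>\<^bsub>comps P n\<^esub> x"
      using pcomp_smult_left[OF _ ident_closed x, of "\<ominus> c" 1] c ident_left[OF x] by simp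
    moreover have "pcomp P n 1 i x ?u = \<ominus> c \<odot>\<^bsub>comps P n\<^esub> x" if "i \<in> {1..n}" for i
      using pcomp_smult_right[OF _ x ident_closed, of "\<ominus> c" i] c that ident_right[OF x, of i] by simp
    then have "(\<Oplus>\<^bsub>comps P n\<^esub>i\<in>{1..n}. pcomp P n 1 i x ?u)
        = (\<Oplus>\<^bsub>comps P n\<^esub>i\<in>{1..n}. \<ominus> c \<odot>\<^bsub>comps P n\<^esub> x)"
      using c x by (intro M.finsum_cong') auto
    moreover have "\<dots> = [n] \<cdot>\<^bsub>comps P n\<^esub> (\<ominus> c \<odot>\<^bsub>comps P n\<^esub> x)"
      using c x by (simp add: M.add.finprod_const)
    moreover have "[k] \<cdot>\<^bsub>comps P n\<^esub> y = ([k] \<cdot> \<one>) \<odot>\<^bsub>comps P n\<^esub> y"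
      if "y \<in> carrier (comps P n)" for k :: nat and y
      using that by (induction k) (simp_all add: M.smult_l_distr)
    ultimately have "inner_der P ?u n x
        = (\<ominus> c) \<odot>\<^bsub>comps P n\<^esub> x \<ominus>\<^bsub>comps P n\<^esub> ([n] \<cdot> \<one>) \<odot>\<^bsub>comps P n\<^esub> (\<ominus> c \<odot>\<^bsub>comps P n\<^esub> x)"
      using c x by (simp add: inner_der_def)
    also have "\<dots> = (\<ominus> c \<oplus> c \<otimes> [n] \<cdot> \<one>) \<odot>\<^bsub>comps P n\<^esub> x"
      using c x by (simp add: M.minus_eq M.smult_assoc1[symmetric] M.smult_l_minus [symmetric] M.smult_l_distr
         K.l_minus K.r_minus K.m_comm del: M.smult_l_minus)
    also have "\<ominus> c \<oplus> c \<otimes> [n] \<cdot> \<one> = c \<otimes> arity_weight n"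
      using c by (simp add: arity_weight_def K.minus_eq K.r_distr K.r_minus K.a_comm)
    finally show ?thesis using x by (simp add: arity_der_def)
  qed (simp add: inner_der_def arity_der_def)
qed

lemma ider_arity_der:
  assumes "carrier (comps P 1) = (\<lambda>c. c \<odot>\<^bsub>comps P 1\<^esub> ident P) ` carrier K"
  shows "ider P = arity_der ` carrier K"
proof -
  have "ider P = (\<lambda>c. inner_der P (c \<odot>\<^bsub>comps P 1\<^esub> ident P)) ` carrier K"
    by (simp only: ider_def assms image_image)
  also have "\<dots> = (\<lambda>c. inner_der P (\<ominus> c \<odot>\<^bsub>comps P 1\<^esub> ident P)) ` carrier K"
    by (auto simp: image_iff) (metis K.a_inv_closed K.minus_minus)+
  also have "\<dots> = arity_der ` carrier K" using arity_der_inner by (intro image_cong) auto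
  finally show ?thesis .
qed

lemma arity_der_2:
  assumes "c \<in> carrier K" "x \<in> carrier (comps P 2)"
  shows "arity_der c 2 x = c \<odot>\<^bsub>comps P 2\<^esub> x"
  using assms by (simp add: arity_der_def arity_weight_2)

text \<open>
  An operad generated by one binary operation \<open>\<mu>\<close>, in the weak sense that \<open>\<mu>\<close> determines every
  derivation, has only inner derivations as soon as \<open>\<mu>\<close> is an eigenvector of all of them:
  \<open>arity_der a\<close> has eigenvalue a on \<open>\<mu>\<close>, so it equals every derivation with this eigenvalue.
\<close>

theorem derivations_one_dimensional:
  assumes P1: "carrier (comps P 1) = (\<lambda>c. c \<odot>\<^bsub>comps P 1\<^esub> ident P) ` carrier K"
    and \<mu>: "\<mu> \<in> carrier (comps P 2)" "\<mu> \<noteq> \<zero>\<^bsub>comps P 2\<^esub>"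
    and eigen: "\<And>d. derivation K P d \<Longrightarrow> \<exists>a\<in>carrier K. d 2 \<mu> = a \<odot>\<^bsub>comps P 2\<^esub> \<mu>"
    and unique: "\<And>d d'. \<lbrakk>derivation K P d; derivation K P d'; d 2 \<mu> = d' 2 \<mu>\<rbrakk> \<Longrightarrow> d = d'"
  shows "lie_iso K (der K P) (lie_base K)" and "lie_trivial (H1 K P)"
proof -
  have der: "carrier (der K P) = arity_der ` carrier K"
  proof (intro equalityI subsetI)
    fix d assume "d \<in> carrier (der K P)"
    then have d: "derivation K P d" by (simp add: der_def)
    then obtain a where a: "a \<in> carrier K" "d 2 \<mu> = a \<odot>\<^bsub>comps P 2\<^esub> \<mu>" using eigen by blast
    then have "d = arity_der a"
      using d \<mu> by (intro unique arity_der_derivation) (simp_all add: arity_der_2)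
    then show "d \<in> arity_der ` carrier K" using a by blast
  qed (auto simp: der_def arity_der_derivation)
  have inj: "a = b" if "a \<in> carrier K" "b \<in> carrier K" "arity_der a = arity_der b" for a b
    using that \<mu> arity_der_2[of a \<mu>] arity_der_2[of b \<mu>] smult_cancel[OF \<mu>, of a b] by simp
  have add: "arity_der a \<oplus>\<^bsub>der K P\<^esub> arity_der b = arity_der (a \<oplus> b)"
    if "a \<in> carrier K" "b \<in> carrier K" for a b
    using that by (auto simp: der_def arity_der_def fun_eq_iff K.l_distr M.smult_l_distr)
  have smult: "c \<odot>\<^bsub>der K P\<^esub> arity_der a = arity_der (c \<otimes> a)"
    if "a \<in> carrier K" "c \<in> carrier K" for a c
    using that by (auto simp: der_def arity_der_def fun_eq_iff M.smult_assoc1[symmetric] K.m_assoc)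
  have bracket: "bracket (der K P) (arity_der a) (arity_der b) = arity_der \<zero>"
    if "a \<in> carrier K" "b \<in> carrier K" for a b
    using that by (auto simp: der_def arity_der_def fun_eq_iff M.smult_closed M.smult_assoc1[symmetric]
        M.smult_l_null K.m_ac a_minus_def M.r_neg)
  define f where "f = the_inv_into (carrier K) arity_der"
  have inj_on: "inj_on arity_der (carrier K)" using inj by (auto intro: inj_onI)
  have f: "f (arity_der a) = a" if "a \<in> carrier K" for a
    unfolding f_def using inj_on that by (rule the_inv_into_f_f)
  have "bij_betw f (carrier (der K P)) (carrier K)"
    unfolding der f_def using inj_on by (simp add: bij_betw_the_inv_into inj_on_imp_bij_betw)
  then show "lie_iso K (der K P) (lie_base K)"
    unfolding lie_iso_def lie_base_def
    by (intro exI[of _ f]) (auto simp: der add smult bracket f)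
  have "ider P = carrier (der K P)" using ider_arity_der[OF P1] der by simp
  then show "lie_trivial (H1 K P)"
    using lie_trivial_quotient_self[OF K.abelian_group_axioms der add] by (simp add: H1_def)
qed

end

context operad
begin

lemma derivation_addI:
  assumes d: "derivation K P d" and e: "derivation K P e"
  shows "derivation K P (d \<oplus>\<^bsub>der K P\<^esub> e)"
proof -
  note dD = derivationD[OF d] and eD = derivationD[OF e]
  show ?thesis
    unfolding derivation_def
  proof (intro conjI allI ballI impI)
    fix m n i x y
    assume x: "x \<in> carrier (comps P m)" and y: "y \<in> carrier (comps P n)" and i: "1 \<le> i \<and> i \<le> m"
    have "pcomp P m n i x y \<in> carrier (comps P (m + n - 1))" using x y i by (intro pcomp_closed) auto
    then show "(d \<oplus>\<^bsub>der K P\<^esub> e) (m + n - 1) (pcomp P m n i x y)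
        = pcomp P m n i ((d \<oplus>\<^bsub>der K P\<^esub> e) m x) y
          \<oplus>\<^bsub>comps P (m + n - 1)\<^esub> pcomp P m n i x ((d \<oplus>\<^bsub>der K P\<^esub> e) n y)"
      using x y i
      by (simp add: der_def dD eD pcomp_add_left pcomp_add_right pcomp_closed M.M.a_ac del: One_nat_def)
  qed (simp_all add: der_def dD eD act_closed act_add M.M.a_ac M.smult_r_distr)
qed

lemma derivation_smultI:
  assumes c: "c \<in> carrier K" and d: "derivation K P d"
  shows "derivation K P (c \<odot>\<^bsub>der K P\<^esub> d)"
proof -
  note dD = derivationD[OF d]
  show ?thesis
    unfolding derivation_def
  proof (intro conjI allI ballI impI)
    fix m n i x y
    assume x: "x \<in> carrier (comps P m)" and y: "y \<in> carrier (comps P n)" and i: "1 \<le> i \<and> i \<le> m"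
    have "pcomp P m n i x y \<in> carrier (comps P (m + n - 1))" using x y i by (intro pcomp_closed) auto
    then show "(c \<odot>\<^bsub>der K P\<^esub> d) (m + n - 1) (pcomp P m n i x y)
        = pcomp P m n i ((c \<odot>\<^bsub>der K P\<^esub> d) m x) y
          \<oplus>\<^bsub>comps P (m + n - 1)\<^esub> pcomp P m n i x ((c \<odot>\<^bsub>der K P\<^esub> d) n y)"
      using x y i c
      by (simp add: der_def dD pcomp_smult_left pcomp_smult_right pcomp_closed M.smult_r_distr del: One_nat_def)
  next
    fix n a x assume "a \<in> carrier K" "x \<in> carrier (comps P n)"
    then show "(c \<odot>\<^bsub>der K P\<^esub> d) n (a \<odot>\<^bsub>comps P n\<^esub> x) = a \<odot>\<^bsub>comps P n\<^esub> (c \<odot>\<^bsub>der K P\<^esub> d) n x"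
      using c by (simp add: der_def dD M.smult_assoc1 [symmetric] K.m_comm)
  qed (use c in \<open>simp_all add: der_def dD act_closed act_smult M.smult_r_distr\<close>)
qed

text \<open>
  With two binary operations the eigenvalues on \<open>\<mu>\<close> and \<open>\<nu>\<close> can be prescribed independently:
  \<open>arity_der a + b \<beta>\<close> has eigenvalues a and \<open>a + b\<close>. In the coordinates a and b the inner
  derivations are the axis \<open>b = 0\<close>. Since the arity derivation is a scalar in each arity, it commutes
  with \<open>\<beta>\<close>, and the Lie algebra is abelian.
\<close>

theorem derivations_two_dimensional:
  assumes P1: "carrier (comps P 1) = (\<lambda>c. c \<odot>\<^bsub>comps P 1\<^esub> ident P) ` carrier K"
    and \<mu>: "\<mu> \<in> carrier (comps P 2)" "\<mu> \<noteq> \<zero>\<^bsub>comps P 2\<^esub>"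
    and \<nu>: "\<nu> \<in> carrier (comps P 2)" "\<nu> \<noteq> \<zero>\<^bsub>comps P 2\<^esub>"
    and eigen: "\<And>d. derivation K P d \<Longrightarrow>
        \<exists>a\<in>carrier K. \<exists>b\<in>carrier K. d 2 \<mu> = a \<odot>\<^bsub>comps P 2\<^esub> \<mu> \<and> d 2 \<nu> = b \<odot>\<^bsub>comps P 2\<^esub> \<nu>"
    and unique: "\<And>d d'. \<lbrakk>derivation K P d; derivation K P d'; d 2 \<mu> = d' 2 \<mu>; d 2 \<nu> = d' 2 \<nu>\<rbrakk> \<Longrightarrow> d = d'"
    and \<beta>: "derivation K P \<beta>" "\<beta> 2 \<mu> = \<zero>\<^bsub>comps P 2\<^esub>" "\<beta> 2 \<nu> = \<nu>"
  shows "lie_iso K (der K P) (lie_dsum (lie_base K) (lie_base K))"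
    and "lie_iso K (H1 K P) (lie_base K)"
proof -
  define \<phi> where "\<phi> a b = arity_der a \<oplus>\<^bsub>der K P\<^esub> b \<odot>\<^bsub>der K P\<^esub> \<beta>" for a b
  note \<beta>D = derivationD[OF \<beta>(1)]
  have \<phi>_der: "derivation K P (\<phi> a b)" if "a \<in> carrier K" "b \<in> carrier K" for a b
    unfolding \<phi>_def using that by (intro derivation_addI derivation_smultI arity_der_derivation \<beta>)
  have \<phi>\<mu>: "\<phi> a b 2 \<mu> = a \<odot>\<^bsub>comps P 2\<^esub> \<mu>" and \<phi>\<nu>: "\<phi> a b 2 \<nu> = (a \<oplus> b) \<odot>\<^bsub>comps P 2\<^esub> \<nu>"
    if "a \<in> carrier K" "b \<in> carrier K" for a b
    using that \<mu> \<nu> by (simp_all add: \<phi>_def der_def arity_der_2 \<beta> M.smult_l_distr)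
  have \<phi>_eqI: "d = \<phi> a b"
    if "derivation K P d" "a \<in> carrier K" "b \<in> carrier K"
      "d 2 \<mu> = a \<odot>\<^bsub>comps P 2\<^esub> \<mu>" "d 2 \<nu> = (a \<oplus> b) \<odot>\<^bsub>comps P 2\<^esub> \<nu>" for d a b
    using that by (intro unique \<phi>_der) (simp_all add: \<phi>\<mu> \<phi>\<nu>)
  have der: "carrier (der K P) = {\<phi> a b | a b. a \<in> carrier K \<and> b \<in> carrier K}"
  proof (intro equalityI subsetI)
    fix d assume "d \<in> carrier (der K P)"
    then have d: "derivation K P d" by (simp add: der_def)
    then obtain a b where ab: "a \<in> carrier K" "b \<in> carrier K"
      "d 2 \<mu> = a \<odot>\<^bsub>comps P 2\<^esub> \<mu>" "d 2 \<nu> = b \<odot>\<^bsub>comps P 2\<^esub> \<nu>" using eigen by blast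
    moreover have "a \<oplus> (b \<ominus> a) = b"
      using ab K.a_lcomm[of a b "\<ominus> a"] by (simp add: K.minus_eq K.r_neg)
    ultimately have "d = \<phi> a (b \<ominus> a)" using d by (intro \<phi>_eqI) simp_all
    then show "d \<in> {\<phi> a b | a b. a \<in> carrier K \<and> b \<in> carrier K}" using ab by blast
  qed (auto simp: der_def \<phi>_der)
  have inj: "a = a' \<and> b = b'"
    if ab: "a \<in> carrier K" "b \<in> carrier K" "a' \<in> carrier K" "b' \<in> carrier K" and eq: "\<phi> a b = \<phi> a' b'"
    for a b a' b'
  proof -
    have "a = a'"
      using smult_cancel[OF \<mu>, of a a'] \<phi>\<mu>[of a b] \<phi>\<mu>[of a' b'] ab eq by simp
    moreover have "a \<oplus> b = a' \<oplus> b'"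
      using smult_cancel[OF \<nu>, of "a \<oplus> b" "a' \<oplus> b'"] \<phi>\<nu>[of a b] \<phi>\<nu>[of a' b'] ab eq by simp
    ultimately show ?thesis using ab by simp
  qed
  have add: "\<phi> a b \<oplus>\<^bsub>der K P\<^esub> \<phi> a' b' = \<phi> (a \<oplus> a') (b \<oplus> b')"
    if ab: "a \<in> carrier K" "b \<in> carrier K" "a' \<in> carrier K" "b' \<in> carrier K" for a b a' b'
  proof (rule \<phi>_eqI)
    show "(\<phi> a b \<oplus>\<^bsub>der K P\<^esub> \<phi> a' b') 2 \<mu> = (a \<oplus> a') \<odot>\<^bsub>comps P 2\<^esub> \<mu>"
      using ab \<mu> by (simp add: der_def[of K P] \<phi>\<mu> M.smult_l_distr)
    show "(\<phi> a b \<oplus>\<^bsub>der K P\<^esub> \<phi> a' b') 2 \<nu> = (a \<oplus> a' \<oplus> (b \<oplus> b')) \<odot>\<^bsub>comps P 2\<^esub> \<nu>"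
      using ab \<nu> by (simp add: der_def[of K P] \<phi>\<nu> M.smult_l_distr[symmetric] K.a_ac)
  qed (use ab in \<open>auto intro: derivation_addI \<phi>_der\<close>)
  have smult: "c \<odot>\<^bsub>der K P\<^esub> \<phi> a b = \<phi> (c \<otimes> a) (c \<otimes> b)"
    if ab: "c \<in> carrier K" "a \<in> carrier K" "b \<in> carrier K" for a b c
  proof (rule \<phi>_eqI)
    show "(c \<odot>\<^bsub>der K P\<^esub> \<phi> a b) 2 \<mu> = (c \<otimes> a) \<odot>\<^bsub>comps P 2\<^esub> \<mu>"
      using ab \<mu> by (simp add: der_def[of K P] \<phi>\<mu> M.smult_assoc1)
    show "(c \<odot>\<^bsub>der K P\<^esub> \<phi> a b) 2 \<nu> = (c \<otimes> a \<oplus> c \<otimes> b) \<odot>\<^bsub>comps P 2\<^esub> \<nu>"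
      using ab \<nu> by (simp add: der_def[of K P] \<phi>\<nu> M.smult_assoc1 K.r_distr[symmetric])
  qed (use ab in \<open>auto intro: derivation_smultI \<phi>_der\<close>)
  have bracket: "bracket (der K P) (\<phi> a b) (\<phi> a' b') = \<phi> \<zero> \<zero>"
    if ab: "a \<in> carrier K" "b \<in> carrier K" "a' \<in> carrier K" "b' \<in> carrier K" for a b a' b'
  proof (intro ext)
    fix n x
    show "bracket (der K P) (\<phi> a b) (\<phi> a' b') n x = \<phi> \<zero> \<zero> n x"
    proof (cases "x \<in> carrier (comps P n)")
      case x: True
      have "\<phi> a b n (\<phi> a' b' n x) = \<phi> a' b' n (\<phi> a b n x)"
        using ab x by (simp add: \<phi>_def der_def arity_der_def \<beta>D M.smult_r_distr
            M.smult_assoc1[symmetric] K.m_ac M.M.a_ac)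
      moreover have "\<phi> \<zero> \<zero> n x = \<zero>\<^bsub>comps P n\<^esub>"
        using x by (simp add: \<phi>_def der_def arity_der_def \<beta>D)
      moreover have "\<phi> a' b' n (\<phi> a b n x) \<in> carrier (comps P n)"
        using ab x by (intro derivation_closed[OF \<phi>_der])
      ultimately show ?thesis
        using x by (simp add: der_def[of K P] a_minus_def M.M.r_neg)
    qed (simp add: \<phi>_def der_def)
  qed
  show "lie_iso K (der K P) (lie_dsum (lie_base K) (lie_base K))"
    by (rule lie_iso_quotient_coordinate(1)[OF field der inj add smult bracket])
  have "\<phi> a \<zero> = arity_der a" if "a \<in> carrier K" for a
  proof (intro ext)
    fix n x show "\<phi> a \<zero> n x = arity_der a n x"
      using that by (cases "x \<in> carrier (comps P n)") (simp_all add: \<phi>_def der_def arity_der_def \<beta>D)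
  qed
  then have "ider P = (\<lambda>a. \<phi> a \<zero>) ` carrier K"
    unfolding ider_arity_der[OF P1] by (intro image_cong) simp_all
  then have "ider P = {\<phi> a \<zero> | a. a \<in> carrier K}" by (simp add: Setcompr_eq_image)
  then have H1: "H1 K P = lie_quotient (der K P) {\<phi> a \<zero> | a. a \<in> carrier K}" by (simp only: H1_def)
  show "lie_iso K (H1 K P) (lie_base K)"
    unfolding H1 by (rule lie_iso_quotient_coordinate(2)[OF field der inj add smult bracket])
qed

end


section \<open>The commutative operad\<close>

text \<open>
  A derivation of \<open>Com\<close> is the sequence of the scalars \<open>d n 1\<close>, subject to
  \<open>d (m + n - 1) 1 = d m 1 + d n 1\<close> for \<open>m \<ge> 1\<close>. With \<open>m = 2\<close> this recursion, started at
  \<open>d 1 1 = 0\<close>, computes the whole sequence from \<open>d 2 1\<close>, in arity zero by running it backwards.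
\<close>

theorem Com_derivations:
  fixes K :: "('k, 'r) ring_scheme"
  assumes "field K"
  shows "lie_iso K (der K (Com K)) (lie_base K)" and "lie_trivial (H1 K (Com K))"
proof -
  interpret operad K "Com K" by (rule Com_operad[OF assms])
  have P1: "carrier (comps (Com K) 1)
      = (\<lambda>c. c \<odot>\<^bsub>comps (Com K) 1\<^esub> ident (Com K)) ` carrier K"
    by (auto simp: Com_def image_iff)
  have \<mu>: "\<one>\<^bsub>K\<^esub> \<in> carrier (comps (Com K) 2)" "\<one>\<^bsub>K\<^esub> \<noteq> \<zero>\<^bsub>comps (Com K) 2\<^esub>"
    by (simp_all add: Com_def)
  have eigen: "\<exists>a\<in>carrier K. d 2 \<one>\<^bsub>K\<^esub> = a \<odot>\<^bsub>comps (Com K) 2\<^esub> \<one>\<^bsub>K\<^esub>"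
    if "derivation K (Com K) d" for d
    using derivation_closed[OF that \<mu>(1)] by (intro bexI[of _ "d 2 \<one>\<^bsub>K\<^esub>"]) (simp_all add: Com_def)
  have unique: "d = d'"
    if d: "derivation K (Com K) d" and d': "derivation K (Com K) d'" and eq: "d 2 \<one>\<^bsub>K\<^esub> = d' 2 \<one>\<^bsub>K\<^esub>"
    for d d'
  proof (rule derivation_eqI[OF d d'])
    have clos: "e n \<one>\<^bsub>K\<^esub> \<in> carrier K" if "derivation K (Com K) e" for e n
      using derivation_closed[OF that, of "\<one>\<^bsub>K\<^esub>" n] by (simp add: Com_def)
    have one: "e 1 \<one>\<^bsub>K\<^esub> = \<zero>\<^bsub>K\<^esub>" if "derivation K (Com K) e" for e
      using derivation_ident[OF that] by (simp add: Com_def)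
    have step: "e (Suc n) \<one>\<^bsub>K\<^esub> = e 2 \<one>\<^bsub>K\<^esub> \<oplus>\<^bsub>K\<^esub> e n \<one>\<^bsub>K\<^esub>" if "derivation K (Com K) e" for e n
      using derivation_pcomp[OF that, of "\<one>\<^bsub>K\<^esub>" 2 "\<one>\<^bsub>K\<^esub>" n 1] clos[OF that]
      by (simp add: Com_def)
    have unit: "d n \<one>\<^bsub>K\<^esub> = d' n \<one>\<^bsub>K\<^esub>" for n
    proof (induction n)
      case 0
      have "d 2 \<one>\<^bsub>K\<^esub> \<oplus>\<^bsub>K\<^esub> d 0 \<one>\<^bsub>K\<^esub> = d 2 \<one>\<^bsub>K\<^esub> \<oplus>\<^bsub>K\<^esub> d' 0 \<one>\<^bsub>K\<^esub>"
        using step[OF d, of 0] step[OF d', of 0] one[OF d] one[OF d'] eq by simp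
      then show ?case using clos[OF d] clos[OF d'] by simp
    next
      case (Suc n)
      then show ?case by (simp only: step[OF d] step[OF d'] eq)
    qed
    fix n x assume "x \<in> carrier (comps (Com K) n)"
    then show "d n x = d' n x"
      using derivation_smult[OF d, of x "\<one>\<^bsub>K\<^esub>" n] derivation_smult[OF d', of x "\<one>\<^bsub>K\<^esub>" n] unit[of n]
      by (simp add: Com_def)
  qed
  show "lie_iso K (der K (Com K)) (lie_base K)"
    by (rule derivations_one_dimensional(1)[OF P1 \<mu>], erule eigen, rule unique)
  show "lie_trivial (H1 K (Com K))"
    by (rule derivations_one_dimensional(2)[OF P1 \<mu>], erule eigen, rule unique)
qed


section \<open>The associative operad\<close>

lemma perm_ins_id:
  assumes "1 \<le> i" "i \<le> m" shows "perm_ins m n i id id = id"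
  using assms by (auto simp: perm_ins_def fun_eq_iff Let_def)

lemma perm_ins_id_left:
  assumes "\<tau> permutes {1..n}" shows "perm_ins 1 n 1 id \<tau> = \<tau>"
  using permutes_not_in[OF assms] by (auto simp: perm_ins_def fun_eq_iff)

lemma perm_ins_id_right:
  assumes \<sigma>: "\<sigma> permutes {1..m}" and i: "1 \<le> i" "i \<le> m" shows "perm_ins m 1 i \<sigma> id = \<sigma>"
proof -
  have "1 \<le> \<sigma> i" using permutes_in_image[OF \<sigma>, of i] i by simp
  then show ?thesis
    using permutes_not_in[OF \<sigma>] i by (auto simp: perm_ins_def fun_eq_iff less_Suc_eq)
qed

lemma permutes_singleton_iff: "\<sigma> permutes {a} \<longleftrightarrow> \<sigma> = id"
  by (metis permutes_id permutes_sing)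

lemma permutes_1_2: "\<sigma> permutes {1..2::nat} \<longleftrightarrow> \<sigma> = id \<or> \<sigma> = swap12"
proof -
  have "{1..2::nat} = {1, 2}" by auto
  then show ?thesis using permutes_doubleton_iff[of \<sigma> 1 2] by auto
qed

lemma swap12_permutes: "swap12 permutes {1..2}"
  by (simp only: permutes_1_2 simp_thms)

locale associative_operad = field
begin

abbreviation "A \<equiv> Ass R"

definition basis :: "nat \<Rightarrow> (nat \<Rightarrow> nat) \<Rightarrow> (nat \<Rightarrow> nat) \<Rightarrow> 'a" where
  "basis n \<sigma> = (\<lambda>\<pi>\<in>{\<pi>. \<pi> permutes {1..n}}. if \<pi> = \<sigma> then \<one> else \<zero>)"

definition fibre :: "nat \<Rightarrow> nat \<Rightarrow> nat \<Rightarrow> (nat \<Rightarrow> nat) \<Rightarrow> ((nat \<Rightarrow> nat) \<times> (nat \<Rightarrow> nat)) set" where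
  "fibre m n i \<pi> = {(\<sigma>, \<tau>). \<sigma> permutes {1..m} \<and> \<tau> permutes {1..n} \<and> perm_ins m n i \<sigma> \<tau> = \<pi>}"

lemma finite_fibre [simp]: "finite (fibre m n i \<pi>)"
  by (rule finite_subset[of _ "{\<sigma>. \<sigma> permutes {1..m}} \<times> {\<tau>. \<tau> permutes {1..n}}"])
    (auto simp: fibre_def finite_permutations)

lemma Ass_carrier: "f \<in> carrier (comps A n) \<longleftrightarrow>
    (\<forall>\<pi>. \<pi> permutes {1..n} \<longrightarrow> f \<pi> \<in> carrier R) \<and> (\<forall>\<pi>. \<not> \<pi> permutes {1..n} \<longrightarrow> f \<pi> = undefined)"
  by (auto simp: Ass_def Let_def PiE_def Pi_def extensional_def)

lemma Ass_eqI:
  assumes "f \<in> carrier (comps A n)" "g \<in> carrier (comps A n)"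
    and "\<And>\<pi>. \<pi> permutes {1..n} \<Longrightarrow> f \<pi> = g \<pi>"
  shows "f = g"
  using assms unfolding Ass_carrier by (metis ext)

lemma Ass_coeff:
  assumes "\<pi> permutes {1..n}"
  shows Ass_add: "(f \<oplus>\<^bsub>comps A n\<^esub> g) \<pi> = f \<pi> \<oplus> g \<pi>"
    and Ass_smult: "(c \<odot>\<^bsub>comps A n\<^esub> f) \<pi> = c \<otimes> f \<pi>"
    and Ass_zero: "\<zero>\<^bsub>comps A n\<^esub> \<pi> = \<zero>"
    and Ass_act: "act A n f \<sigma> \<pi> = f (\<pi> \<circ> inv_into UNIV \<sigma>)"
    and Ass_basis: "basis n \<sigma> \<pi> = (if \<pi> = \<sigma> then \<one> else \<zero>)"
  using assms by (simp_all add: Ass_def Let_def basis_def)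

lemma Ass_pcomp:
  assumes "\<pi> permutes {1..m + n - 1}"
  shows "pcomp A m n i f g \<pi> = (\<Oplus>p\<in>fibre m n i \<pi>. f (fst p) \<otimes> g (snd p))"
  using assms by (simp add: Ass_def fibre_def)

lemma Ass_ident: "ident A = basis 1 id"
  by (auto simp: Ass_def basis_def permutes_singleton_iff restrict_def)

lemma Ass_module: "module R (comps A n)"
proof (intro moduleI abelian_groupI)
  fix x assume "x \<in> carrier (comps A n)"
  then show "\<exists>y\<in>carrier (comps A n). y \<oplus>\<^bsub>comps A n\<^esub> x = \<zero>\<^bsub>comps A n\<^esub>"
    by (intro bexI[of _ "\<lambda>\<pi>\<in>{\<pi>. \<pi> permutes {1..n}}. \<ominus> x \<pi>"])
      (auto simp: Ass_def Let_def PiE_mem intro!: restrict_ext l_neg)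
qed (auto simp: Ass_def Let_def PiE_iff extensional_def is_cring a_ac m_assoc l_distr r_distr
      restrict_def split: if_splits intro!: ext)

lemma Ass_pcomp_term:
  assumes "f \<in> carrier (comps A m)" "g \<in> carrier (comps A n)" "p \<in> fibre m n i \<pi>"
  shows "f (fst p) \<in> carrier R" "g (snd p) \<in> carrier R"
  using assms by (auto simp: fibre_def Ass_carrier)

lemma Ass_pcomp_closed:
  assumes "f \<in> carrier (comps A m)" "g \<in> carrier (comps A n)"
  shows "pcomp A m n i f g \<in> carrier (comps A (m + n - 1))"
proof -
  have "pcomp A m n i f g \<pi> \<in> carrier R" if "\<pi> permutes {1..m + n - 1}" for \<pi>
    using Ass_pcomp_term[OF assms] by (subst Ass_pcomp[OF that]) (auto intro!: finsum_closed)
  then show ?thesis unfolding Ass_carrier by (auto simp: Ass_def)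
qed

lemma basis_closed [simp]: "basis n \<sigma> \<in> carrier (comps A n)"
  by (auto simp: Ass_carrier basis_def)

lemma pre_operad_Ass: "pre_operad R A"
proof (rule pre_operad.intro)
  note cl = Ass_pcomp_closed and mod = Ass_module and tm = Ass_pcomp_term
  show "field R" by (rule field_axioms)
  show "module R (comps A n)" for n by (rule mod)
  show act: "act A n x \<sigma> \<in> carrier (comps A n)" if "x \<in> carrier (comps A n)" "\<sigma> permutes {1..n}" for x n \<sigma>
    using that permutes_compose[OF permutes_inv[OF that(2)]] by (auto simp: Ass_def Let_def PiE_mem)
  show "act A n (c \<odot>\<^bsub>comps A n\<^esub> x) \<sigma> = c \<odot>\<^bsub>comps A n\<^esub> act A n x \<sigma>"
    if "c \<in> carrier R" "x \<in> carrier (comps A n)" "\<sigma> permutes {1..n}" for c x n \<sigma>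
    using that permutes_compose[OF permutes_inv[OF that(3)]]
    by (intro Ass_eqI[of _ n] act module.smult_closed[OF mod]) (auto simp: Ass_coeff)
  show "ident A \<in> carrier (comps A 1)" by (simp only: Ass_ident basis_closed)
  show "pcomp A m n i x y \<in> carrier (comps A (m + n - 1))"
    if "x \<in> carrier (comps A m)" "y \<in> carrier (comps A n)" "1 \<le> i" "i \<le> m" for x y m n i
    using that by (rule_tac cl)
  show "pcomp A m n i (c \<odot>\<^bsub>comps A m\<^esub> x) y = c \<odot>\<^bsub>comps A (m + n - 1)\<^esub> pcomp A m n i x y"
    if "c \<in> carrier R" and x: "x \<in> carrier (comps A m)" and y: "y \<in> carrier (comps A n)"
      and i: "1 \<le> i" "i \<le> m" for c x y m n i
  proof (rule Ass_eqI)
    fix \<pi> assume \<pi>: "\<pi> permutes {1..m + n - 1}"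
    have "(c \<odot>\<^bsub>comps A m\<^esub> x) (fst p) \<otimes> y (snd p) = c \<otimes> (x (fst p) \<otimes> y (snd p))"
      if p: "p \<in> fibre m n i \<pi>" for p
      using tm[OF x y p] p \<open>c \<in> carrier R\<close> by (auto simp: fibre_def Ass_coeff m_assoc)
    then have "pcomp A m n i (c \<odot>\<^bsub>comps A m\<^esub> x) y \<pi> = (\<Oplus>p\<in>fibre m n i \<pi>. c \<otimes> (x (fst p) \<otimes> y (snd p)))"
      unfolding Ass_pcomp[OF \<pi>] using tm[OF x y] \<open>c \<in> carrier R\<close> by (intro finsum_cong') auto
    also have "\<dots> = (c \<odot>\<^bsub>comps A (m + n - 1)\<^esub> pcomp A m n i x y) \<pi>"
      unfolding Ass_smult[OF \<pi>] Ass_pcomp[OF \<pi>]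
      using tm[OF x y] \<open>c \<in> carrier R\<close> by (intro finsum_rdistr[symmetric]) auto
    finally show "pcomp A m n i (c \<odot>\<^bsub>comps A m\<^esub> x) y \<pi> = (c \<odot>\<^bsub>comps A (m + n - 1)\<^esub> pcomp A m n i x y) \<pi>" .
  qed (insert that, (intro cl module.smult_closed[OF mod]; assumption)+)
  show "pcomp A m n i x (c \<odot>\<^bsub>comps A n\<^esub> y) = c \<odot>\<^bsub>comps A (m + n - 1)\<^esub> pcomp A m n i x y"
    if "c \<in> carrier R" and x: "x \<in> carrier (comps A m)" and y: "y \<in> carrier (comps A n)"
      and i: "1 \<le> i" "i \<le> m" for c x y m n i
  proof (rule Ass_eqI)
    fix \<pi> assume \<pi>: "\<pi> permutes {1..m + n - 1}"
    have "x (fst p) \<otimes> (c \<odot>\<^bsub>comps A n\<^esub> y) (snd p) = c \<otimes> (x (fst p) \<otimes> y (snd p))"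
      if p: "p \<in> fibre m n i \<pi>" for p
      using tm[OF x y p] p \<open>c \<in> carrier R\<close> by (auto simp: fibre_def Ass_coeff m_lcomm)
    then have "pcomp A m n i x (c \<odot>\<^bsub>comps A n\<^esub> y) \<pi> = (\<Oplus>p\<in>fibre m n i \<pi>. c \<otimes> (x (fst p) \<otimes> y (snd p)))"
      unfolding Ass_pcomp[OF \<pi>] using tm[OF x y] \<open>c \<in> carrier R\<close> by (intro finsum_cong') auto
    also have "\<dots> = (c \<odot>\<^bsub>comps A (m + n - 1)\<^esub> pcomp A m n i x y) \<pi>"
      unfolding Ass_smult[OF \<pi>] Ass_pcomp[OF \<pi>]
      using tm[OF x y] \<open>c \<in> carrier R\<close> by (intro finsum_rdistr[symmetric]) auto
    finally show "pcomp A m n i x (c \<odot>\<^bsub>comps A n\<^esub> y) \<pi> = (c \<odot>\<^bsub>comps A (m + n - 1)\<^esub> pcomp A m n i x y) \<pi>" .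
  qed (insert that, (intro cl module.smult_closed[OF mod]; assumption)+)
  show "pcomp A 1 n 1 (ident A) y = y" if y: "y \<in> carrier (comps A n)" for y n
  proof (rule Ass_eqI[of _ n])
    show "pcomp A 1 n 1 (ident A) y \<in> carrier (comps A n)"
      using cl[of "ident A" 1 y n 1] y unfolding Ass_ident by simp
    fix \<pi> assume \<pi>: "\<pi> permutes {1..n}"
    then have "fibre 1 n 1 \<pi> = {(id, \<pi>)}"
      by (auto simp: fibre_def permutes_singleton_iff perm_ins_id_left[simplified])
    then show "pcomp A 1 n 1 (ident A) y \<pi> = y \<pi>"
      using \<pi> y unfolding Ass_ident by (subst Ass_pcomp) (auto simp: Ass_coeff Ass_carrier permutes_id)
  qed (rule y)
  show "pcomp A m 1 i x (ident A) = x" if x: "x \<in> carrier (comps A m)" and i: "1 \<le> i" "i \<le> m" for x m i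
  proof (rule Ass_eqI[of _ m])
    show "pcomp A m 1 i x (ident A) \<in> carrier (comps A m)"
      using cl[of x m "ident A" 1 i] x unfolding Ass_ident by simp
    fix \<pi> assume \<pi>: "\<pi> permutes {1..m}"
    then have "fibre m 1 i \<pi> = {(\<pi>, id)}"
      using i by (auto simp: fibre_def permutes_singleton_iff perm_ins_id_right[simplified])
    then show "pcomp A m 1 i x (ident A) \<pi> = x \<pi>"
      using \<pi> x unfolding Ass_ident by (subst Ass_pcomp) (auto simp: Ass_coeff Ass_carrier permutes_id)
  qed (rule x)
qed

lemma Ass_pcomp_basis:
  assumes \<sigma>: "\<sigma> permutes {1..m}" and \<tau>: "\<tau> permutes {1..n}" and i: "1 \<le> i" "i \<le> m"
  shows "pcomp A m n i (basis m \<sigma>) (basis n \<tau>) = basis (m + n - 1) (perm_ins m n i \<sigma> \<tau>)"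
proof (rule Ass_eqI[of _ "m + n - 1"])
  fix \<pi> assume \<pi>: "\<pi> permutes {1..m + n - 1}"
  have "pcomp A m n i (basis m \<sigma>) (basis n \<tau>) \<pi>
      = (\<Oplus>p\<in>fibre m n i \<pi>. if (\<sigma>, \<tau>) = p then \<one> else \<zero>)"
    unfolding Ass_pcomp[OF \<pi>] by (rule finsum_cong) (auto simp: fibre_def Ass_coeff simp_implies_def split: if_splits)
  also have "\<dots> = (if (\<sigma>, \<tau>) \<in> fibre m n i \<pi> then \<one> else \<zero>)"
  proof (cases "(\<sigma>, \<tau>) \<in> fibre m n i \<pi>")
    case True
    then show ?thesis using finsum_singleton[of "(\<sigma>, \<tau>)" "fibre m n i \<pi>" "\<lambda>_. \<one>"] by simp
  next
    case False
    then have "(\<Oplus>p\<in>fibre m n i \<pi>. if (\<sigma>, \<tau>) = p then \<one> else \<zero>) = (\<Oplus>p\<in>fibre m n i \<pi>. \<zero>)"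
      by (intro finsum_cong) (auto simp: simp_implies_def)
    then show ?thesis using False by (simp add: finsum_zero)
  qed
  also have "\<dots> = basis (m + n - 1) (perm_ins m n i \<sigma> \<tau>) \<pi>"
    using \<sigma> \<tau> \<pi> by (auto simp: fibre_def Ass_coeff)
  finally show "pcomp A m n i (basis m \<sigma>) (basis n \<tau>) \<pi> = basis (m + n - 1) (perm_ins m n i \<sigma> \<tau>) \<pi>" .
qed (intro Ass_pcomp_closed basis_closed)+

lemma Ass_act_basis:
  assumes \<sigma>: "\<sigma> permutes {1..n}"
  shows "act A n (basis n id) \<sigma> = basis n \<sigma>"
proof (rule Ass_eqI[of _ n])
  show "act A n (basis n id) \<sigma> \<in> carrier (comps A n)"
    by (rule pre_operad.act_closed[OF pre_operad_Ass basis_closed \<sigma>])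
  fix \<pi> assume \<pi>: "\<pi> permutes {1..n}"
  have "\<pi> \<circ> inv_into UNIV \<sigma> = id \<longleftrightarrow> \<pi> = \<sigma>"
    by (metis comp_id fun.map_id o_assoc permutes_inv_o(1,2)[OF \<sigma>])
  then show "act A n (basis n id) \<sigma> \<pi> = basis n \<sigma> \<pi>"
    using \<pi> permutes_compose[OF permutes_inv[OF \<sigma>] \<pi>] by (simp add: Ass_coeff)
qed simp

text \<open>
  A function on permutations is built up from zero by adding one value at a time. For a linear map this
  reduces every statement to the group elements.
\<close>

lemma Ass_basis_induct [consumes 1, case_names zero add]:
  assumes f: "f \<in> carrier (comps A n)"
    and zero: "Q \<zero>\<^bsub>comps A n\<^esub>"
    and add: "\<And>c \<sigma> g. \<lbrakk>c \<in> carrier R; \<sigma> permutes {1..n}; g \<in> carrier (comps A n); Q g\<rbrakk>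
        \<Longrightarrow> Q (c \<odot>\<^bsub>comps A n\<^esub> basis n \<sigma> \<oplus>\<^bsub>comps A n\<^esub> g)"
  shows "Q f"
proof -
  interpret M: module R "comps A n" by (rule Ass_module)
  have "Q f" if "finite B" "B \<subseteq> {\<pi>. \<pi> permutes {1..n}}" "f \<in> carrier (comps A n)"
      "\<And>\<pi>. \<pi> permutes {1..n} \<Longrightarrow> \<pi> \<notin> B \<Longrightarrow> f \<pi> = \<zero>" for B f
    using that
  proof (induction B arbitrary: f rule: finite_induct)
    case empty
    then have "f = \<zero>\<^bsub>comps A n\<^esub>" by (intro Ass_eqI[of _ n]) (auto simp: Ass_coeff)
    then show ?case using zero by simp
  next
    case (insert \<sigma> B)
    define g where "g = f(\<sigma> := \<zero>)"
    have \<sigma>: "\<sigma> permutes {1..n}" using insert by auto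
    have c: "f \<sigma> \<in> carrier R" using insert \<sigma> by (auto simp: Ass_carrier)
    have g: "g \<in> carrier (comps A n)" using insert \<sigma> by (auto simp: Ass_carrier g_def)
    have "Q g"
    proof (rule insert.IH)
      show "B \<subseteq> {\<pi>. \<pi> permutes {1..n}}" using insert by blast
      show "g \<pi> = \<zero>" if "\<pi> permutes {1..n}" "\<pi> \<notin> B" for \<pi>
        using insert that by (simp add: g_def)
    qed (rule g)
    moreover have "f = f \<sigma> \<odot>\<^bsub>comps A n\<^esub> basis n \<sigma> \<oplus>\<^bsub>comps A n\<^esub> g"
      using insert c g
      by (intro Ass_eqI[of _ n]) (auto simp: Ass_coeff g_def dest: Ass_carrier[THEN iffD1])
    ultimately show ?case using add[OF c \<sigma> g] by simp
  qed
  from this[of "{\<pi>. \<pi> permutes {1..n}}" f] f show ?thesis by (auto simp: finite_permutations)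
qed

text \<open>
  Write \<open>d \<mu> = a \<mu> + b \<mu>'\<close>, where \<open>\<mu>'\<close> is the opposite product. Differentiating
  \<open>\<mu> \<circ>\<^sub>1 \<mu> = \<mu> \<circ>\<^sub>2 \<mu>\<close> gives four terms with coefficient b, namely the products of three inputs in the
  orders 312, 213, 231 and 132. These are distinct, and so \<open>b = 0\<close>.

  The value of a derivation on \<open>\<mu>\<close> determines it on the standard products, because the product of
  \<open>n + 1\<close> inputs is \<open>\<mu>\<close> composed with that of n inputs; the symmetric group reaches all other basis
  elements from there. On the nullary product the value is fixed by \<open>\<mu> \<circ>\<^sub>1 1\<^sub>0 = 1\<close>.
\<close>

theorem Ass_derivations:
  shows "lie_iso R (der R A) (lie_base R)" and "lie_trivial (H1 R A)"
proof -
  interpret pre_operad R A by (rule pre_operad_Ass)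
  define \<mu> where "\<mu> = basis 2 id"
  have \<mu>: "\<mu> \<in> carrier (comps A 2)" by (simp add: \<mu>_def)
  have P1: "carrier (comps A 1) = (\<lambda>c. c \<odot>\<^bsub>comps A 1\<^esub> ident A) ` carrier R"
  proof (intro equalityI subsetI)
    fix f assume f: "f \<in> carrier (comps A 1)"
    then have "f id \<in> carrier R" by (auto simp: Ass_carrier permutes_id)
    moreover from this f have "f = f id \<odot>\<^bsub>comps A 1\<^esub> ident A"
      by (intro Ass_eqI[of _ 1]) (auto simp: Ass_ident Ass_coeff permutes_singleton_iff simp del: One_nat_def)
    ultimately show "f \<in> (\<lambda>c. c \<odot>\<^bsub>comps A 1\<^esub> ident A) ` carrier R" by blast
  qed (use ident_closed in auto)
  have \<mu>_nonzero: "\<mu> \<noteq> \<zero>\<^bsub>comps A 2\<^esub>"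
  proof
    assume "\<mu> = \<zero>\<^bsub>comps A 2\<^esub>"
    then have "\<mu> id = \<zero>" by (simp add: Ass_coeff permutes_id)
    then show False by (simp add: \<mu>_def Ass_coeff permutes_id)
  qed
  have \<mu>_comp: "pcomp A 2 n i \<mu> (basis n id) = basis (Suc n) id" if "i = 1 \<or> i = 2" for n i
    using Ass_pcomp_basis[of id 2 id n i] that perm_ins_id[of i 2 n]
    by (auto simp: \<mu>_def permutes_id simp del: One_nat_def)
  have eigen: "\<exists>a\<in>carrier R. d 2 \<mu> = a \<odot>\<^bsub>comps A 2\<^esub> \<mu>" if d: "derivation R A d" for d
  proof -
    define f where "f = d 2 \<mu>"
    have f: "f \<in> carrier (comps A 2)" unfolding f_def by (rule derivation_closed[OF d \<mu>])
    have sw: "swap12 permutes {1..2}" and idp: "id permutes {1..2::nat}"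
      by (simp_all only: permutes_1_2 simp_thms)
    have fc: "f id \<in> carrier R" "f swap12 \<in> carrier R"
      using f sw idp by (auto simp: Ass_carrier simp del: One_nat_def)
    \<comment> \<open>The order 312, which among the four terms only \<open>f \<circ>\<^sub>1 \<mu>\<close> produces.\<close>
    define \<pi> where "\<pi> = perm_ins 2 2 1 swap12 id"
    have \<pi>: "\<pi> permutes {1..2 + 2 - 1}"
      unfolding \<pi>_def by (rule perm_ins_permutes[OF sw idp]) simp_all
    have \<pi>_values: "\<pi> 1 = 2" "\<pi> 3 = 1"
      by (simp_all add: \<pi>_def perm_ins_def Let_def)
    have "perm_ins 2 2 1 id \<tau> 3 = 3" "perm_ins 2 2 1 swap12 swap12 1 = 3"
      "perm_ins 2 2 2 id \<tau> 1 = 1" "perm_ins 2 2 2 swap12 \<tau> 1 = 3" for \<tau>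
      by (simp_all add: perm_ins_def Let_def)
    then have ne: "perm_ins 2 2 1 id \<tau> \<noteq> \<pi>" "perm_ins 2 2 1 swap12 swap12 \<noteq> \<pi>"
      "perm_ins 2 2 2 id \<tau> \<noteq> \<pi>" "perm_ins 2 2 2 swap12 \<tau> \<noteq> \<pi>" for \<tau>
      using \<pi>_values by (metis numeral_eq_iff one_eq_numeral_iff num.distinct semiring_norm(85-90))+
    have fib: "fibre 2 2 1 \<pi> = {(swap12, id)}" "fibre 2 2 2 \<pi> = {}"
      using ne by (auto simp: fibre_def permutes_1_2 \<pi>_def[symmetric] simp del: One_nat_def)
    have "swap12 \<noteq> id" by (metis id_apply transpose_apply_first n_not_Suc_n numeral_2_eq_2 One_nat_def)
    then have coeffs: "pcomp A 2 2 1 f \<mu> \<pi> = f swap12" "pcomp A 2 2 1 \<mu> f \<pi> = \<zero>"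
      "pcomp A 2 2 2 f \<mu> \<pi> = \<zero>" "pcomp A 2 2 2 \<mu> f \<pi> = \<zero>"
      using fc sw idp unfolding Ass_pcomp[OF \<pi>] fib by (simp_all add: \<mu>_def Ass_coeff del: One_nat_def)
    have "pcomp A 2 2 1 f \<mu> \<oplus>\<^bsub>comps A 3\<^esub> pcomp A 2 2 1 \<mu> f
        = pcomp A 2 2 2 f \<mu> \<oplus>\<^bsub>comps A 3\<^esub> pcomp A 2 2 2 \<mu> f"
      using derivation_pcomp[OF d \<mu> \<mu>, of 1] derivation_pcomp[OF d \<mu> \<mu>, of 2]
        \<mu>_comp[of 1 2] \<mu>_comp[of 2 2] by (simp add: f_def \<mu>_def[symmetric])
    then have "f swap12 = \<zero>"
      using \<pi> coeffs fc by (auto dest!: fun_cong[of _ _ \<pi>] simp: Ass_coeff)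
    then have "f = f id \<odot>\<^bsub>comps A 2\<^esub> \<mu>"
      using fc by (intro Ass_eqI[OF f] M.smult_closed \<mu>)
        (auto simp: permutes_1_2 Ass_coeff \<mu>_def sw idp \<open>swap12 \<noteq> id\<close> simp del: One_nat_def)
    then show ?thesis using fc unfolding f_def by blast
  qed
  have unique: "d = d'"
    if d: "derivation R A d" and d': "derivation R A d'" and eq: "d 2 \<mu> = d' 2 \<mu>" for d d'
  proof -
    have step: "e (Suc n) (basis (Suc n) id) = pcomp A 2 n 1 (e 2 \<mu>) (basis n id)
        \<oplus>\<^bsub>comps A (Suc n)\<^esub> pcomp A 2 n 1 \<mu> (e n (basis n id))" if "derivation R A e" for e n
      using derivation_pcomp[OF that \<mu> basis_closed, of 1 n id] \<mu>_comp[of 1 n] by simp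
    have unit: "d 0 (basis 0 id) = d' 0 (basis 0 id)"
    proof -
      let ?u = "basis 0 id"
      have zero: "pcomp A 2 0 1 (e 2 \<mu>) ?u \<oplus>\<^bsub>comps A 1\<^esub> pcomp A 2 0 1 \<mu> (e 0 ?u) = \<zero>\<^bsub>comps A 1\<^esub>"
        if "derivation R A e" for e
        using step[OF that, of 0] derivation_ident[OF that] by (simp add: Ass_ident)
      have coeff: "pcomp A 2 0 1 \<mu> x id = x id" if x: "x \<in> carrier (comps A 0)" for x
      proof -
        have c: "x id \<in> carrier R" using x by (auto simp: Ass_carrier)
        have "x = x id \<odot>\<^bsub>comps A 0\<^esub> ?u"
          using c by (intro Ass_eqI[OF x] M.smult_closed) (auto simp: Ass_coeff)
        then have "pcomp A 2 0 1 \<mu> x = x id \<odot>\<^bsub>comps A 1\<^esub> basis 1 id"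
          using pcomp_smult_right[OF c \<mu> basis_closed, of 1 0 id] \<mu>_comp[of 1 0] by simp
        then show ?thesis using c by (simp add: Ass_coeff permutes_id)
      qed
      have cl: "e 0 ?u \<in> carrier (comps A 0)" "e 2 \<mu> \<in> carrier (comps A 2)" if "derivation R A e" for e
        using derivation_closed[OF that] \<mu> by simp_all
      have "pcomp A 2 0 1 \<mu> (d 0 ?u) = pcomp A 2 0 1 \<mu> (d' 0 ?u)"
        using zero[OF d] zero[OF d'] eq cl[OF d] cl[OF d'] \<mu>
          pcomp_closed[of "d 2 \<mu>" 2 ?u 0 1] pcomp_closed[of \<mu> 2 "d 0 ?u" 0 1] pcomp_closed[of \<mu> 2 "d' 0 ?u" 0 1]
        by (metis (no_types, lifting) M.M.add.Units_l_cancel M.M.add.Units_eq add_0_right basis_closed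
            diff_add_inverse2 numeral_2_eq_2 one_le_numeral order_refl plus_1_eq_Suc add.commute)
      then have "d 0 ?u id = d' 0 ?u id" using coeff[OF cl(1)[OF d]] coeff[OF cl(1)[OF d']] by simp
      then show ?thesis by (intro Ass_eqI[OF cl(1)[OF d] cl(1)[OF d']]) simp
    qed
    have one: "d n (basis n id) = d' n (basis n id)" for n
    proof (induction n)
      case (Suc n)
      then show ?case by (simp only: step[OF d] step[OF d'] eq)
    qed (rule unit)
    show ?thesis
    proof (rule derivation_eqI[OF d d'])
      fix n x assume "x \<in> carrier (comps A n)"
      then show "d n x = d' n x"
      proof (induction rule: Ass_basis_induct)
        case zero
        have "e n \<zero>\<^bsub>comps A n\<^esub> = \<zero>\<^bsub>comps A n\<^esub>" if "derivation R A e" for e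
          using derivation_smult[OF that, of \<zero> "\<zero>\<^bsub>comps A n\<^esub>" n]
            derivation_closed[OF that, of "\<zero>\<^bsub>comps A n\<^esub>" n] by simp
        then show ?case using d d' by simp
      next
        case (add c \<sigma> g)
        have "d n (basis n \<sigma>) = d' n (basis n \<sigma>)"
          using derivation_act[OF d basis_closed add(2), of id] derivation_act[OF d' basis_closed add(2), of id]
            one[of n] Ass_act_basis[OF add(2)] by simp
        then show ?case
          using add by (simp add: derivation_add[OF d] derivation_add[OF d'] derivation_smult[OF d] derivation_smult[OF d'])
      qed
    qed
  qed
  show "lie_iso R (der R A) (lie_base R)"
    by (rule derivations_one_dimensional(1)[OF P1 \<mu> \<mu>_nonzero], erule eigen, rule unique)
  show "lie_trivial (H1 R A)"
    by (rule derivations_one_dimensional(2)[OF P1 \<mu> \<mu>_nonzero], erule eigen, rule unique)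
qed

end


section \<open>Operads generated without nullary operations\<close>

context operad
begin

inductive generated for G where
  base: "\<lbrakk>x \<in> G n; x \<in> carrier (comps P n)\<rbrakk> \<Longrightarrow> generated G n x"
| ident: "generated G 1 (ident P)"
| zero: "generated G n \<zero>\<^bsub>comps P n\<^esub>"
| add: "\<lbrakk>generated G n x; generated G n y\<rbrakk> \<Longrightarrow> generated G n (x \<oplus>\<^bsub>comps P n\<^esub> y)"
| smult: "\<lbrakk>c \<in> carrier K; generated G n x\<rbrakk> \<Longrightarrow> generated G n (c \<odot>\<^bsub>comps P n\<^esub> x)"
| act: "\<lbrakk>generated G n x; \<sigma> permutes {1..n}\<rbrakk> \<Longrightarrow> generated G n (act P n x \<sigma>)"
| pcomp: "\<lbrakk>generated G m x; generated G n y; 1 \<le> i; i \<le> m\<rbrakk>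
    \<Longrightarrow> generated G (m + n - 1) (pcomp P m n i x y)"

lemma generated_closed: "generated G n x \<Longrightarrow> x \<in> carrier (comps P n)"
  by (induction rule: generated.induct) (auto intro: ident_closed act_closed pcomp_closed simp del: One_nat_def)

lemma pcomp_zero_left:
  assumes "y \<in> carrier (comps P n)" "1 \<le> i" "i \<le> m"
  shows "pcomp P m n i \<zero>\<^bsub>comps P m\<^esub> y = \<zero>\<^bsub>comps P (m + n - 1)\<^esub>"
  using pcomp_smult_left[of \<zero> "\<zero>\<^bsub>comps P m\<^esub>" m y n i] assms pcomp_closed[of "\<zero>\<^bsub>comps P m\<^esub>" m y n i] by simp

lemma pcomp_zero_right:
  assumes "x \<in> carrier (comps P m)" "1 \<le> i" "i \<le> m"
  shows "pcomp P m n i x \<zero>\<^bsub>comps P n\<^esub> = \<zero>\<^bsub>comps P (m + n - 1)\<^esub>"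
  using pcomp_smult_right[of \<zero> x m "\<zero>\<^bsub>comps P n\<^esub>" n i] assms pcomp_closed[of x m "\<zero>\<^bsub>comps P n\<^esub>" n i] by simp

lemma pcomp_scalar_left:
  assumes "c \<in> carrier K" "y \<in> carrier (comps P n)"
  shows "pcomp P 1 n 1 (c \<odot>\<^bsub>comps P 1\<^esub> ident P) y = c \<odot>\<^bsub>comps P n\<^esub> y"
  using pcomp_smult_left[OF assms(1) ident_closed assms(2), of 1] ident_left[OF assms(2)] by simp

lemma pcomp_scalar_right:
  assumes "c \<in> carrier K" "x \<in> carrier (comps P m)" "1 \<le> i" "i \<le> m"
  shows "pcomp P m 1 i x (c \<odot>\<^bsub>comps P 1\<^esub> ident P) = c \<odot>\<^bsub>comps P m\<^esub> x"
  using pcomp_smult_right[OF assms(1,2) ident_closed assms(3,4)] ident_right[OF assms(2-4)] by simp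

lemma arity_cases:
  fixes k :: nat
  obtains "k = 0" | "k = 1" | "k = 2" | "2 < k"
  by linarith

text \<open>
  If the generators have arity at least two, then zero is the only nullary operation that arises, so
  no composition lowers the arity of its factors. An operation of arity at most two is therefore
  obtained without passing through higher arities.
\<close>

lemma generated_low_arity:
  assumes G: "G 0 = {}" "G 1 = {}" "G 2 \<subseteq> S"
    and S: "\<zero>\<^bsub>comps P 2\<^esub> \<in> S" "\<And>x y. \<lbrakk>x \<in> S; y \<in> S\<rbrakk> \<Longrightarrow> x \<oplus>\<^bsub>comps P 2\<^esub> y \<in> S"
      "\<And>c x. \<lbrakk>c \<in> carrier K; x \<in> S\<rbrakk> \<Longrightarrow> c \<odot>\<^bsub>comps P 2\<^esub> x \<in> S" "\<And>x. x \<in> S \<Longrightarrow> act P 2 x swap12 \<in> S"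
    and x: "generated G n x"
  shows "(n = 0 \<longrightarrow> x = \<zero>\<^bsub>comps P 0\<^esub>)
    \<and> (n = 1 \<longrightarrow> x \<in> (\<lambda>c. c \<odot>\<^bsub>comps P 1\<^esub> ident P) ` carrier K)
    \<and> (n = 2 \<longrightarrow> x \<in> S)"
  using x
proof (induction rule: generated.induct)
  case (base x n)
  then show ?case using G by auto
next
  case ident
  then show ?case using ident_closed by (auto intro!: image_eqI[where x = \<one>] simp del: One_nat_def)
next
  case (zero n)
  then show ?case using S ident_closed by (auto intro!: image_eqI[where x = \<zero>] simp del: One_nat_def)
next
  case (add n x y)
  then show ?case
    using S ident_closed
    by (rule_tac arity_cases[of n]) (auto simp: M.smult_l_distr[symmetric] simp del: One_nat_def)
next
  case (smult c n x)
  then show ?case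
    using S ident_closed
    by (rule_tac arity_cases[of n]) (auto simp: M.smult_assoc1[symmetric] simp del: One_nat_def)
next
  case (act n x \<sigma>)
  note x = generated_closed[OF act.hyps(1)]
  have "n = 0 \<or> n = 1 \<Longrightarrow> \<sigma> = id" using act.hyps by (auto simp: permutes_singleton_iff)
  moreover have "n = 2 \<Longrightarrow> \<sigma> = id \<or> \<sigma> = swap12" using act.hyps permutes_1_2 by simp
  ultimately show ?case using act.IH S x act_id by (auto simp del: One_nat_def)
next
  case (pcomp m x n y i)
  note x = generated_closed[OF pcomp.hyps(1)] and y = generated_closed[OF pcomp.hyps(2)]
  consider "n = 0" | "n = 1" "m = 1" | "n = 1" "m = 2" | "n = 2" "m = 1" | "n \<noteq> 0" "m + n - 1 > 2"
    using pcomp.hyps by linarith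
  then show ?case
  proof cases
    case 1
    then have "pcomp P m n i x y = \<zero>\<^bsub>comps P (m + n - 1)\<^esub>"
      using pcomp.IH x pcomp.hyps by (simp add: pcomp_zero_right)
    moreover have "\<zero>\<^bsub>comps P 1\<^esub> = \<zero> \<odot>\<^bsub>comps P 1\<^esub> ident P" using ident_closed by simp
    ultimately show ?thesis using S by (auto intro!: image_eqI[where x = \<zero>] simp del: One_nat_def)
  next
    case 2
    then obtain c where c: "c \<in> carrier K" "x = c \<odot>\<^bsub>comps P 1\<^esub> ident P" using pcomp.IH by auto
    moreover have "i = 1" using pcomp.hyps 2 by simp
    ultimately show ?thesis
      using pcomp.IH 2 y pcomp_scalar_left[of c y 1] ident_closed
      by (auto simp: M.smult_assoc1[symmetric] simp del: One_nat_def)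
  next
    case 3
    then obtain c where c: "c \<in> carrier K" "y = c \<odot>\<^bsub>comps P 1\<^esub> ident P" using pcomp.IH by auto
    then show ?thesis
      using pcomp.IH pcomp.hyps 3 x S pcomp_scalar_right[of c x 2 i] by simp
  next
    case 4
    then obtain c where c: "c \<in> carrier K" "x = c \<odot>\<^bsub>comps P 1\<^esub> ident P" using pcomp.IH by auto
    moreover have "i = 1" using pcomp.hyps 4 by simp
    ultimately show ?thesis using pcomp.IH 4 y S pcomp_scalar_left[of c y 2] by simp
  next
    case 5 then show ?thesis by auto
  qed
qed

text \<open>
  By the two associativity laws, plugging e into an input of a composite amounts to plugging it into
  the factor to which that input belongs. Descending in this way one reaches a generator, unless the
  factor has arity one; but then it is a multiple of the identity and can be dropped before.
\<close>

lemma generated_plug_unit: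
  assumes e: "e \<in> carrier (comps P 0)" and G: "G 0 = {}" "G 1 = {}"
    and plug: "\<And>n x i. \<lbrakk>x \<in> G n; 1 \<le> i; i \<le> n\<rbrakk> \<Longrightarrow> generated G (n - 1) (pcomp P n 0 i x e)"
    and x: "generated G n x" "2 \<le> n" "1 \<le> i" "i \<le> n"
  shows "generated G (n - 1) (pcomp P n 0 i x e)"
  using x
proof (induction arbitrary: i rule: generated.induct)
  case (base x n)
  then show ?case by (intro plug)
next
  case ident
  then show ?case by simp
next
  case (zero n)
  then show ?case using pcomp_zero_left[OF e, of i n] by (simp add: generated.zero)
next
  case (add n x y)
  then show ?case
    using pcomp_add_left[OF add.hyps(1,2)[THEN generated_closed] e, of i] generated.add[of G "n - 1"] by simp
next
  case (smult c n x)
  then show ?case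
    using pcomp_smult_left[OF smult.hyps(1) generated_closed[OF smult.hyps(2)] e, of i] generated.smult[of c G "n - 1"] by simp
next
  case (act n x \<sigma>)
  note x = generated_closed[OF act.hyps(1)]
  have \<sigma>i: "1 \<le> \<sigma> i" "\<sigma> i \<le> n" using permutes_in_image[OF act.hyps(2), of i] act.prems by auto
  have "pcomp P n 0 i (act P n x \<sigma>) (act P 0 e id)
      = act P (n + 0 - 1) (pcomp P n 0 (\<sigma> i) x e) (perm_ins n 0 i \<sigma> id)"
    using act.prems act.hyps x e by (intro equivariant) (auto simp: permutes_id)
  moreover have "perm_ins n 0 i \<sigma> id permutes {1..n + 0 - 1}"
    using act.prems act.hyps by (intro perm_ins_permutes) (auto simp: permutes_id)
  ultimately show ?case
    using act.IH[OF act.prems(1) \<sigma>i] act_id[OF e] generated.act[of G "n - 1"] by simp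
next
  case (pcomp m x n y j)
  note x = generated_closed[OF pcomp.hyps(1)] and y = generated_closed[OF pcomp.hyps(2)]
  note j = pcomp.hyps(3,4)
  have low: "(k = 0 \<longrightarrow> z = \<zero>\<^bsub>comps P 0\<^esub>)
      \<and> (k = 1 \<longrightarrow> z \<in> (\<lambda>c. c \<odot>\<^bsub>comps P 1\<^esub> ident P) ` carrier K)" if "generated G k z" for k z
  proof -
    have "G 2 \<subseteq> UNIV" by simp
    from generated_low_arity[OF G this _ _ _ _ that] show ?thesis by blast
  qed
  consider "n = 0" | "n = 1" "j = i" | "n \<ge> 2" "j \<le> i" "i < j + n" | "n \<ge> 1" "i < j" | "n \<ge> 1" "j + n \<le> i"
    by linarith
  then show ?case
  proof cases
    case 1
    then have "y = \<zero>\<^bsub>comps P 0\<^esub>" using low[OF pcomp.hyps(2)] by simp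
    then have "pcomp P m n j x y = \<zero>\<^bsub>comps P (m + n - 1)\<^esub>"
      using 1 pcomp_zero_right[OF x j, of n] by simp
    then show ?thesis
      using pcomp_zero_left[OF e, of i "m + n - 1"] pcomp.prems generated.zero[of G "m + n - 1 - 1"] by simp
  next
    case 2
    then obtain c where c: "c \<in> carrier K" "y = c \<odot>\<^bsub>comps P 1\<^esub> ident P" using low[OF pcomp.hyps(2)] by auto
    have "pcomp P m n j x y = c \<odot>\<^bsub>comps P m\<^esub> x" using c 2 pcomp_scalar_right[OF c(1) x j] by simp
    then show ?thesis
      using 2 pcomp.prems pcomp.IH(1)[of i] c pcomp_smult_left[OF c(1) x e, of i]
        generated.smult[of c G "m - 1"] by simp
  next
    case 3
    define i' where "i' = i + 1 - j"
    have i': "1 \<le> i'" "i' \<le> n" "i = j + i' - 1" using 3 by (auto simp: i'_def)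
    have "pcomp P (m + n - 1) 0 i (pcomp P m n j x y) e = pcomp P m (n + 0 - 1) j x (pcomp P n 0 i' y e)"
      unfolding i'(3) by (rule assoc_sequential[OF x y e j i'(1,2)])
    moreover have "generated G (m + (n - 1) - 1) (pcomp P m (n - 1) j x (pcomp P n 0 i' y e))"
      using pcomp.IH(2)[of i'] i' 3 pcomp.hyps by (intro generated.pcomp) auto
    moreover have "m + (n - 1) - 1 = m + n - 1 - 1" using 3 by simp
    ultimately show ?thesis by simp
  next
    case 4
    have "pcomp P (m + n - 1) 0 i (pcomp P m n j x y) e
        = pcomp P (m + 0 - 1) n (j + 0 - 1) (pcomp P m 0 i x e) y"
      using assoc_parallel[OF x e y pcomp.prems(2) 4(2) j(2)] by simp
    moreover have "generated G (m - 1 + n - 1) (pcomp P (m - 1) n (j - 1) (pcomp P m 0 i x e) y)"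
      using pcomp.IH(1)[of i] 4 pcomp.hyps pcomp.prems by (intro generated.pcomp) auto
    moreover have "m - 1 + n - 1 = m + n - 1 - 1" using j by simp
    ultimately show ?thesis by simp
  next
    case 5
    define k where "k = i + 1 - n"
    have k: "j < k" "k \<le> m" "i = k + n - 1" using 5 pcomp.prems j by (auto simp: k_def)
    have "pcomp P (m + n - 1) 0 i (pcomp P m n j x y) e
        = pcomp P (m + 0 - 1) n j (pcomp P m 0 k x e) y"
      unfolding k(3) by (rule assoc_parallel[OF x y e j(1) k(1,2)])
    moreover have "generated G (m - 1 + n - 1) (pcomp P (m - 1) n j (pcomp P m 0 k x e) y)"
      using pcomp.IH(1)[of k] k 5 pcomp.hyps by (intro generated.pcomp) auto
    moreover have "m - 1 + n - 1 = m + n - 1 - 1" using j by simp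
    ultimately show ?thesis by simp
  qed
qed

text \<open>
  So a unit e can be eliminated from every operation of positive arity, although composing with e
  lowers arities. This is what makes the low arities of an operad with unit computable.
\<close>

lemma generated_unital:
  assumes e: "e \<in> carrier (comps P 0)" and G: "G 0 = {}" "G 1 = {}"
    and plug: "\<And>n x i. \<lbrakk>x \<in> G n; 1 \<le> i; i \<le> n\<rbrakk> \<Longrightarrow> generated G (n - 1) (pcomp P n 0 i x e)"
    and x: "generated (G(0 := {e})) n x"
  shows "if n = 0 then x \<in> (\<lambda>c. c \<odot>\<^bsub>comps P 0\<^esub> e) ` carrier K else generated G n x"
  using x
proof (induction rule: generated.induct)
  case (base x n)
  then show ?case using e by (auto intro: generated.base intro!: image_eqI[where x = \<one>])
next
  case ident
  then show ?case using generated.ident by simp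
next
  case (zero n)
  then show ?case using e by (auto intro: generated.zero intro!: image_eqI[where x = \<zero>])
next
  case (add n x y)
  then show ?case using e by (auto intro: generated.add simp: M.smult_l_distr[symmetric])
next
  case (smult c n x)
  then show ?case using e by (auto intro: generated.smult simp: M.smult_assoc1[symmetric])
next
  case (act n x \<sigma>)
  then show ?case using e act_id by (auto intro: generated.act generated_closed)
next
  case (pcomp m x n y i)
  have x: "generated G m x" using pcomp by (auto split: if_splits)
  note xc = generated_closed[OF x]
  show ?case
  proof (cases "n = 0")
    case False
    then show ?thesis using generated.pcomp[OF x, where n = n and y = y and i = i] pcomp by auto
  next
    case n: True
    then obtain c where c: "c \<in> carrier K" "y = c \<odot>\<^bsub>comps P 0\<^esub> e" using pcomp.IH by auto
    then have xy: "pcomp P m n i x y = c \<odot>\<^bsub>comps P (m - 1)\<^esub> pcomp P m 0 i x e"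
      using n pcomp_smult_right[OF c(1) xc e pcomp.hyps(3,4)] by simp
    show ?thesis
    proof (cases "m = 1")
      case False
      then have "generated G (m - 1) (pcomp P m 0 i x e)"
        using pcomp.hyps by (intro generated_plug_unit[OF e G plug x]) auto
      then show ?thesis using xy n c False pcomp.hyps by (auto intro: generated.smult)
    next
      case m: True
      have "G 2 \<subseteq> UNIV" by simp
      from generated_low_arity[OF G this _ _ _ _ x] obtain b
        where b: "b \<in> carrier K" "x = b \<odot>\<^bsub>comps P 1\<^esub> ident P" using m by auto
      have "i = 1" using pcomp.hyps m by simp
      then have "pcomp P m 0 i x e = b \<odot>\<^bsub>comps P 0\<^esub> e" using pcomp_scalar_left[OF b(1) e] b m by simp
      then show ?thesis using xy m n b c e by (auto simp: M.smult_assoc1[symmetric])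
    qed
  qed
qed

end


section \<open>Presented operads\<close>

context presentation
begin

sublocale O: operad K "presented K ar R" by (rule operad_P)

lemma expr_closed:
  shows Plus_closed: "\<lbrakk>h s n; h t n\<rbrakk> \<Longrightarrow> h (Plus s t) n"
    and Smult_closed: "\<lbrakk>c \<in> carrier K; h t n\<rbrakk> \<Longrightarrow> h (Smult c t) n"
    and Act_closed: "\<lbrakk>h t n; \<sigma> permutes {1..n}\<rbrakk> \<Longrightarrow> h (Act t \<sigma>) n"
    and Comp_closed: "\<lbrakk>h s m; h t n; 1 \<le> i; i \<le> m\<rbrakk> \<Longrightarrow> h (Comp i s t) (m + n - 1)"
  by (rule has_arity.intros; assumption)+

lemma cl_P:
  shows cl_Plus: "\<lbrakk>h s n; h t n\<rbrakk> \<Longrightarrow> cl n (Plus s t) = cl n s \<oplus>\<^bsub>comps P n\<^esub> cl n t"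
    and cl_Smult: "\<lbrakk>c \<in> carrier K; h t n\<rbrakk> \<Longrightarrow> cl n (Smult c t) = c \<odot>\<^bsub>comps P n\<^esub> cl n t"
    and cl_Act: "\<lbrakk>h t n; \<sigma> permutes {1..n}\<rbrakk> \<Longrightarrow> cl n (Act t \<sigma>) = act P n (cl n t) \<sigma>"
    and cl_Comp: "\<lbrakk>h s m; h t n; 1 \<le> i; i \<le> m; N = m + n - 1\<rbrakk>
      \<Longrightarrow> cl N (Comp i s t) = pcomp P m n i (cl m s) (cl n t)"
  by (simp_all add: add_P smult_P act_P comp_P del: One_nat_def)

lemma relation_pcomp:
  assumes "(Comp i s t, u) \<in> R" "h s m" "h t n" "1 \<le> i" "i \<le> m" "h u N" "N = m + n - 1"
  shows "pcomp P m n i (cl m s) (cl n t) = cl N u"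
  using assms cl_eq[OF op_eq.rel[OF assms(1)], of N] by (simp add: comp_P Comp_closed del: One_nat_def)

lemma relation_act:
  assumes "(Act t \<sigma>, u) \<in> R" "h t n" "\<sigma> permutes {1..n}" "h u n"
  shows "act P n (cl n t) \<sigma> = cl n u"
  using assms cl_eq[OF op_eq.rel[OF assms(1)], of n] by (simp add: act_P Act_closed del: One_nat_def)

lemma presented_derivation_eqI:
  assumes d: "derivation K P d" and d': "derivation K P d'"
    and eq: "\<And>g. d (ar g) (cl (ar g) (Gen g)) = d' (ar g) (cl (ar g) (Gen g))"
  shows "d = d'"
proof (rule derivation_eqI[OF d d'])
  have zero: "e n (cl n (Zero n)) = cl n (Zero n)" if "derivation K P e" for e n
  proof -
    have "e n \<zero>\<^bsub>comps P n\<^esub> = \<zero>\<^bsub>comps P n\<^esub>"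
      using derivation_smult[OF that, of \<zero> "\<zero>\<^bsub>comps P n\<^esub>" n]
        derivation_closed[OF that, of "\<zero>\<^bsub>comps P n\<^esub>" n] by simp
    then show ?thesis by (simp only: zero_P)
  qed
  have "d n (cl n t) = d' n (cl n t)" if "h t n" for n t
    using that
  proof (induction rule: has_arity.induct)
    case (1 g) then show ?case by (rule eq)
  next
    case 2 then show ?case using O.derivation_ident[OF d] O.derivation_ident[OF d'] by (simp only: ident_P)
  next
    case (3 n) then show ?case by (simp only: zero[OF d] zero[OF d'])
  next
    case (4 s n t)
    then show ?case
      using derivation_add[OF d cl_car cl_car, of s n t] derivation_add[OF d' cl_car cl_car, of s n t]
      by (simp add: add_P)
  next
    case (5 c t n)
    then show ?case
      using derivation_smult[OF d _ cl_car, of c t n] derivation_smult[OF d' _ cl_car, of c t n]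
      by (simp add: smult_P)
  next
    case (6 t n \<sigma>)
    then show ?case
      using derivation_act[OF d cl_car, of t n \<sigma>] derivation_act[OF d' cl_car, of t n \<sigma>]
      by (simp add: act_P)
  next
    case (7 s m t n i)
    then show ?case
      using derivation_pcomp[OF d cl_car cl_car, of s m t n i] derivation_pcomp[OF d' cl_car cl_car, of s m t n i]
      by (simp add: comp_P del: One_nat_def)
  qed
  then show "d n x = d' n x" if "x \<in> carrier (comps P n)" for n x
    using that by (auto simp: car)
qed

lemma presented_generated: "h t n \<Longrightarrow> O.generated (\<lambda>n. {cl n (Gen g) | g. ar g = n}) n (cl n t)"
proof (induction rule: has_arity.induct)
  case (1 g) then show ?case by (intro O.generated.base cl_car has_arity.intros) blast
next
  case 2 then show ?case using O.generated.ident by (simp only: ident_P)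
next
  case (3 n) then show ?case using O.generated.zero by (simp only: zero_P[symmetric])
next
  case (4 s n t) then show ?case using O.generated.add by (simp only: add_P[symmetric])
next
  case (5 c t n) then show ?case using O.generated.smult by (simp only: smult_P[symmetric])
next
  case (6 t n \<sigma>) then show ?case using O.generated.act by (simp only: act_P[symmetric])
next
  case (7 s m t n i) then show ?case using O.generated.pcomp by (simp only: comp_P[symmetric])
qed

end


section \<open>Euler derivations\<close>

text \<open>
  The derivation of the free operad that multiplies the generator g by the scalar \<open>w g\<close>, on
  representatives: the Leibniz rule is its clause for compositions.
\<close>

primrec euler :: "('g \<Rightarrow> 'k) \<Rightarrow> ('k, 'g) expr \<Rightarrow> ('k, 'g) expr" where
  "euler w (Gen g) = Smult (w g) (Gen g)"
| "euler w Ident = Zero 1"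
| "euler w (Zero n) = Zero n"
| "euler w (Plus s t) = Plus (euler w s) (euler w t)"
| "euler w (Smult c t) = Smult c (euler w t)"
| "euler w (Act t \<sigma>) = Act (euler w t) \<sigma>"
| "euler w (Comp i s t) = Plus (Comp i (euler w s) t) (Comp i s (euler w t))"

inductive homogeneous :: "('k, 'r) ring_scheme \<Rightarrow> ('g \<Rightarrow> 'k) \<Rightarrow> ('k, 'g) expr \<Rightarrow> 'k \<Rightarrow> bool" for K w where
  "homogeneous K w (Gen g) (w g)"
| "homogeneous K w Ident \<zero>\<^bsub>K\<^esub>"
| "k \<in> carrier K \<Longrightarrow> homogeneous K w (Zero n) k"
| "\<lbrakk>homogeneous K w s k; homogeneous K w t k\<rbrakk> \<Longrightarrow> homogeneous K w (Plus s t) k"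
| "homogeneous K w t k \<Longrightarrow> homogeneous K w (Smult c t) k"
| "homogeneous K w t k \<Longrightarrow> homogeneous K w (Act t \<sigma>) k"
| "\<lbrakk>homogeneous K w s k; homogeneous K w t l\<rbrakk> \<Longrightarrow> homogeneous K w (Comp i s t) (k \<oplus>\<^bsub>K\<^esub> l)"

locale weighted_presentation = presentation +
  fixes w :: "'c \<Rightarrow> 'a"
  assumes w_closed: "w g \<in> carrier K"
    and homogeneous_rels: "\<And>s t. (s, t) \<in> R \<Longrightarrow> \<exists>k. homogeneous K w s k \<and> homogeneous K w t k"
begin

lemma homogeneous_closed: "homogeneous K w t k \<Longrightarrow> k \<in> carrier K"
  by (induction rule: homogeneous.induct) (auto intro: w_closed)

lemma euler_arity: "h t n \<Longrightarrow> h (euler w t) n"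
  by (induction rule: has_arity.induct)
    (auto intro: has_arity.intros w_closed simp del: One_nat_def)

lemma euler_P:
  shows euler_Ident: "cl 1 (euler w Ident) = \<zero>\<^bsub>comps P 1\<^esub>"
    and euler_Zero: "cl n (euler w (Zero n)) = \<zero>\<^bsub>comps P n\<^esub>"
    and euler_Plus: "\<lbrakk>h s n; h t n\<rbrakk>
      \<Longrightarrow> cl n (euler w (Plus s t)) = cl n (euler w s) \<oplus>\<^bsub>comps P n\<^esub> cl n (euler w t)"
    and euler_Smult: "\<lbrakk>c \<in> carrier K; h t n\<rbrakk>
      \<Longrightarrow> cl n (euler w (Smult c t)) = c \<odot>\<^bsub>comps P n\<^esub> cl n (euler w t)"
    and euler_Act: "\<lbrakk>h t n; \<sigma> permutes {1..n}\<rbrakk>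
      \<Longrightarrow> cl n (euler w (Act t \<sigma>)) = act P n (cl n (euler w t)) \<sigma>"
    and euler_Comp: "\<lbrakk>h s m; h t n; 1 \<le> i; i \<le> m; N = m + n - 1\<rbrakk>
      \<Longrightarrow> cl N (euler w (Comp i s t))
        = pcomp P m n i (cl m (euler w s)) (cl n t) \<oplus>\<^bsub>comps P N\<^esub> pcomp P m n i (cl m s) (cl n (euler w t))"
proof -
  show "cl N (euler w (Comp i s t))
        = pcomp P m n i (cl m (euler w s)) (cl n t) \<oplus>\<^bsub>comps P N\<^esub> pcomp P m n i (cl m s) (cl n (euler w t))"
    if "h s m" "h t n" "1 \<le> i" "i \<le> m" "N = m + n - 1"
    using that euler_arity[OF that(1)] euler_arity[OF that(2)]
    by (simp add: comp_P add_P Comp_closed del: One_nat_def)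
qed (simp_all add: zero_P add_P smult_P act_P euler_arity)

lemma euler_homogeneous:
  assumes "homogeneous K w t k" and "h t n"
  shows "cl n (euler w t) = k \<odot>\<^bsub>comps P n\<^esub> cl n t"
  using assms
proof (induction arbitrary: n rule: homogeneous.induct)
  case (1 g)
  then show ?case by (simp add: smult_P w_closed)
next
  case 2
  then have n: "n = 1" by (cases rule: has_arity.cases) auto
  have "\<zero> \<odot>\<^bsub>comps P 1\<^esub> cl 1 Ident = \<zero>\<^bsub>comps P 1\<^esub>"
    by (rule O.M.smult_l_null) (intro cl_car has_arity.intros)
  then show ?case unfolding n by (simp only: euler_Ident)
next
  case (3 k m)
  from 3(2) have n: "n = m" by (cases rule: has_arity.cases) auto
  show ?case unfolding n zero_P[symmetric] euler_Zero using 3 by simp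
next
  case (4 s k t)
  then have st: "h s n" "h t n" by (auto elim: has_arity.cases)
  show ?case
    using 4 st homogeneous_closed[OF 4(1)]
    by (simp only: euler_Plus cl_Plus O.M.smult_r_distr cl_car)
next
  case (5 t k c)
  then have t: "h t n" "c \<in> carrier K" by (auto elim: has_arity.cases)
  have "c \<otimes> k = k \<otimes> c" using t homogeneous_closed[OF 5(1)] by (rule_tac m_comm)
  then show ?case
    using 5 t homogeneous_closed[OF 5(1)]
    by (simp only: euler_Smult cl_Smult O.M.smult_assoc1[symmetric] cl_car)
next
  case (6 t k \<sigma>)
  then have t: "h t n" "\<sigma> permutes {1..n}" by (auto elim: has_arity.cases simp del: One_nat_def)
  show ?case
    using 6 t homogeneous_closed[OF 6(1)]
    by (simp only: euler_Act cl_Act O.act_smult cl_car)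
next
  case (7 s k t l i)
  from 7(5) obtain m p where st: "h s m" "h t p" "1 \<le> i" "i \<le> m" "n = m + p - 1"
    by (auto elim: has_arity.cases simp del: One_nat_def)
  have "pcomp P m p i (cl m s) (cl p t) \<in> carrier (comps P n)"
    unfolding st(5) using st by (intro O.pcomp_closed cl_car)
  then show ?case
    using st 7 homogeneous_closed[OF 7(1)] homogeneous_closed[OF 7(2)]
      O.pcomp_smult_left[of k "cl m s" m "cl p t" p i] O.pcomp_smult_right[of l "cl m s" m "cl p t" p i]
    by (simp only: euler_Comp cl_Comp cl_car O.M.smult_l_distr)
qed

text \<open>
  The operad axioms are compatible with the Leibniz rule. A relation between expressions of the same
  weight is compatible with it because both sides are multiplied by that weight.
\<close>

lemma euler_cong: "oe n s t \<Longrightarrow> cl n (euler w s) = cl n (euler w t)"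
proof (induction rule: op_eq.induct)
  case (rel s t n)
  then obtain k where "homogeneous K w s k" "homogeneous K w t k" using homogeneous_rels by blast
  then show ?case
    using rel euler_homogeneous[of s k n] euler_homogeneous[of t k n] cl_eq[OF op_eq.rel, of s t n] by simp
next
  case (cong_plus n s s' t t')
  then show ?case using arity by (simp only: euler_Plus)
next
  case (cong_smult c n t t')
  then show ?case using arity by (simp only: euler_Smult)
next
  case (cong_act n t t' \<sigma>)
  then show ?case using arity by (simp only: euler_Act)
next
  case (cong_comp m s s' n t t' i)
  then show ?case
    using arity[OF cong_comp(1), THEN conjunct1] arity[OF cong_comp(1), THEN conjunct2]
      arity[OF cong_comp(2), THEN conjunct1] arity[OF cong_comp(2), THEN conjunct2]
      cl_eq[OF cong_comp(1)] cl_eq[OF cong_comp(2)]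
    by (simp only: euler_Comp HOL.refl)
next
  case (plus_assoc s n t u)
  then show ?case by (simp only: euler_Plus Plus_closed O.M.M.a_assoc cl_car euler_arity)
next
  case (plus_comm s n t)
  then show ?case by (simp only: euler_Plus Plus_closed cl_car euler_arity)
     (intro O.M.M.a_comm cl_car euler_arity)
next
  case (plus_zero t n)
  then show ?case
    by (simp only: euler_Plus euler_Zero has_arity.intros O.M.M.l_zero cl_car euler_arity)
next
  case (plus_neg t n)
  then show ?case
    by (simp add: euler_Plus euler_Smult euler_Zero Smult_closed cl_car euler_arity O.M.smult_l_minus O.M.M.l_neg
         del: euler.simps)
next
  case (smult_add b c t n)
  then show ?case
    by (simp add: euler_Plus euler_Smult Smult_closed cl_car euler_arity O.M.smult_l_distr del: euler.simps)
next
  case (smult_plus c s n t)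
  then show ?case
    by (simp add: euler_Plus euler_Smult Plus_closed Smult_closed cl_car euler_arity O.M.smult_r_distr
        del: euler.simps)
next
  case (smult_mult b c t n)
  then show ?case
    by (simp add: euler_Smult Smult_closed cl_car euler_arity O.M.smult_assoc1 del: euler.simps)
next
  case (smult_one t n)
  then show ?case by (simp add: euler_Smult cl_car euler_arity del: euler.simps)
next
  case (act_plus s n t \<sigma>)
  then show ?case
    by (simp add: euler_Plus euler_Act Plus_closed Act_closed cl_car euler_arity O.act_add
        del: euler.simps One_nat_def)
next
  case (act_smult c t n \<sigma>)
  then show ?case
    by (simp add: euler_Smult euler_Act Smult_closed Act_closed cl_car euler_arity O.act_smult
        del: euler.simps One_nat_def)
next
  case (act_id t n)
  then show ?case
    by (simp add: euler_Act permutes_id cl_car euler_arity O.act_id del: euler.simps One_nat_def)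
next
  case (act_comp t n \<sigma> \<tau>)
  then show ?case
    by (simp add: euler_Act permutes_compose Act_closed cl_car euler_arity O.act_comp
        del: euler.simps One_nat_def)
next
  case (comp_plus_left s m s' t n i)
  then show ?case
    by (simp add: euler_Comp[OF Plus_closed[OF comp_plus_left(1,2)] comp_plus_left(3-5) HOL.refl]
        euler_Plus euler_Comp Plus_closed Comp_closed cl_Plus cl_car
        euler_arity O.pcomp_add_left
        O.pcomp_closed O.M.M.a_ac del: euler.simps One_nat_def)
next
  case (comp_plus_right s m t n t' i)
  then show ?case
    by (simp add: euler_Comp[OF comp_plus_right(1) Plus_closed[OF comp_plus_right(2,3)] comp_plus_right(4,5) HOL.refl]
        euler_Plus euler_Comp Plus_closed Comp_closed cl_Plus cl_car
        euler_arity O.pcomp_add_right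
        O.pcomp_closed O.M.M.a_ac del: euler.simps One_nat_def)
next
  case (comp_smult_left c s m t n i)
  then show ?case
    by (simp add: euler_Comp[OF Smult_closed[OF comp_smult_left(1,2)] comp_smult_left(3-5) HOL.refl]
        euler_Smult euler_Comp Smult_closed Comp_closed cl_Smult cl_car
        euler_arity O.pcomp_smult_left
        O.pcomp_closed O.M.smult_r_distr del: euler.simps One_nat_def)
next
  case (comp_smult_right c s m t n i)
  then show ?case
    by (simp add: euler_Comp[OF comp_smult_right(2) Smult_closed[OF comp_smult_right(1,3)] comp_smult_right(4,5) HOL.refl]
        euler_Smult euler_Comp Smult_closed Comp_closed cl_Smult cl_car
        euler_arity O.pcomp_smult_right
        O.pcomp_closed O.M.smult_r_distr del: euler.simps One_nat_def)
next
  case (ident_left t n)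
  have "cl n (euler w (Comp 1 Ident t)) = pcomp P 1 n 1 (cl 1 (euler w Ident)) (cl n t)
      \<oplus>\<^bsub>comps P n\<^esub> pcomp P 1 n 1 (cl 1 Ident) (cl n (euler w t))"
    using ident_left has_arity.intros(2) by (intro euler_Comp) auto
  also have "pcomp P 1 n 1 (cl 1 (euler w Ident)) (cl n t) = \<zero>\<^bsub>comps P n\<^esub>"
    unfolding euler_Ident using O.pcomp_zero_left[OF cl_car[OF ident_left], of 1 1] by simp
  also have "pcomp P 1 n 1 (cl 1 Ident) (cl n (euler w t)) = cl n (euler w t)"
    using O.ident_left[OF cl_car[OF euler_arity[OF ident_left]]] by (simp only: ident_P)
  finally show ?case using cl_car[OF euler_arity[OF ident_left]] by simp
next
  case (ident_right s m i)
  have "cl m (euler w (Comp i s Ident)) = pcomp P m 1 i (cl m (euler w s)) (cl 1 Ident)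
      \<oplus>\<^bsub>comps P m\<^esub> pcomp P m 1 i (cl m s) (cl 1 (euler w Ident))"
    using ident_right has_arity.intros(2) by (intro euler_Comp) auto
  also have "pcomp P m 1 i (cl m s) (cl 1 (euler w Ident)) = \<zero>\<^bsub>comps P m\<^esub>"
    unfolding euler_Ident using O.pcomp_zero_right[OF cl_car[OF ident_right(1)] ident_right(2,3), of 1] by simp
  also have "pcomp P m 1 i (cl m (euler w s)) (cl 1 Ident) = cl m (euler w s)"
    using O.ident_right[OF cl_car[OF euler_arity[OF ident_right(1)]] ident_right(2,3)] by (simp only: ident_P)
  finally show ?case using cl_car[OF euler_arity[OF ident_right(1)]] by simp
next
  case (assoc_sequential s l t m u n i j)
  note car = cl_car[OF assoc_sequential(1)] cl_car[OF assoc_sequential(2)] cl_car[OF assoc_sequential(3)]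
    and dcar = cl_car[OF euler_arity[OF assoc_sequential(1)]] cl_car[OF euler_arity[OF assoc_sequential(2)]]
      cl_car[OF euler_arity[OF assoc_sequential(3)]]
    and ij = assoc_sequential(4-7)
  have ij': "1 \<le> i + j - 1" "i + j - 1 \<le> l + m - 1" using ij by auto
  define N where "N = l + m - 1 + n - 1"
  have N: "l + (m + n - 1) - 1 = N" using ij by (auto simp: N_def)
  note st = Comp_closed[OF assoc_sequential(1,2) ij(1,2)] and tu = Comp_closed[OF assoc_sequential(2,3) ij(3,4)]
  note assoc = O.assoc_sequential[OF _ _ _ ij]
  have cl1: "pcomp P (l + m - 1) n (i + j - 1) (pcomp P l m i x y) z \<in> carrier (comps P N)"
    if "x \<in> carrier (comps P l)" "y \<in> carrier (comps P m)" "z \<in> carrier (comps P n)" for x y z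
    unfolding N_def using that ij ij' by (intro O.pcomp_closed)
  note car2 = cl1[OF dcar(1) car(2,3)] cl1[OF car(1) dcar(2) car(3)] cl1[OF car(1,2) dcar(3)]
  have "cl N (euler w (Comp (i + j - 1) (Comp i s t) u))
    = pcomp P (l + m - 1) n (i + j - 1) (pcomp P l m i (cl l (euler w s)) (cl m t)
        \<oplus>\<^bsub>comps P (l + m - 1)\<^esub> pcomp P l m i (cl l s) (cl m (euler w t))) (cl n u)
      \<oplus>\<^bsub>comps P N\<^esub> pcomp P (l + m - 1) n (i + j - 1) (pcomp P l m i (cl l s) (cl m t)) (cl n (euler w u))"
    using assoc_sequential(1-3) ij ij' st N_def
    by (simp only: euler_Comp cl_Comp HOL.refl)
  also have "\<dots> = pcomp P (l + m - 1) n (i + j - 1) (pcomp P l m i (cl l (euler w s)) (cl m t)) (cl n u)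
      \<oplus>\<^bsub>comps P N\<^esub> (pcomp P (l + m - 1) n (i + j - 1) (pcomp P l m i (cl l s) (cl m (euler w t))) (cl n u)
      \<oplus>\<^bsub>comps P N\<^esub> pcomp P (l + m - 1) n (i + j - 1) (pcomp P l m i (cl l s) (cl m t)) (cl n (euler w u)))"
    using car dcar ij ij' car2
    by (simp only: O.pcomp_add_left O.pcomp_closed N_def[symmetric] O.M.M.a_assoc)
  also have "\<dots> = pcomp P l (m + n - 1) i (cl l (euler w s)) (pcomp P m n j (cl m t) (cl n u))
      \<oplus>\<^bsub>comps P N\<^esub> pcomp P l (m + n - 1) i (cl l s)
        (pcomp P m n j (cl m (euler w t)) (cl n u) \<oplus>\<^bsub>comps P (m + n - 1)\<^esub> pcomp P m n j (cl m t) (cl n (euler w u)))"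
    using car dcar ij by (simp only: assoc O.pcomp_add_right O.pcomp_closed N)
  also have "\<dots> = cl N (euler w (Comp i s (Comp j t u)))"
    using assoc_sequential(1-3) ij tu N[symmetric]
    by (simp only: euler_Comp cl_Comp HOL.refl)
  finally show ?case unfolding N .
next
  case (assoc_parallel s l t m u n i k)
  note car = cl_car[OF assoc_parallel(1)] cl_car[OF assoc_parallel(2)] cl_car[OF assoc_parallel(3)]
    and dcar = cl_car[OF euler_arity[OF assoc_parallel(1)]] cl_car[OF euler_arity[OF assoc_parallel(2)]]
      cl_car[OF euler_arity[OF assoc_parallel(3)]]
    and ik = assoc_parallel(4-6)
  have ik': "i \<le> l" "1 \<le> k" "1 \<le> k + m - 1" "k + m - 1 \<le> l + m - 1" "i \<le> l + n - 1"
    using ik by auto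
  define N where "N = l + m - 1 + n - 1"
  have N: "l + n - 1 + m - 1 = N" using ik by (auto simp: N_def)
  note st = Comp_closed[OF assoc_parallel(1,2) ik(1) ik'(1)] and su = Comp_closed[OF assoc_parallel(1,3) ik'(2) ik(3)]
  note assoc = O.assoc_parallel[OF _ _ _ ik]
  have cl1: "pcomp P (l + m - 1) n (k + m - 1) (pcomp P l m i x y) z \<in> carrier (comps P N)"
    if "x \<in> carrier (comps P l)" "y \<in> carrier (comps P m)" "z \<in> carrier (comps P n)" for x y z
    unfolding N_def using that ik ik' by (intro O.pcomp_closed)
  note car2 = cl1[OF dcar(1) car(2,3)] cl1[OF car(1) dcar(2) car(3)] cl1[OF car(1,2) dcar(3)]
  have "cl N (euler w (Comp (k + m - 1) (Comp i s t) u))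
    = pcomp P (l + m - 1) n (k + m - 1) (pcomp P l m i (cl l (euler w s)) (cl m t)
        \<oplus>\<^bsub>comps P (l + m - 1)\<^esub> pcomp P l m i (cl l s) (cl m (euler w t))) (cl n u)
      \<oplus>\<^bsub>comps P N\<^esub> pcomp P (l + m - 1) n (k + m - 1) (pcomp P l m i (cl l s) (cl m t)) (cl n (euler w u))"
    using assoc_parallel(1-3) ik ik' st N_def
    by (simp only: euler_Comp cl_Comp HOL.refl)
  also have "\<dots> = pcomp P (l + m - 1) n (k + m - 1) (pcomp P l m i (cl l (euler w s)) (cl m t)) (cl n u)
      \<oplus>\<^bsub>comps P N\<^esub> pcomp P (l + m - 1) n (k + m - 1) (pcomp P l m i (cl l s) (cl m (euler w t))) (cl n u)
      \<oplus>\<^bsub>comps P N\<^esub> pcomp P (l + m - 1) n (k + m - 1) (pcomp P l m i (cl l s) (cl m t)) (cl n (euler w u))"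
    using car dcar ik ik' by (simp only: O.pcomp_add_left O.pcomp_closed N_def[symmetric])
  also have "\<dots> = pcomp P (l + m - 1) n (k + m - 1) (pcomp P l m i (cl l (euler w s)) (cl m t)) (cl n u)
      \<oplus>\<^bsub>comps P N\<^esub> pcomp P (l + m - 1) n (k + m - 1) (pcomp P l m i (cl l s) (cl m t)) (cl n (euler w u))
      \<oplus>\<^bsub>comps P N\<^esub> pcomp P (l + m - 1) n (k + m - 1) (pcomp P l m i (cl l s) (cl m (euler w t))) (cl n u)"
    using car2 by (simp add: O.M.M.a_ac)
  also have "\<dots> = pcomp P (l + n - 1) m i (pcomp P l n k (cl l (euler w s)) (cl n u)
        \<oplus>\<^bsub>comps P (l + n - 1)\<^esub> pcomp P l n k (cl l s) (cl n (euler w u))) (cl m t)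
      \<oplus>\<^bsub>comps P N\<^esub> pcomp P (l + n - 1) m i (pcomp P l n k (cl l s) (cl n u)) (cl m (euler w t))"
    using car dcar ik ik' by (simp only: assoc O.pcomp_add_left O.pcomp_closed N)
  also have "\<dots> = cl N (euler w (Comp i (Comp k s u) t))"
    using assoc_parallel(1-3) ik ik' su N[symmetric]
    by (simp only: euler_Comp cl_Comp HOL.refl)
  finally show ?case unfolding N_def .
next
  case (equivariant s m t n \<sigma> \<tau> i)
  note car = cl_car[OF equivariant(1)] cl_car[OF equivariant(2)]
    and dcar = cl_car[OF euler_arity[OF equivariant(1)]] cl_car[OF euler_arity[OF equivariant(2)]]
    and p = equivariant(3,4) and i = equivariant(5,6)
  have \<sigma>i: "1 \<le> \<sigma> i" "\<sigma> i \<le> m" using permutes_in_image[OF p(1), of i] i by auto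
  note \<pi> = perm_ins_permutes[OF p i]
  show ?case
    using equivariant(1,2) p i \<sigma>i \<pi> car dcar
    by (simp only: euler_Comp[OF Act_closed[OF equivariant(1) p(1)] Act_closed[OF equivariant(2) p(2)] i HOL.refl]
        euler_Comp euler_Act cl_Act Act_closed Comp_closed HOL.refl O.equivariant O.act_add O.pcomp_closed)
qed simp_all

definition euler_der :: "nat \<Rightarrow> ('a, 'c) expr set \<Rightarrow> ('a, 'c) expr set" where
  "euler_der n = (\<lambda>X\<in>carrier (comps P n). \<Union>t\<in>X. cl n (euler w t))"

lemma euler_der_cl: "h t n \<Longrightarrow> euler_der n (cl n t) = cl n (euler w t)"
  unfolding euler_der_def
  using lift1[of t n n "euler w"] euler_cong[of n t] arity
  by (simp add: cl_car cl_eq_iff euler_arity)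

lemma euler_der_derivation: "derivation K P euler_der"
  unfolding derivation_def
proof (intro conjI allI ballI impI)
  show "euler_der n \<in> carrier (comps P n) \<rightarrow>\<^sub>E carrier (comps P n)" for n
  proof (rule PiE_I)
    fix X assume "X \<in> carrier (comps P n)"
    then show "euler_der n X \<in> carrier (comps P n)"
      by (auto simp: car euler_der_cl intro!: imageI euler_arity)
  qed (simp add: euler_der_def)
next
  fix n X Y assume "X \<in> carrier (comps P n)" "Y \<in> carrier (comps P n)"
  then obtain s t where "h s n" "h t n" "X = cl n s" "Y = cl n t" by (auto simp: car)
  then show "euler_der n (X \<oplus>\<^bsub>comps P n\<^esub> Y) = euler_der n X \<oplus>\<^bsub>comps P n\<^esub> euler_der n Y"
    by (simp only: cl_Plus[symmetric] euler_der_cl euler_Plus Plus_closed)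
next
  fix n c X assume "c \<in> carrier K" "X \<in> carrier (comps P n)"
  then obtain t where "c \<in> carrier K" "h t n" "X = cl n t" by (auto simp: car)
  then show "euler_der n (c \<odot>\<^bsub>comps P n\<^esub> X) = c \<odot>\<^bsub>comps P n\<^esub> euler_der n X"
    by (simp only: cl_Smult[symmetric] euler_der_cl euler_Smult Smult_closed)
next
  fix n X \<sigma> assume "X \<in> carrier (comps P n)" "\<sigma> permutes {1..n}"
  then obtain t where "\<sigma> permutes {1..n}" "h t n" "X = cl n t" by (auto simp: car simp del: One_nat_def)
  then show "euler_der n (act P n X \<sigma>) = act P n (euler_der n X) \<sigma>"
    by (simp only: cl_Act[symmetric] euler_der_cl euler_Act Act_closed)
next
  fix m n i X Y assume "X \<in> carrier (comps P m)" "Y \<in> carrier (comps P n)" "1 \<le> i \<and> i \<le> m"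
  then obtain s t where "h s m" "h t n" "X = cl m s" "Y = cl n t" "1 \<le> i" "i \<le> m"
    by (auto simp: car simp del: One_nat_def)
  then show "euler_der (m + n - 1) (pcomp P m n i X Y)
      = pcomp P m n i (euler_der m X) Y \<oplus>\<^bsub>comps P (m + n - 1)\<^esub> pcomp P m n i X (euler_der n Y)"
    by (simp only: comp_P euler_der_cl euler_Comp Comp_closed HOL.refl)
qed

end


section \<open>Brackets to first order\<close>

text \<open>
  The model in this section interprets an operation with n inputs as an expression
  \<open>c x\<^sub>1 \<dots> x\<^sub>n + \<Sum> b\<^sub>k\<^sub>l {x\<^sub>k, x\<^sub>l} \<dots>\<close>, the sum over \<open>k < l\<close>, in which the dots stand for the product of
  the remaining inputs and terms with two or more brackets are dropped. The scalar c is the image in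
  the commutative operad and \<open>b\<^sub>k\<^sub>l\<close> is a form on the inputs, alternating for products and brackets.
  These are visibly nonzero in the model, and this is how they are shown to be nonzero in a presented
  operad.

  If an operation with n inputs is plugged into the i-th input of another one, \<open>collapse i n\<close> sends an
  input of the composite to the input of the outer operation through which it passes.
\<close>

definition collapse :: "nat \<Rightarrow> nat \<Rightarrow> nat \<Rightarrow> nat" where
  "collapse i n k = (if k < i then k else if k < i + n then i else k + 1 - n)"

lemma collapse_range:
  "\<lbrakk>1 \<le> i; i \<le> m; k \<in> {1..m + n - 1}\<rbrakk> \<Longrightarrow> collapse i n k \<in> {1..m}"
  by (auto simp: collapse_def)

lemma collapse_one: "collapse i 1 k = k"
  by (auto simp: collapse_def)

lemma collapse_sequential:
  assumes "1 \<le> i" "1 \<le> j" "j \<le> m"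
  shows "collapse i m (collapse (i + j - 1) n k) = collapse i (m + n - 1) k"
    and "collapse (i + j - 1) n k \<in> {i..<i + m} \<longleftrightarrow> k \<in> {i..<i + (m + n - 1)}"
    and "k \<in> {i..<i + (m + n - 1)} \<Longrightarrow> collapse (i + j - 1) n k + 1 - i = collapse j n (k + 1 - i)"
    and "k \<in> {i + j - 1..<i + j - 1 + n} \<longleftrightarrow> k \<in> {i..<i + (m + n - 1)} \<and> k + 1 - i \<in> {j..<j + n}"
  using assms by (auto simp: collapse_def)

lemma collapse_parallel:
  assumes "1 \<le> i" "i < k"
  shows "collapse i m (collapse (k + m - 1) n x) = collapse k n (collapse i m x)"
    and "collapse (k + m - 1) n x \<in> {i..<i + m} \<longleftrightarrow> x \<in> {i..<i + m}"
    and "x \<in> {i..<i + m} \<Longrightarrow> collapse (k + m - 1) n x = x"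
    and "collapse i m x \<in> {k..<k + n} \<longleftrightarrow> x \<in> {k + m - 1..<k + m - 1 + n}"
    and "x \<in> {k + m - 1..<k + m - 1 + n} \<Longrightarrow> collapse i m x + 1 - k = x + 1 - (k + m - 1)"
  using assms by (auto simp: collapse_def)

lemma collapse_perm_ins:
  assumes \<sigma>: "\<sigma> permutes {1..m}" and \<tau>: "\<tau> permutes {1..n}" and i: "1 \<le> i" "i \<le> m"
    and k: "k \<in> {1..m + n - 1}"
  shows "collapse (\<sigma> i) n (perm_ins m n i \<sigma> \<tau> k) = \<sigma> (collapse i n k)"
    and "perm_ins m n i \<sigma> \<tau> k \<in> {\<sigma> i..<\<sigma> i + n} \<longleftrightarrow> k \<in> {i..<i + n}"
    and "k \<in> {i..<i + n} \<Longrightarrow> perm_ins m n i \<sigma> \<tau> k + 1 - \<sigma> i = \<tau> (k + 1 - i)"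
proof -
  have \<sigma>i: "1 \<le> \<sigma> i" using permutes_in_image[OF \<sigma>, of i] i by auto
  have block: "1 \<le> \<tau> (k + 1 - i) \<and> \<tau> (k + 1 - i) \<le> n" if "k \<in> {i..<i + n}"
    using permutes_in_image[OF \<tau>, of "k + 1 - i"] that by auto
  have other: "1 \<le> \<sigma> j \<and> \<sigma> j \<noteq> \<sigma> i" if "j \<noteq> i" "1 \<le> j" "j \<le> m" for j
    using permutes_in_image[OF \<sigma>, of j] permutes_inj[OF \<sigma>] that by (auto simp: inj_def)
  show "collapse (\<sigma> i) n (perm_ins m n i \<sigma> \<tau> k) = \<sigma> (collapse i n k)"
    and "perm_ins m n i \<sigma> \<tau> k \<in> {\<sigma> i..<\<sigma> i + n} \<longleftrightarrow> k \<in> {i..<i + n}"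
    and "k \<in> {i..<i + n} \<Longrightarrow> perm_ins m n i \<sigma> \<tau> k + 1 - \<sigma> i = \<tau> (k + 1 - i)"
  proof -
    consider "k \<in> {i..<i + n}" | "k < i" | "i + n \<le> k" by force
    then have "collapse (\<sigma> i) n (perm_ins m n i \<sigma> \<tau> k) = \<sigma> (collapse i n k)
      \<and> (perm_ins m n i \<sigma> \<tau> k \<in> {\<sigma> i..<\<sigma> i + n} \<longleftrightarrow> k \<in> {i..<i + n})
      \<and> (k \<in> {i..<i + n} \<longrightarrow> perm_ins m n i \<sigma> \<tau> k + 1 - \<sigma> i = \<tau> (k + 1 - i))"
    proof cases
      case 1
      then show ?thesis using \<sigma>i block i k by (auto simp: collapse_def perm_ins_def)
    next
      case 2
      then show ?thesis using \<sigma>i other[of k] i k by (auto simp: collapse_def perm_ins_def Let_def)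
    next
      case 3
      define j where "j = k + 1 - n"
      have j: "j \<noteq> i" "1 \<le> j" "j \<le> m" "k = j + n - 1" using 3 i k by (auto simp: j_def)
      have "perm_ins m n i \<sigma> \<tau> k = (if \<sigma> j < \<sigma> i then \<sigma> j else \<sigma> j + n - 1)"
        "collapse i n k = j"
        using 3 i k by (auto simp: j_def perm_ins_def collapse_def Let_def)
      moreover have "\<sigma> j < \<sigma> i \<or> \<sigma> i < \<sigma> j" "1 \<le> \<sigma> j" using other[OF j(1-3)] by auto
      ultimately show ?thesis using \<sigma>i 3 by (auto simp: collapse_def)
    qed
    then show "collapse (\<sigma> i) n (perm_ins m n i \<sigma> \<tau> k) = \<sigma> (collapse i n k)"
      and "perm_ins m n i \<sigma> \<tau> k \<in> {\<sigma> i..<\<sigma> i + n} \<longleftrightarrow> k \<in> {i..<i + n}"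
      and "k \<in> {i..<i + n} \<Longrightarrow> perm_ins m n i \<sigma> \<tau> k + 1 - \<sigma> i = \<tau> (k + 1 - i)"
      by blast+
  qed
qed

text \<open>
  The interpretation of a composition needs the length of the inserted block, which the expression
  contains only implicitly.
\<close>

primrec expr_arity :: "('g \<Rightarrow> nat) \<Rightarrow> ('k, 'g) expr \<Rightarrow> nat" where
  "expr_arity ar (Gen g) = ar g"
| "expr_arity ar Ident = 1"
| "expr_arity ar (Zero n) = n"
| "expr_arity ar (Plus s t) = expr_arity ar s"
| "expr_arity ar (Smult c t) = expr_arity ar t"
| "expr_arity ar (Act t \<sigma>) = expr_arity ar t"
| "expr_arity ar (Comp i s t) = expr_arity ar s + expr_arity ar t - 1"

lemma has_arity_expr_arity: "has_arity K ar t n \<Longrightarrow> expr_arity ar t = n"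
  by (induction rule: has_arity.induct) auto

locale bivector_model = presentation +
  fixes c :: "'c \<Rightarrow> 'a" and b :: "'c \<Rightarrow> nat \<Rightarrow> nat \<Rightarrow> 'a"
  assumes c_closed: "c g \<in> carrier K" and b_closed: "b g k l \<in> carrier K"
begin

primrec scal :: "('a, 'c) expr \<Rightarrow> 'a" where
  "scal (Gen g) = c g"
| "scal Ident = \<one>"
| "scal (Zero n) = \<zero>"
| "scal (Plus s t) = scal s \<oplus> scal t"
| "scal (Smult a t) = a \<otimes> scal t"
| "scal (Act t \<sigma>) = scal t"
| "scal (Comp i s t) = scal s \<otimes> scal t"

text \<open>
  The bracket of the inputs k and l of a composite comes either from a bracket of the outer operation,
  which the Leibniz rule distributes over the inserted product, or from a bracket of the inserted
  operation. Two inputs of the same block contribute a diagonal value of the outer form, which vanishes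
  if that form is alternating.
\<close>

primrec biv :: "('a, 'c) expr \<Rightarrow> nat \<Rightarrow> nat \<Rightarrow> 'a" where
  "biv (Gen g) = b g"
| "biv Ident = (\<lambda>k l. \<zero>)"
| "biv (Zero n) = (\<lambda>k l. \<zero>)"
| "biv (Plus s t) = (\<lambda>k l. biv s k l \<oplus> biv t k l)"
| "biv (Smult a t) = (\<lambda>k l. a \<otimes> biv t k l)"
| "biv (Act t \<sigma>) = (\<lambda>k l. biv t (\<sigma> k) (\<sigma> l))"
| "biv (Comp i s t) = (\<lambda>k l. let n = expr_arity ar t in
    scal t \<otimes> biv s (collapse i n k) (collapse i n l)
    \<oplus> (if k \<in> {i..<i + n} \<and> l \<in> {i..<i + n} then scal s \<otimes> biv t (k + 1 - i) (l + 1 - i) else \<zero>))"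

definition same_value :: "nat \<Rightarrow> ('a, 'c) expr \<Rightarrow> ('a, 'c) expr \<Rightarrow> bool" where
  "same_value n s t \<longleftrightarrow> scal s = scal t \<and> (\<forall>k\<in>{1..n}. \<forall>l\<in>{1..n}. biv s k l = biv t k l)"

lemma scal_closed: "h t n \<Longrightarrow> scal t \<in> carrier K"
  by (induction rule: has_arity.induct) (auto intro: c_closed)

lemma biv_closed: "h t n \<Longrightarrow> biv t k l \<in> carrier K"
  by (induction arbitrary: k l rule: has_arity.induct) (auto intro!: a_closed m_closed intro: b_closed scal_closed simp: Let_def)

lemma same_value_sound:
  assumes rels: "\<And>s t n. \<lbrakk>(s, t) \<in> R; h s n; h t n\<rbrakk> \<Longrightarrow> same_value n s t"
  shows "oe n s t \<Longrightarrow> same_value n s t"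
proof (induction rule: op_eq.induct)
  case rel then show ?case by (rule rels)
next
  case (cong_act n t t' \<sigma>)
  then show ?case
    using permutes_in_image[OF cong_act(2)] by (simp add: same_value_def del: One_nat_def)
next
  case (cong_comp m s s' n t t' i)
  note h = arity[OF cong_comp(1), THEN conjunct1] arity[OF cong_comp(1), THEN conjunct2]
    arity[OF cong_comp(2), THEN conjunct1] arity[OF cong_comp(2), THEN conjunct2]
  have "biv t (k + 1 - i) (l + 1 - i) = biv t' (k + 1 - i) (l + 1 - i)"
    if "k \<in> {i..<i + n}" "l \<in> {i..<i + n}" for k l
  proof -
    have "k + 1 - i \<in> {1..n}" "l + 1 - i \<in> {1..n}" using that by auto
    then show ?thesis using cong_comp.IH(2) unfolding same_value_def by blast
  qed
  then show ?case
    using cong_comp.IH collapse_range[OF cong_comp(3,4)] h[THEN has_arity_expr_arity]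
    by (simp add: same_value_def Let_def del: One_nat_def)
next
  case (ident_left t n)
  then show ?case
    using has_arity_expr_arity[OF ident_left] scal_closed[OF ident_left] biv_closed[OF ident_left]
    by (auto simp: same_value_def Let_def)
next
  case (ident_right s m i)
  then show ?case
    using scal_closed[OF ident_right(1)] biv_closed[OF ident_right(1)]
    by (auto simp: same_value_def Let_def collapse_one[simplified])
next
  case (assoc_sequential s l t m u n i j)
  note h = assoc_sequential(1-3)
  note [simp] = h[THEN has_arity_expr_arity] h[THEN scal_closed] h[THEN biv_closed]
  note seq = collapse_sequential[OF assoc_sequential(4,6,7), where n = n]
  have shift: "x + 1 - (i + j - 1) = x + 1 - i + 1 - j" for x
    using assoc_sequential(4,6) by auto
  have "biv (Comp (i + j - 1) (Comp i s t) u) k l' = biv (Comp i s (Comp j t u)) k l'" for k l'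
  proof -
    define S where "S = biv s (collapse i (m + n - 1) k) (collapse i (m + n - 1) l')"
    define T where "T = biv t (collapse j n (k + 1 - i)) (collapse j n (l' + 1 - i))"
    define U where "U = biv u (k + 1 - i + 1 - j) (l' + 1 - i + 1 - j)"
    have [simp]: "S \<in> carrier K" "T \<in> carrier K" "U \<in> carrier K" by (simp_all add: S_def T_def U_def)
    let ?p = "k \<in> {i..<i + (m + n - 1)} \<and> l' \<in> {i..<i + (m + n - 1)}"
    let ?q = "k + 1 - i \<in> {j..<j + n} \<and> l' + 1 - i \<in> {j..<j + n}"
    have inner: "k \<in> {i + j - 1..<i + j - 1 + n} \<and> l' \<in> {i + j - 1..<i + j - 1 + n} \<longleftrightarrow> ?p \<and> ?q"
      using seq(4)[where k = k] seq(4)[where k = l'] by blast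
    have "biv (Comp (i + j - 1) (Comp i s t) u) k l'
        = scal u \<otimes> (scal t \<otimes> S \<oplus> (if ?p then scal s \<otimes> T else \<zero>))
          \<oplus> (if ?p \<and> ?q then scal s \<otimes> scal t \<otimes> U else \<zero>)"
      unfolding biv.simps scal.simps Let_def h[THEN has_arity_expr_arity] seq(1,2) inner shift S_def T_def U_def
      by (cases ?p) (simp_all only: seq(3) if_True if_False simp_thms)
    moreover have "biv (Comp i s (Comp j t u)) k l'
        = scal t \<otimes> scal u \<otimes> S
          \<oplus> (if ?p then scal s \<otimes> (scal u \<otimes> T \<oplus> (if ?q then scal t \<otimes> U else \<zero>)) else \<zero>)"
      by (simp only: biv.simps scal.simps expr_arity.simps Let_def h[THEN has_arity_expr_arity] S_def T_def U_def)
    moreover have "scal u \<otimes> (scal t \<otimes> S \<oplus> (if p then scal s \<otimes> T else \<zero>))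
          \<oplus> (if p \<and> q then scal s \<otimes> scal t \<otimes> U else \<zero>)
        = scal t \<otimes> scal u \<otimes> S
          \<oplus> (if p then scal s \<otimes> (scal u \<otimes> T \<oplus> (if q then scal t \<otimes> U else \<zero>)) else \<zero>)" for p q
      by (cases p; cases q) (simp_all add: r_distr m_ac a_ac)
    ultimately show ?thesis by (simp only:)
  qed
  then show ?case by (simp add: same_value_def m_assoc del: biv.simps)
next
  case (assoc_parallel s l t m u n i k)
  note h = assoc_parallel(1-3)
  note [simp] = h[THEN has_arity_expr_arity] h[THEN scal_closed] h[THEN biv_closed]
  note par = collapse_parallel[OF assoc_parallel(4,5)]
  have "biv (Comp (k + m - 1) (Comp i s t) u) x y = biv (Comp i (Comp k s u) t) x y" for x y
  proof -
    define S where "S = biv s (collapse k n (collapse i m x)) (collapse k n (collapse i m y))"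
    define T where "T = biv t (x + 1 - i) (y + 1 - i)"
    define U where "U = biv u (x + 1 - (k + m - 1)) (y + 1 - (k + m - 1))"
    have [simp]: "S \<in> carrier K" "T \<in> carrier K" "U \<in> carrier K" by (simp_all add: S_def T_def U_def)
    let ?p = "x \<in> {i..<i + m} \<and> y \<in> {i..<i + m}"
    let ?q = "x \<in> {k + m - 1..<k + m - 1 + n} \<and> y \<in> {k + m - 1..<k + m - 1 + n}"
    have "biv (Comp (k + m - 1) (Comp i s t) u) x y
        = scal u \<otimes> (scal t \<otimes> S \<oplus> (if ?p then scal s \<otimes> T else \<zero>))
          \<oplus> (if ?q then scal s \<otimes> scal t \<otimes> U else \<zero>)"
      unfolding biv.simps scal.simps Let_def h[THEN has_arity_expr_arity] par(1,2) S_def T_def U_def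
      by (cases ?p) (simp_all only: par(3) if_True if_False simp_thms)
    moreover have "biv (Comp i (Comp k s u) t) x y
        = scal t \<otimes> (scal u \<otimes> S \<oplus> (if ?q then scal s \<otimes> U else \<zero>))
          \<oplus> (if ?p then scal s \<otimes> scal u \<otimes> T else \<zero>)"
      unfolding biv.simps scal.simps Let_def h[THEN has_arity_expr_arity] par(4) S_def T_def U_def
      by (cases ?q) (simp_all only: par(5)[where n = n] if_True if_False simp_thms)
    moreover have "scal u \<otimes> (scal t \<otimes> S \<oplus> (if p then scal s \<otimes> T else \<zero>))
          \<oplus> (if q then scal s \<otimes> scal t \<otimes> U else \<zero>)
        = scal t \<otimes> (scal u \<otimes> S \<oplus> (if q then scal s \<otimes> U else \<zero>))
          \<oplus> (if p then scal s \<otimes> scal u \<otimes> T else \<zero>)" for p q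
      by (cases p; cases q) (simp_all add: r_distr m_ac a_ac)
    ultimately show ?thesis by (simp only:)
  qed
  then show ?case by (simp add: same_value_def m_ac del: biv.simps)
next
  case (equivariant s m t n \<sigma> \<tau> i)
  note [simp] = equivariant(1,2)[THEN has_arity_expr_arity]
  show ?case
    using collapse_perm_ins[OF equivariant(3-6)]
    by (simp add: same_value_def Let_def del: One_nat_def atLeastLessThan_iff atLeastAtMost_iff)
next
  case (comp_plus_left s m s' t n i)
  note [simp] = comp_plus_left(1,2,3)[THEN has_arity_expr_arity] comp_plus_left(1,2,3)[THEN scal_closed]
    comp_plus_left(1,2,3)[THEN biv_closed]
  show ?case
    using comp_plus_left
    by (simp add: same_value_def Let_def l_distr r_distr m_ac a_ac del: atLeastLessThan_iff One_nat_def)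
next
  case (comp_plus_right s m t n t' i)
  note [simp] = comp_plus_right(1,2,3)[THEN has_arity_expr_arity] comp_plus_right(1,2,3)[THEN scal_closed]
    comp_plus_right(1,2,3)[THEN biv_closed]
  show ?case
    using comp_plus_right
    by (simp add: same_value_def Let_def l_distr r_distr m_ac a_ac del: atLeastLessThan_iff One_nat_def)
next
  case (comp_smult_left a s m t n i)
  note [simp] = comp_smult_left(2,3)[THEN has_arity_expr_arity] comp_smult_left(2,3)[THEN scal_closed]
    comp_smult_left(2,3)[THEN biv_closed]
  show ?case
    using comp_smult_left
    by (simp add: same_value_def Let_def l_distr r_distr m_ac a_ac del: atLeastLessThan_iff One_nat_def)
next
  case (comp_smult_right a s m t n i)
  note [simp] = comp_smult_right(2,3)[THEN has_arity_expr_arity] comp_smult_right(2,3)[THEN scal_closed]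
    comp_smult_right(2,3)[THEN biv_closed]
  show ?case
    using comp_smult_right
    by (simp add: same_value_def Let_def l_distr r_distr m_ac a_ac del: atLeastLessThan_iff One_nat_def)
next
  case (plus_neg t n)
  then show ?case by (simp add: same_value_def scal_closed biv_closed l_minus l_neg)
next
  case (smult_add a a' t n)
  then show ?case by (simp add: same_value_def scal_closed biv_closed l_distr)
next
  case (smult_plus a s n t)
  then show ?case by (simp add: same_value_def scal_closed biv_closed r_distr)
next
  case (smult_mult a a' t n)
  then show ?case by (simp add: same_value_def scal_closed biv_closed m_assoc)
qed (simp_all add: same_value_def scal_closed biv_closed a_ac)

end

text \<open>
  The form that belongs to the bracket of two inputs.
\<close>

definition area :: "('k, 'r) ring_scheme \<Rightarrow> nat \<Rightarrow> nat \<Rightarrow> 'k" where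
  "area K k l = (if k = 1 \<and> l = 2 then \<one>\<^bsub>K\<^esub> else if k = 2 \<and> l = 1 then \<ominus>\<^bsub>K\<^esub> \<one>\<^bsub>K\<^esub> else \<zero>\<^bsub>K\<^esub>)"


context field
begin

lemma area_closed: "area R k l \<in> carrier R"
  by (simp add: area_def)

lemma area_swap:
  assumes "k \<in> {1..2}" "l \<in> {1..2}"
  shows "area R (swap12 k) (swap12 l) = \<ominus> \<one> \<otimes> area R k l"
proof -
  have "{1..2::nat} = {1, 2}" by auto
  then show ?thesis using assms by (auto simp: area_def l_minus)
qed

end


section \<open>The Lie operad\<close>

text \<open>
  Since \<open>Lie\<close> has no nullary operations, its arities one and two are spanned by the identity and the
  bracket, and the bracket is determined by its eigenvalue under a derivation. In the model the bracket
  has a nonzero form, while a composition of two brackets vanishes, so the Jacobi identity holds there.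
\<close>

theorem Lie_derivations:
  fixes K :: "('k, 'r) ring_scheme"
  assumes "field K"
  shows "lie_iso K (der K (Lie K)) (lie_base K)" and "lie_trivial (H1 K (Lie K))"
proof -
  interpret K: field K by fact
  let ?ar = "\<lambda>_::lie_gen. 2 :: nat"
  interpret presentation K ?ar "Lie_rels K" by (rule presentation.intro) fact
  let ?b = "Gen LieBracket :: ('k, lie_gen) expr"
  define \<mu> where "\<mu> = cl 2 ?b"
  have hb: "has_arity K ?ar ?b 2" by (rule has_arity.intros)
  have \<mu>: "\<mu> \<in> carrier (comps (Lie K) 2)" unfolding \<mu>_def Lie_def by (rule cl_car[OF hb])
  interpret model: bivector_model K ?ar "Lie_rels K" "\<lambda>_. \<zero>\<^bsub>K\<^esub>" "\<lambda>_. area K"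
    by unfold_locales (simp_all add: K.area_closed)
  have rels: "model.same_value n s t" if "(s, t) \<in> Lie_rels K" "has_arity K ?ar s n" for s t n
  proof -
    have n: "n = expr_arity ?ar s" by (rule has_arity_expr_arity[OF that(2), symmetric])
    have "model.same_value 2 (Act ?b swap12) (Smult (\<ominus>\<^bsub>K\<^esub> \<one>\<^bsub>K\<^esub>) ?b)"
      using K.area_swap by (simp add: model.same_value_def del: One_nat_def)
    moreover have "model.same_value 3 (Comp 2 ?b ?b) (Plus (Comp 1 ?b ?b) (Act (Comp 2 ?b ?b) swap12))"
      by (simp add: model.same_value_def Let_def K.area_closed)
    ultimately show ?thesis
      using that(1) unfolding n by (auto simp: Lie_rels_def Let_def simp del: One_nat_def)
  qed
  have \<mu>_nonzero: "\<mu> \<noteq> \<zero>\<^bsub>comps (Lie K) 2\<^esub>"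
  proof
    assume "\<mu> = \<zero>\<^bsub>comps (Lie K) 2\<^esub>"
    then have "op_eq K ?ar (Lie_rels K) 2 ?b (Zero 2)"
      by (simp add: \<mu>_def Lie_def zero_P cl_eq_iff hb has_arity.intros)
    then have "model.same_value 2 ?b (Zero 2)" by (rule model.same_value_sound[rotated]) (rule rels)
    then have "area K 1 2 = \<zero>\<^bsub>K\<^esub>" unfolding model.same_value_def by force
    then show False by (simp add: area_def)
  qed
  have sw: "act (Lie K) 2 \<mu> swap12 = \<ominus>\<^bsub>K\<^esub> \<one>\<^bsub>K\<^esub> \<odot>\<^bsub>comps (Lie K) 2\<^esub> \<mu>"
  proof -
    have "act (Lie K) 2 \<mu> swap12 = cl 2 (Smult (\<ominus>\<^bsub>K\<^esub> \<one>\<^bsub>K\<^esub>) ?b)"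
      unfolding \<mu>_def Lie_def using hb
      by (intro relation_act swap12_permutes) (auto simp: Lie_rels_def Let_def intro: has_arity.intros)
    then show ?thesis unfolding \<mu>_def Lie_def using hb by (simp add: smult_P)
  qed
  interpret P: operad K "Lie K" unfolding Lie_def by (rule operad_P)
  let ?S = "(\<lambda>c. c \<odot>\<^bsub>comps (Lie K) 2\<^esub> \<mu>) ` carrier K"
  let ?G = "\<lambda>n. {cl n (Gen g) | g. ?ar g = n}"
  have G2: "?G 2 \<subseteq> ?S"
  proof
    fix y assume "y \<in> ?G 2"
    then obtain g where "y = cl 2 (Gen g)" by blast
    then have "y = \<mu>" by (cases g) (simp add: \<mu>_def)
    then show "y \<in> ?S" using \<mu> by (intro image_eqI[of _ _ "\<one>\<^bsub>K\<^esub>"]) simp_all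
  qed
  have S0: "\<zero>\<^bsub>comps (Lie K) 2\<^esub> \<in> ?S"
    using \<mu> by (intro image_eqI[of _ _ "\<zero>\<^bsub>K\<^esub>"]) simp_all
  have S_add: "x \<oplus>\<^bsub>comps (Lie K) 2\<^esub> y \<in> ?S" if "x \<in> ?S" "y \<in> ?S" for x y
    using that \<mu> by (auto simp: P.M.smult_l_distr[symmetric])
  have S_smult: "c \<odot>\<^bsub>comps (Lie K) 2\<^esub> x \<in> ?S" if "c \<in> carrier K" "x \<in> ?S" for c x
    using that \<mu> by (auto simp: P.M.smult_assoc1[symmetric])
  have S_act: "act (Lie K) 2 x swap12 \<in> ?S" if "x \<in> ?S" for x
  proof -
    from that obtain c where c: "c \<in> carrier K" "x = c \<odot>\<^bsub>comps (Lie K) 2\<^esub> \<mu>" by blast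
    have "act (Lie K) 2 x swap12 = c \<odot>\<^bsub>comps (Lie K) 2\<^esub> act (Lie K) 2 \<mu> swap12"
      unfolding c(2) by (rule P.act_smult[OF c(1) \<mu> swap12_permutes])
    also have "\<dots> \<in> ?S" unfolding sw using c(1) by (intro S_smult imageI) simp_all
    finally show ?thesis .
  qed
  have low: "(n = 1 \<longrightarrow> x \<in> (\<lambda>c. c \<odot>\<^bsub>comps (Lie K) 1\<^esub> ident (Lie K)) ` carrier K) \<and> (n = 2 \<longrightarrow> x \<in> ?S)"
    if x: "x \<in> carrier (comps (Lie K) n)" for x n
  proof -
    have "P.generated ?G n x"
      using x presented_generated unfolding Lie_def by (auto simp: car)
    moreover have "?G 0 = {}" "?G 1 = {}" by simp_all
    ultimately show ?thesis
      using P.generated_low_arity[of ?G ?S, OF _ _ G2 S0 S_add S_smult S_act] by blast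
  qed
  have P1: "carrier (comps (Lie K) 1) = (\<lambda>c. c \<odot>\<^bsub>comps (Lie K) 1\<^esub> ident (Lie K)) ` carrier K"
    using low[of _ 1] P.ident_closed by auto
  have eigen: "\<exists>a\<in>carrier K. d 2 \<mu> = a \<odot>\<^bsub>comps (Lie K) 2\<^esub> \<mu>" if "derivation K (Lie K) d" for d
    using low[OF derivation_closed[OF that \<mu>]] by blast
  have unique: "d = d'"
    if "derivation K (Lie K) d" "derivation K (Lie K) d'" "d 2 \<mu> = d' 2 \<mu>" for d d'
  proof (rule presented_derivation_eqI)
    show "d 2 (cl 2 (Gen g)) = d' 2 (cl 2 (Gen g))" for g using that(3) by (cases g) (simp add: \<mu>_def)
  qed (use that in \<open>simp_all add: Lie_def\<close>)
  show "lie_iso K (der K (Lie K)) (lie_base K)"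
    by (rule P.derivations_one_dimensional(1)[OF P1 \<mu> \<mu>_nonzero], erule eigen, rule unique)
  show "lie_trivial (H1 K (Lie K))"
    by (rule P.derivations_one_dimensional(2)[OF P1 \<mu> \<mu>_nonzero], erule eigen, rule unique)
qed


section \<open>The Poisson operad\<close>

lemma homogeneous_Comp:
  "\<lbrakk>homogeneous K w s k; homogeneous K w t l; k \<oplus>\<^bsub>K\<^esub> l = m\<rbrakk> \<Longrightarrow> homogeneous K w (Comp i s t) m"
  using homogeneous.intros(7) by metis

text \<open>
  Every Poisson relation is homogeneous in the number of brackets. The associated Euler derivation is
  the outer one.
\<close>

lemma Pois_weighted:
  assumes "field K"
  shows "weighted_presentation K (Pois_rels K)
    (\<lambda>g. if g = PoisBracket then \<one>\<^bsub>K\<^esub> else \<zero>\<^bsub>K\<^esub>)"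
proof -
  interpret K: field K by fact
  let ?w = "\<lambda>g. if g = PoisBracket then \<one>\<^bsub>K\<^esub> else \<zero>\<^bsub>K\<^esub>"
  have e: "homogeneous K ?w (Gen PoisUnit) \<zero>\<^bsub>K\<^esub>" and p: "homogeneous K ?w (Gen PoisMult) \<zero>\<^bsub>K\<^esub>"
    and b: "homogeneous K ?w (Gen PoisBracket) \<one>\<^bsub>K\<^esub>"
    using homogeneous.intros(1)[of K ?w PoisUnit] homogeneous.intros(1)[of K ?w PoisMult]
      homogeneous.intros(1)[of K ?w PoisBracket] by simp_all
  note hom = e p b homogeneous_Comp homogeneous.intros(2-6)
  have "\<exists>k. homogeneous K ?w s k \<and> homogeneous K ?w t k" if "(s, t) \<in> Pois_rels K" for s t
    using that unfolding Pois_rels_def Let_def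
  proof (elim insertE emptyE, goal_cases)
    case 1 then show ?case by (auto intro!: exI[of _ "\<zero>\<^bsub>K\<^esub>"] hom simp del: One_nat_def)
  next
    case 2 then show ?case by (auto intro!: exI[of _ "\<zero>\<^bsub>K\<^esub>"] hom simp del: One_nat_def)
  next
    case 3 then show ?case by (auto intro!: exI[of _ "\<one>\<^bsub>K\<^esub>"] hom simp del: One_nat_def)
  next
    case 4 then show ?case by (auto intro!: exI[of _ "\<one>\<^bsub>K\<^esub>"] hom simp del: One_nat_def)
  next
    case 5 then show ?case by (auto intro!: exI[of _ "\<zero>\<^bsub>K\<^esub>"] hom simp del: One_nat_def)
  next
    case 6 then show ?case by (auto intro!: exI[of _ "\<one>\<^bsub>K\<^esub>"] hom simp del: One_nat_def)
  next
    case 7 then show ?case by (auto intro!: exI[of _ "\<zero>\<^bsub>K\<^esub>"] hom simp del: One_nat_def)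
  next
    case 8 then show ?case by (auto intro!: exI[of _ "\<one>\<^bsub>K\<^esub>"] hom simp del: One_nat_def)
  next
    case 9 then show ?case by (auto intro!: exI[of _ "\<one>\<^bsub>K\<^esub> \<oplus>\<^bsub>K\<^esub> \<one>\<^bsub>K\<^esub>"] hom simp del: One_nat_def)
  qed
  then show ?thesis
    by (intro weighted_presentation.intro weighted_presentation_axioms.intro presentation.intro assms) simp_all
qed

abbreviation pois_scal :: "('k, 'r) ring_scheme \<Rightarrow> pois_gen \<Rightarrow> 'k" where
  "pois_scal K g \<equiv> (if g = PoisBracket then \<zero>\<^bsub>K\<^esub> else \<one>\<^bsub>K\<^esub>)"

abbreviation pois_biv :: "('k, 'r) ring_scheme \<Rightarrow> pois_gen \<Rightarrow> nat \<Rightarrow> nat \<Rightarrow> 'k" where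
  "pois_biv K g \<equiv> (if g = PoisBracket then area K else (\<lambda>k l. \<zero>\<^bsub>K\<^esub>))"

lemma Pois_model:
  assumes "field K"
  shows "bivector_model K (pois_scal K) (pois_biv K)"
proof -
  interpret K: field K by fact
  show ?thesis
    by (intro bivector_model.intro bivector_model_axioms.intro presentation.intro assms)
      (simp_all add: K.area_closed)
qed

lemma Pois_model_rels:
  assumes "field K" and st: "(s, t) \<in> Pois_rels K" "has_arity K pois_arity s n"
  shows "bivector_model.same_value K pois_arity (pois_scal K) (pois_biv K) n s t"
proof -
  interpret K: field K by fact
  interpret model: bivector_model K pois_arity "Pois_rels K" "pois_scal K" "pois_biv K"
    by (rule Pois_model) fact
  have n: "n = expr_arity pois_arity s" by (rule has_arity_expr_arity[OF st(2), symmetric])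
  have interval: "{Suc 0..Suc 0} = {1}" "{Suc 0..2} = {1, 2}" "{Suc 0..3} = {1, 2, 3}" by auto
  note ev = model.same_value_def collapse_def area_def Let_def interval
  show ?thesis
    using st(1) unfolding Pois_rels_def Let_def n
  proof (elim insertE emptyE, goal_cases)
    case 1 then show ?case by (simp add: ev)
  next
    case 2 then show ?case by (simp add: ev)
  next
    case 3 then show ?case by (simp add: ev)
  next
    case 4 then show ?case by (simp add: ev)
  next
    case 5 then show ?case by (simp add: ev)
  next
    case 6 then show ?case using K.area_swap by (simp add: model.same_value_def del: One_nat_def)
  next
    case 7 then show ?case by (simp add: ev)
  next
    case 8 then show ?case by (simp add: ev)
  next
    case 9 then show ?case by (simp add: model.same_value_def Let_def K.area_closed)
  qed
qed

text \<open>
  After elimination of the unit, the binary operations are spanned by the product \<open>\<mu>\<close> and the bracket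
  \<open>\<nu>\<close>, which the model shows to be linearly independent. Because \<open>\<mu>\<close> is symmetric and \<open>\<nu>\<close> is
  antisymmetric, the transposition separates them if 2 is invertible, so that a derivation multiplies
  each of them by a scalar. Its value \<open>c \<eta>\<close> on the unit is determined by that on \<open>\<mu>\<close> through
  \<open>\<mu> \<circ>\<^sub>1 \<eta> = 1\<close>.
\<close>

theorem Pois_derivations:
  fixes K :: "('k, 'r) ring_scheme"
  assumes "field K" and char: "\<one>\<^bsub>K\<^esub> \<oplus>\<^bsub>K\<^esub> \<one>\<^bsub>K\<^esub> \<noteq> \<zero>\<^bsub>K\<^esub>"
  shows "lie_iso K (der K (Pois K)) (lie_dsum (lie_base K) (lie_base K))"
    and "lie_iso K (H1 K (Pois K)) (lie_base K)"
proof -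
  interpret K: field K by fact
  interpret presentation K pois_arity "Pois_rels K" by (rule presentation.intro) fact
  interpret W: weighted_presentation K pois_arity "Pois_rels K"
      "\<lambda>g. if g = PoisBracket then \<one>\<^bsub>K\<^esub> else \<zero>\<^bsub>K\<^esub>"
    by (rule Pois_weighted) fact
  interpret model: bivector_model K pois_arity "Pois_rels K" "pois_scal K" "pois_biv K"
    by (rule Pois_model) fact
  interpret P: operad K "Pois K" unfolding Pois_def by (rule operad_P)
  let ?h = "has_arity K pois_arity"
  let ?e = "Gen PoisUnit :: ('k, pois_gen) expr"
  let ?p = "Gen PoisMult :: ('k, pois_gen) expr"
  let ?b = "Gen PoisBracket :: ('k, pois_gen) expr"
  have h: "?h ?e 0" "?h ?p 2" "?h ?b 2"
    using has_arity.intros(1)[of K pois_arity] by (metis pois_arity.simps)+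
  define \<eta> where "\<eta> = cl 0 ?e"
  define \<mu> where "\<mu> = cl 2 ?p"
  define \<nu> where "\<nu> = cl 2 ?b"
  have \<eta>: "\<eta> \<in> carrier (comps (Pois K) 0)" and \<mu>: "\<mu> \<in> carrier (comps (Pois K) 2)"
    and \<nu>: "\<nu> \<in> carrier (comps (Pois K) 2)"
    using h by (simp_all only: \<eta>_def \<mu>_def \<nu>_def Pois_def cl_car)
  have hI: "?h Ident 1" by (rule has_arity.intros)
  have value_eq: "model.same_value n s t" if "cl n s = cl n t" "?h s n" "?h t n" for n s t
    using that by (intro model.same_value_sound[OF Pois_model_rels[OF assms(1)]]) (simp_all add: cl_eq_iff)

  have \<mu>_unit: "pcomp (Pois K) 2 0 i \<mu> \<eta> = ident (Pois K)" if "i = 1 \<or> i = 2" for i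
    unfolding \<mu>_def \<eta>_def Pois_def ident_P
    by (rule relation_pcomp) (use that h hI in \<open>auto simp: Pois_rels_def Let_def simp del: One_nat_def\<close>)
  have \<nu>_unit: "pcomp (Pois K) 2 0 i \<nu> \<eta> = \<zero>\<^bsub>comps (Pois K) 1\<^esub>" if "i = 1 \<or> i = 2" for i
    unfolding \<nu>_def \<eta>_def Pois_def zero_P
    by (rule relation_pcomp)
      (use that h in \<open>auto simp: Pois_rels_def Let_def simp del: One_nat_def intro: has_arity.intros\<close>)
  have \<mu>_swap: "act (Pois K) 2 \<mu> swap12 = \<mu>"
    unfolding \<mu>_def Pois_def
    by (rule relation_act) (use h swap12_permutes in \<open>auto simp: Pois_rels_def Let_def simp del: One_nat_def\<close>)
  have \<nu>_swap: "act (Pois K) 2 \<nu> swap12 = \<ominus>\<^bsub>K\<^esub> \<one>\<^bsub>K\<^esub> \<odot>\<^bsub>comps (Pois K) 2\<^esub> \<nu>"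
  proof -
    have "act (Pois K) 2 \<nu> swap12 = cl 2 (Smult (\<ominus>\<^bsub>K\<^esub> \<one>\<^bsub>K\<^esub>) ?b)"
      unfolding \<nu>_def Pois_def
      by (rule relation_act)
        (use h swap12_permutes in \<open>auto simp: Pois_rels_def Let_def simp del: One_nat_def intro: has_arity.intros\<close>)
    then show ?thesis unfolding \<nu>_def Pois_def using h by (simp add: smult_P)
  qed

  let ?span = "\<lambda>a b. a \<odot>\<^bsub>comps (Pois K) 2\<^esub> \<mu> \<oplus>\<^bsub>comps (Pois K) 2\<^esub> b \<odot>\<^bsub>comps (Pois K) 2\<^esub> \<nu>"
  have independent: "a = a' \<and> b = b'"
    if ab: "a \<in> carrier K" "b \<in> carrier K" "a' \<in> carrier K" "b' \<in> carrier K" and eq: "?span a b = ?span a' b'"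
    for a b a' b'
  proof -
    let ?t = "\<lambda>a b. Plus (Smult a ?p) (Smult b ?b)"
    have ht: "?h (?t a b) 2" if "a \<in> carrier K" "b \<in> carrier K" for a b
      using that h by (intro has_arity.intros)
    have "cl 2 (?t a b) = ?span a b" if "a \<in> carrier K" "b \<in> carrier K" for a b
      using that h by (simp add: \<mu>_def \<nu>_def Pois_def cl_P Smult_closed)
    then have "model.same_value 2 (?t a b) (?t a' b')"
      using ab eq by (intro value_eq ht) simp_all
    then have "model.scal (?t a b) = model.scal (?t a' b')" "model.biv (?t a b) 1 2 = model.biv (?t a' b') 1 2"
      unfolding model.same_value_def by (blast, force)
    then show ?thesis using ab by (simp add: area_def)
  qed
  have span_0: "?span a \<zero>\<^bsub>K\<^esub> = a \<odot>\<^bsub>comps (Pois K) 2\<^esub> \<mu>" "?span \<zero>\<^bsub>K\<^esub> a = a \<odot>\<^bsub>comps (Pois K) 2\<^esub> \<nu>"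
    if "a \<in> carrier K" for a
    using that \<mu> \<nu> by simp_all
  have \<mu>_nonzero: "\<mu> \<noteq> \<zero>\<^bsub>comps (Pois K) 2\<^esub>" and \<nu>_nonzero: "\<nu> \<noteq> \<zero>\<^bsub>comps (Pois K) 2\<^esub>"
    using independent[of "\<one>\<^bsub>K\<^esub>" "\<zero>\<^bsub>K\<^esub>" "\<zero>\<^bsub>K\<^esub>" "\<zero>\<^bsub>K\<^esub>"]
      independent[of "\<zero>\<^bsub>K\<^esub>" "\<one>\<^bsub>K\<^esub>" "\<zero>\<^bsub>K\<^esub>" "\<zero>\<^bsub>K\<^esub>"] \<mu> \<nu> by auto
  have ident_nonzero: "ident (Pois K) \<noteq> \<zero>\<^bsub>comps (Pois K) 1\<^esub>"
  proof
    assume "ident (Pois K) = \<zero>\<^bsub>comps (Pois K) 1\<^esub>"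
    then have "cl 1 Ident = cl 1 (Zero 1)" by (simp only: Pois_def ident_P zero_P)
    then have "model.same_value 1 Ident (Zero 1)" by (rule value_eq) (intro has_arity.intros)+
    then show False by (simp add: model.same_value_def)
  qed

  define G where "G n = (if n = 2 then {\<mu>, \<nu>} else {})" for n :: nat
  let ?S = "{?span a b | a b. a \<in> carrier K \<and> b \<in> carrier K}"
  have plug: "P.generated G (n - 1) (pcomp (Pois K) n 0 i x \<eta>)" if "x \<in> G n" "1 \<le> i" "i \<le> n" for n x i
  proof -
    have "n = 2" "x = \<mu> \<or> x = \<nu>" using that by (auto simp: G_def split: if_splits)
    moreover from this that have "i = 1 \<or> i = 2" by auto
    ultimately show ?thesis
      using \<mu>_unit \<nu>_unit P.generated.ident[of G] P.generated.zero[of G 1] by auto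
  qed
  have G01: "G 0 = {}" "G 1 = {}" by (simp_all add: G_def)
  have generated: "if n = 0 then x \<in> (\<lambda>c. c \<odot>\<^bsub>comps (Pois K) 0\<^esub> \<eta>) ` carrier K else P.generated G n x"
    if "x \<in> carrier (comps (Pois K) n)" for n x
  proof (rule P.generated_unital[OF \<eta> G01 plug])
    have gens: "{cl n (Gen g) | g. pois_arity g = n} = (G(0 := {\<eta>})) n" for n
    proof (intro equalityI subsetI)
      fix x assume "x \<in> {cl n (Gen g) | g. pois_arity g = n}"
      then obtain g where g: "x = cl n (Gen g)" "pois_arity g = n" by blast
      then show "x \<in> (G(0 := {\<eta>})) n" by (cases g) (simp_all add: G_def \<mu>_def \<nu>_def \<eta>_def)
    next
      fix x assume "x \<in> (G(0 := {\<eta>})) n"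
      then consider "n = 0" "x = \<eta>" | "n = 2" "x = \<mu>" | "n = 2" "x = \<nu>"
        by (auto simp: G_def split: if_splits)
      then show "x \<in> {cl n (Gen g) | g. pois_arity g = n}"
        unfolding \<mu>_def \<nu>_def \<eta>_def
        by cases (metis (mono_tags, lifting) mem_Collect_eq pois_arity.simps)+
    qed
    from that obtain t where "?h t n" "x = cl n t" by (auto simp: Pois_def car)
    then show "P.generated (G(0 := {\<eta>})) n x"
      using presented_generated[of t n] unfolding Pois_def gens by (simp only:)
  qed
  have S: "G 2 \<subseteq> ?S" "\<zero>\<^bsub>comps (Pois K) 2\<^esub> \<in> ?S"
  proof -
    have "\<mu> = ?span \<one>\<^bsub>K\<^esub> \<zero>\<^bsub>K\<^esub>" "\<nu> = ?span \<zero>\<^bsub>K\<^esub> \<one>\<^bsub>K\<^esub>" "\<zero>\<^bsub>comps (Pois K) 2\<^esub> = ?span \<zero>\<^bsub>K\<^esub> \<zero>\<^bsub>K\<^esub>"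
      using \<mu> \<nu> by simp_all
    then show "G 2 \<subseteq> ?S" "\<zero>\<^bsub>comps (Pois K) 2\<^esub> \<in> ?S"
      unfolding G_def by (auto intro: K.one_closed K.zero_closed)
  qed
  have span_add: "?span a b \<oplus>\<^bsub>comps (Pois K) 2\<^esub> ?span a' b' = ?span (a \<oplus>\<^bsub>K\<^esub> a') (b \<oplus>\<^bsub>K\<^esub> b')"
    if "a \<in> carrier K" "b \<in> carrier K" "a' \<in> carrier K" "b' \<in> carrier K" for a b a' b'
    using that \<mu> \<nu> by (simp add: P.M.smult_l_distr P.M.M.a_ac)
  have span_smult: "c \<odot>\<^bsub>comps (Pois K) 2\<^esub> ?span a b = ?span (c \<otimes>\<^bsub>K\<^esub> a) (c \<otimes>\<^bsub>K\<^esub> b)"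
    if "c \<in> carrier K" "a \<in> carrier K" "b \<in> carrier K" for a b c
    using that \<mu> \<nu> by (simp add: P.M.smult_r_distr P.M.smult_assoc1)
  have span_swap: "act (Pois K) 2 (?span a b) swap12 = ?span a (\<ominus>\<^bsub>K\<^esub> b)"
    if "a \<in> carrier K" "b \<in> carrier K" for a b
  proof -
    have "act (Pois K) 2 (?span a b) swap12
        = a \<odot>\<^bsub>comps (Pois K) 2\<^esub> act (Pois K) 2 \<mu> swap12
          \<oplus>\<^bsub>comps (Pois K) 2\<^esub> b \<odot>\<^bsub>comps (Pois K) 2\<^esub> act (Pois K) 2 \<nu> swap12"
      using that \<mu> \<nu> swap12_permutes by (simp only: P.act_add P.act_smult P.M.smult_closed)
    also have "\<dots> = ?span a (b \<otimes>\<^bsub>K\<^esub> \<ominus>\<^bsub>K\<^esub> \<one>\<^bsub>K\<^esub>)"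
      unfolding \<mu>_swap \<nu>_swap using that \<mu> \<nu> by (simp add: P.M.smult_assoc1)
    finally show ?thesis using that by (simp add: K.r_minus)
  qed
  have low: "(n = 1 \<longrightarrow> x \<in> (\<lambda>c. c \<odot>\<^bsub>comps (Pois K) 1\<^esub> ident (Pois K)) ` carrier K) \<and> (n = 2 \<longrightarrow> x \<in> ?S)"
    if "x \<in> carrier (comps (Pois K) n)" "n \<noteq> 0" for x n
  proof -
    have add: "x \<oplus>\<^bsub>comps (Pois K) 2\<^esub> y \<in> ?S" if "x \<in> ?S" "y \<in> ?S" for x y
      using that by (auto simp only: mem_Collect_eq span_add) (metis K.a_closed)
    have smult: "c \<odot>\<^bsub>comps (Pois K) 2\<^esub> x \<in> ?S" if "c \<in> carrier K" "x \<in> ?S" for c x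
      using that by (auto simp only: mem_Collect_eq span_smult) (metis K.m_closed)
    have swap: "act (Pois K) 2 x swap12 \<in> ?S" if "x \<in> ?S" for x
      using that by (auto simp only: mem_Collect_eq span_swap) (metis K.a_inv_closed)
    have "P.generated G n x" using generated[OF that(1)] that(2) by simp
    from P.generated_low_arity[OF G01 S add smult swap this] show ?thesis by blast
  qed
  have P1: "carrier (comps (Pois K) 1) = (\<lambda>c. c \<odot>\<^bsub>comps (Pois K) 1\<^esub> ident (Pois K)) ` carrier K"
    using low[of _ 1] P.ident_closed by auto

  have self_neg: "a = \<zero>\<^bsub>K\<^esub>" if "a \<in> carrier K" "a = \<ominus>\<^bsub>K\<^esub> a" for a
  proof -
    have "(\<one>\<^bsub>K\<^esub> \<oplus>\<^bsub>K\<^esub> \<one>\<^bsub>K\<^esub>) \<otimes>\<^bsub>K\<^esub> a = a \<oplus>\<^bsub>K\<^esub> \<ominus>\<^bsub>K\<^esub> a"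
      using that by (simp add: K.l_distr)
    then show ?thesis using that(1) char by (simp add: K.r_neg K.integral_iff)
  qed
  have eigen: "\<exists>a\<in>carrier K. \<exists>b\<in>carrier K. d 2 \<mu> = a \<odot>\<^bsub>comps (Pois K) 2\<^esub> \<mu> \<and> d 2 \<nu> = b \<odot>\<^bsub>comps (Pois K) 2\<^esub> \<nu>"
    if d: "derivation K (Pois K) d" for d
  proof -
    obtain a b where ab: "a \<in> carrier K" "b \<in> carrier K" "d 2 \<mu> = ?span a b"
      using low[OF derivation_closed[OF d \<mu>]] by auto
    obtain a' b' where ab': "a' \<in> carrier K" "b' \<in> carrier K" "d 2 \<nu> = ?span a' b'"
      using low[OF derivation_closed[OF d \<nu>]] by auto
    have "?span a b = ?span a (\<ominus>\<^bsub>K\<^esub> b)"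
      using derivation_act[OF d \<mu> swap12_permutes] ab by (simp only: \<mu>_swap span_swap)
    then have "b = \<ominus>\<^bsub>K\<^esub> b" using independent ab by blast
    then have b: "b = \<zero>\<^bsub>K\<^esub>" using self_neg ab by blast
    have "\<ominus>\<^bsub>K\<^esub> \<one>\<^bsub>K\<^esub> \<odot>\<^bsub>comps (Pois K) 2\<^esub> ?span a' b' = ?span a' (\<ominus>\<^bsub>K\<^esub> b')"
      using derivation_act[OF d \<nu> swap12_permutes] derivation_smult[OF d _ \<nu>, of "\<ominus>\<^bsub>K\<^esub> \<one>\<^bsub>K\<^esub>"] ab'
      by (simp add: \<nu>_swap span_swap del: One_nat_def)
    then have "?span (\<ominus>\<^bsub>K\<^esub> a') (\<ominus>\<^bsub>K\<^esub> b') = ?span a' (\<ominus>\<^bsub>K\<^esub> b')"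
      using ab' span_smult[of "\<ominus>\<^bsub>K\<^esub> \<one>\<^bsub>K\<^esub>" a' b'] by (simp add: K.l_minus)
    then have "\<ominus>\<^bsub>K\<^esub> a' = a'" using independent[of "\<ominus>\<^bsub>K\<^esub> a'" "\<ominus>\<^bsub>K\<^esub> b'" a' "\<ominus>\<^bsub>K\<^esub> b'"] ab' by blast
    then have a': "a' = \<zero>\<^bsub>K\<^esub>" using self_neg ab' by metis
    show ?thesis using ab ab' span_0 unfolding a' b by metis
  qed
  have unique: "d = d'"
    if d: "derivation K (Pois K) d" and d': "derivation K (Pois K) d'"
      and eq: "d 2 \<mu> = d' 2 \<mu>" "d 2 \<nu> = d' 2 \<nu>" for d d'
  proof (rule presented_derivation_eqI)
    have on_unit: "\<exists>c\<in>carrier K. e 0 \<eta> = c \<odot>\<^bsub>comps (Pois K) 0\<^esub> \<eta> \<and>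
        pcomp (Pois K) 2 0 1 (e 2 \<mu>) \<eta> \<oplus>\<^bsub>comps (Pois K) 1\<^esub> c \<odot>\<^bsub>comps (Pois K) 1\<^esub> ident (Pois K)
          = \<zero>\<^bsub>comps (Pois K) 1\<^esub>"
      if e: "derivation K (Pois K) e" for e
    proof -
      obtain c where c: "c \<in> carrier K" "e 0 \<eta> = c \<odot>\<^bsub>comps (Pois K) 0\<^esub> \<eta>"
        using generated[OF derivation_closed[OF e \<eta>]] by auto
      have "pcomp (Pois K) 2 0 1 \<mu> (e 0 \<eta>) = c \<odot>\<^bsub>comps (Pois K) 1\<^esub> ident (Pois K)"
        unfolding c(2) using P.pcomp_smult_right[OF c(1) \<mu> \<eta>, of 1] \<mu>_unit[of 1] by simp
      then show ?thesis
        using derivation_pcomp[OF e \<mu> \<eta>, of 1] \<mu>_unit[of 1] P.derivation_ident[OF e] c by auto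
    qed
    obtain c where c: "c \<in> carrier K" "d 0 \<eta> = c \<odot>\<^bsub>comps (Pois K) 0\<^esub> \<eta>"
      "pcomp (Pois K) 2 0 1 (d 2 \<mu>) \<eta> \<oplus>\<^bsub>comps (Pois K) 1\<^esub> c \<odot>\<^bsub>comps (Pois K) 1\<^esub> ident (Pois K)
        = \<zero>\<^bsub>comps (Pois K) 1\<^esub>"
      using on_unit[OF d] by blast
    obtain c' where c': "c' \<in> carrier K" "d' 0 \<eta> = c' \<odot>\<^bsub>comps (Pois K) 0\<^esub> \<eta>"
      "pcomp (Pois K) 2 0 1 (d 2 \<mu>) \<eta> \<oplus>\<^bsub>comps (Pois K) 1\<^esub> c' \<odot>\<^bsub>comps (Pois K) 1\<^esub> ident (Pois K)
        = \<zero>\<^bsub>comps (Pois K) 1\<^esub>"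
      using on_unit[OF d'] unfolding eq by blast
    have cl1: "pcomp (Pois K) 2 0 1 (d 2 \<mu>) \<eta> \<in> carrier (comps (Pois K) 1)"
      using P.pcomp_closed[OF derivation_closed[OF d \<mu>] \<eta>, of 1] by simp
    have "c \<odot>\<^bsub>comps (Pois K) 1\<^esub> ident (Pois K) = c' \<odot>\<^bsub>comps (Pois K) 1\<^esub> ident (Pois K)"
      using c(3) c'(3) cl1 P.M.smult_closed[OF c(1) P.ident_closed] P.M.smult_closed[OF c'(1) P.ident_closed]
        P.M.M.add.Units_l_cancel by (metis P.M.M.add.Units_eq)
    then have "c = c'" by (rule P.smult_cancel[OF P.ident_closed ident_nonzero c(1) c'(1)])
    then show "d (pois_arity g) (cl (pois_arity g) (Gen g)) = d' (pois_arity g) (cl (pois_arity g) (Gen g))" for g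
      using eq c(2) c'(2) by (cases g) (simp_all add: \<eta>_def \<mu>_def \<nu>_def)
  qed (use d d' in \<open>simp_all add: Pois_def\<close>)

  have euler: "derivation K (Pois K) W.euler_der"
    using W.euler_der_derivation by (simp only: Pois_def)
  have euler_\<mu>: "W.euler_der 2 \<mu> = \<zero>\<^bsub>comps (Pois K) 2\<^esub>"
    using h(2) \<mu> unfolding \<mu>_def Pois_def by (simp add: W.euler_der_cl smult_P[symmetric])
  have euler_\<nu>: "W.euler_der 2 \<nu> = \<nu>"
    using h(3) \<nu> unfolding \<nu>_def Pois_def by (simp add: W.euler_der_cl smult_P[symmetric])
  show "lie_iso K (der K (Pois K)) (lie_dsum (lie_base K) (lie_base K))"
    by (rule P.derivations_two_dimensional(1)[OF P1 \<mu> \<mu>_nonzero \<nu> \<nu>_nonzero _ _ euler euler_\<mu> euler_\<nu>],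
        erule eigen, rule unique)
  show "lie_iso K (H1 K (Pois K)) (lie_base K)"
    by (rule P.derivations_two_dimensional(2)[OF P1 \<mu> \<mu>_nonzero \<nu> \<nu>_nonzero _ _ euler euler_\<mu> euler_\<nu>],
        erule eigen, rule unique)
qed


section \<open>Derivations of the four operads\<close>

theorem theorem0p3:
  fixes K :: "('k, 'r) ring_scheme"
  assumes "field K"
  shows "(lie_iso K (der K (Ass K)) (lie_base K) \<and> lie_trivial (H1 K (Ass K)))
    \<and> (lie_iso K (der K (Com K)) (lie_base K) \<and> lie_trivial (H1 K (Com K)))
    \<and> (lie_iso K (der K (Lie K)) (lie_base K) \<and> lie_trivial (H1 K (Lie K)))
    \<and> (\<one>\<^bsub>K\<^esub> \<oplus>\<^bsub>K\<^esub> \<one>\<^bsub>K\<^esub> \<noteq> \<zero>\<^bsub>K\<^esub> \<longrightarrow>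
        lie_iso K (der K (Pois K)) (lie_dsum (lie_base K) (lie_base K))
        \<and> lie_iso K (H1 K (Pois K)) (lie_base K))"
proof -
  interpret associative_operad K by (rule associative_operad.intro) fact
  show ?thesis
    using Ass_derivations Com_derivations[OF assms] Lie_derivations[OF assms] Pois_derivations[OF assms]
    by blast
qed

end
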